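(* Let $G$ be a compact, non-trivial, connected Lie group. Then \[ \beta_n^{(2)}(C(G),\Delta_c)=0 \] for all $n\in\mathbb{N}_0=\{0,1,2,\dots\}$.
   Context: Here $(C(G),\Delta_c)$ is the compact quantum group with comultiplication $\Delta_c\colon C(G)\to C(G)\otimes C(G)=C(G\times G)$, $\Delta_c(f)(s,t)=f(st)$. Let $\mu$ be the Haar probability measure on $G$, let $A_0\subseteq C(G)$ be the $*$-algebra spanned by matrix coefficients of irreducible (finite-dimensional, unitary, continuous) representations of $G$, and let $\varepsilon\colon A_0\to\mathbb{C}$ be evaluation at the identity of $G$ (the counit). The Haar state is $h(f)=\int_G f\,d\mu$ (tracial) and the enveloping von Neumann algebra is $\mathscr{M}=L^\infty(G,\mu)$ acting on $L^2(G,\mu)$. The $L^2$-Betti numbers are \[ \beta_n^{(2)}(C(G),\Delta_c)=\dim_{\mathscr{M}}\operatorname{Tor}_n^{A_0}(L^\infty(G,\mu),\mathbb{C}), \] where $\mathbb{C}$ is a left $A_0$-module via $\varepsilon$ and $L^\infty(G,\mu)$ is a right $A_0$-module via inclusion. Dimension. With $\tau(f)=\int_G f\,d\mu$ on $\mathscr{M}$: if $P\cong\mathscr{M}^kE$ is a finitely generated projective module, $E\in M_k(\mathscr{M})$ a projection, then $\dim_{\mathscr{M}}P=\sum_i\tau(E_{ii})$; for an arbitrary $\mathscr{M}$-module $Q$, $\dim_{\mathscr{M}}Q=\sup\{\dim_{\mathscr{M}}P\mid P\subseteq Q\text{ finitely generated projective submodule}\}\in[0,\infty]$ (Lück). *)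

theory Defs
  imports
    "HOL-Probability.Probability"
    "Jordan_Normal_Form.Matrix"
    "HOL-Algebra.Free_Abelian_Groups"
    "HOL-Algebra.Generated_Groups"
    "HOL-Algebra.Module"
    "HOL-Algebra.QuotRing"
begin

section \<open>Lie groups and Haar measure\<close>

text \<open>Only meaningful for open \<open>S\<close>: \<open>f\<close> is \<open>k\<close> times continuously differentiable on \<open>S\<close>,
  expressed by iterated directional derivatives.\<close>

fun Ck_on :: "nat \<Rightarrow> 'a::euclidean_space set \<Rightarrow> ('a \<Rightarrow> 'b::euclidean_space) \<Rightarrow> bool" where
  "Ck_on 0 S f \<longleftrightarrow> continuous_on S f"
| "Ck_on (Suc k) S f \<longleftrightarrow>
     (\<forall>x\<in>S. f differentiable (at x)) \<and> (\<forall>v. Ck_on k S (\<lambda>x. frechet_derivative f (at x) v))"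

definition smooth_on :: "'a::euclidean_space set \<Rightarrow> ('a \<Rightarrow> 'b::euclidean_space) \<Rightarrow> bool" where
  "smooth_on S f \<longleftrightarrow> (\<forall>k. Ck_on k S f)"

definition smooth_atlas :: "('g::topological_space set \<times> ('g \<Rightarrow> 'e::euclidean_space)) set \<Rightarrow> bool" where
  "smooth_atlas \<A> \<longleftrightarrow>
     (\<Union>(U, \<phi>)\<in>\<A>. U) = UNIV \<and>
     (\<forall>(U, \<phi>)\<in>\<A>. open U \<and> open (\<phi> ` U) \<and> homeomorphism U (\<phi> ` U) \<phi> (inv_into U \<phi>)) \<and>
     (\<forall>(U, \<phi>)\<in>\<A>. \<forall>(V, \<psi>)\<in>\<A>. smooth_on (\<phi> ` (U \<inter> V)) (\<psi> \<circ> inv_into U \<phi>))"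

text \<open>Hausdorffness and second countability of the underlying manifold are provided by the type
  classes. The model space has dimension at least 1; the only connected Lie group of
  dimension 0 is the trivial one.\<close>

definition lie_group ::
  "'g::{t2_space, second_countable_topology} monoid
     \<Rightarrow> ('g set \<times> ('g \<Rightarrow> 'e::euclidean_space)) set \<Rightarrow> bool" where
  "lie_group G \<A> \<longleftrightarrow>
     group G \<and> carrier G = UNIV \<and> smooth_atlas \<A> \<and>
     continuous_on UNIV (\<lambda>(x, y). x \<otimes>\<^bsub>G\<^esub> y) \<and>
     continuous_on UNIV (\<lambda>x. inv\<^bsub>G\<^esub> x) \<and>
     (\<forall>(U, \<phi>)\<in>\<A>. \<forall>(V, \<psi>)\<in>\<A>. \<forall>(W, \<xi>)\<in>\<A>.
        smooth_on {(x, y). x \<in> \<phi> ` U \<and> y \<in> \<psi> ` V \<and> inv_into U \<phi> x \<otimes>\<^bsub>G\<^esub> inv_into V \<psi> y \<in> W}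
          (\<lambda>(x, y). \<xi> (inv_into U \<phi> x \<otimes>\<^bsub>G\<^esub> inv_into V \<psi> y))) \<and>
     (\<forall>(U, \<phi>)\<in>\<A>. \<forall>(V, \<psi>)\<in>\<A>.
        smooth_on {x. x \<in> \<phi> ` U \<and> inv\<^bsub>G\<^esub> (inv_into U \<phi> x) \<in> V}
          (\<lambda>x. \<psi> (inv\<^bsub>G\<^esub> (inv_into U \<phi> x))))"

definition haar_probability :: "'g::topological_space monoid \<Rightarrow> 'g measure \<Rightarrow> bool" where
  "haar_probability G \<mu> \<longleftrightarrow>
     prob_space \<mu> \<and> sets \<mu> = sets borel \<and>
     (\<forall>s\<in>carrier G. distr \<mu> borel (\<lambda>t. s \<otimes>\<^bsub>G\<^esub> t) = \<mu>)"


section \<open>The algebra of matrix coefficients\<close>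

definition unitary_rep :: "'g::topological_space monoid \<Rightarrow> nat \<Rightarrow> ('g \<Rightarrow> complex mat) \<Rightarrow> bool" where
  "unitary_rep G d \<pi> \<longleftrightarrow>
     (\<forall>g\<in>carrier G. \<pi> g \<in> carrier_mat d d \<and> map_mat cnj (transpose_mat (\<pi> g)) * \<pi> g = 1\<^sub>m d) \<and>
     (\<forall>g\<in>carrier G. \<forall>h\<in>carrier G. \<pi> (g \<otimes>\<^bsub>G\<^esub> h) = \<pi> g * \<pi> h) \<and>
     (\<forall>i<d. \<forall>j<d. continuous_on (carrier G) (\<lambda>g. \<pi> g $$ (i, j)))"

definition invariant_subspace ::
  "'g monoid \<Rightarrow> nat \<Rightarrow> ('g \<Rightarrow> complex mat) \<Rightarrow> complex vec set \<Rightarrow> bool" where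
  "invariant_subspace G d \<pi> W \<longleftrightarrow>
     W \<subseteq> carrier_vec d \<and> 0\<^sub>v d \<in> W \<and>
     (\<forall>v\<in>W. \<forall>w\<in>W. v + w \<in> W) \<and> (\<forall>c. \<forall>v\<in>W. c \<cdot>\<^sub>v v \<in> W) \<and>
     (\<forall>g\<in>carrier G. \<forall>v\<in>W. \<pi> g *\<^sub>v v \<in> W)"

definition irreducible_rep :: "'g::topological_space monoid \<Rightarrow> nat \<Rightarrow> ('g \<Rightarrow> complex mat) \<Rightarrow> bool" where
  "irreducible_rep G d \<pi> \<longleftrightarrow>
     unitary_rep G d \<pi> \<and> 0 < d \<and>
     (\<forall>W. invariant_subspace G d \<pi> W \<longrightarrow> W = {0\<^sub>v d} \<or> W = carrier_vec d)"

definition matrix_coeffs :: "'g::topological_space monoid \<Rightarrow> ('g \<Rightarrow> complex) set" where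
  "matrix_coeffs G =
     {\<lambda>g. \<pi> g $$ (i, j) | d \<pi> i j. irreducible_rep G d \<pi> \<and> i < d \<and> j < d}"

definition fun_ring :: "('g \<Rightarrow> complex) set \<Rightarrow> ('g \<Rightarrow> complex) ring" where
  "fun_ring S =
     \<lparr>carrier = S, mult = (\<lambda>f g x. f x * g x), one = (\<lambda>_. 1),
      ring.zero = (\<lambda>_. 0), ring.add = (\<lambda>f g x. f x + g x)\<rparr>"

text \<open>The linear span of the matrix coefficients.\<close>

definition coeff_algebra :: "'g::topological_space monoid \<Rightarrow> ('g \<Rightarrow> complex) ring" where
  "coeff_algebra G =
     fun_ring {\<lambda>x. \<Sum>u\<in>F. c u * u x | F c. finite F \<and> F \<subseteq> matrix_coeffs G}"


section \<open>Modules over a commutative ring\<close>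

text \<open>The HOL-Algebra module record extends the ring record; the \<open>mult\<close> and \<open>one\<close> entries of a
  module play no role and are left unspecified below.\<close>

definition mod_hom ::
  "'r ring \<Rightarrow> ('r, 'a) module \<Rightarrow> ('r, 'b) module \<Rightarrow> ('a \<Rightarrow> 'b) set" where
  "mod_hom R M N =
     {h \<in> carrier M \<rightarrow> carrier N.
        (\<forall>x\<in>carrier M. \<forall>y\<in>carrier M. h (x \<oplus>\<^bsub>M\<^esub> y) = h x \<oplus>\<^bsub>N\<^esub> h y) \<and>
        (\<forall>r\<in>carrier R. \<forall>x\<in>carrier M. h (r \<odot>\<^bsub>M\<^esub> x) = r \<odot>\<^bsub>N\<^esub> h x)}"

definition mod_iso ::
  "'r ring \<Rightarrow> ('r, 'a) module \<Rightarrow> ('r, 'b) module \<Rightarrow> bool" where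
  "mod_iso R M N \<longleftrightarrow> (\<exists>h\<in>mod_hom R M N. bij_betw h (carrier M) (carrier N))"

definition quot_module :: "('r, 'a) module \<Rightarrow> 'a set \<Rightarrow> ('r, 'a set) module" where
  "quot_module M N =
     \<lparr>carrier = a_rcosets\<^bsub>M\<^esub> N, mult = undefined, one = undefined,
      ring.zero = N, ring.add = set_add M,
      smult = (\<lambda>r X. \<Union>x\<in>X. N +>\<^bsub>M\<^esub> (r \<odot>\<^bsub>M\<^esub> x))\<rparr>"

definition is_basis :: "'r ring \<Rightarrow> ('r, 'a) module \<Rightarrow> 'a set \<Rightarrow> bool" where
  "is_basis R M B \<longleftrightarrow>
     B \<subseteq> carrier M \<and>
     (\<forall>x\<in>carrier M. \<exists>!c. c \<in> UNIV \<rightarrow> carrier R \<and> finite {b. c b \<noteq> \<zero>\<^bsub>R\<^esub>} \<and>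
        {b. c b \<noteq> \<zero>\<^bsub>R\<^esub>} \<subseteq> B \<and> x = (\<Oplus>\<^bsub>M\<^esub>b\<in>{b. c b \<noteq> \<zero>\<^bsub>R\<^esub>}. c b \<odot>\<^bsub>M\<^esub> b))"

definition free_resolution ::
  "'r ring \<Rightarrow> ('r, 'n) module \<Rightarrow> (nat \<Rightarrow> ('r, 'p) module) \<Rightarrow> (nat \<Rightarrow> 'p \<Rightarrow> 'p) \<Rightarrow> ('p \<Rightarrow> 'n) \<Rightarrow> bool" where
  "free_resolution R N P d e \<longleftrightarrow>
     (\<forall>n. Module.module R (P n) \<and> (\<exists>B. is_basis R (P n) B)) \<and>
     e \<in> mod_hom R (P 0) N \<and> (\<forall>n. d n \<in> mod_hom R (P (Suc n)) (P n)) \<and>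
     e ` carrier (P 0) = carrier N \<and>
     d 0 ` carrier (P (Suc 0)) = {x \<in> carrier (P 0). e x = \<zero>\<^bsub>N\<^esub>} \<and>
     (\<forall>n. d (Suc n) ` carrier (P (Suc (Suc n))) =
            {x \<in> carrier (P (Suc n)). d n x = \<zero>\<^bsub>P n\<^esub>})"


section \<open>Tensor products, homology and Tor\<close>

text \<open>Let \<open>i\<close> be a homomorphism of commutative rings from \<open>R\<close> to \<open>S\<close>. The tensor product of \<open>S\<close> (as an
  \<open>R\<close>-module along \<open>i\<close>) with an \<open>R\<close>-module \<open>P\<close> is the free abelian group on pairs modulo the
  bilinear and balancing relations, with \<open>S\<close> acting on the left factor.\<close>

definition tensor_relations ::
  "'s ring \<Rightarrow> 'r ring \<Rightarrow> ('r \<Rightarrow> 's) \<Rightarrow> ('r, 'p) module \<Rightarrow> ('s \<times> 'p \<Rightarrow>\<^sub>0 int) set" where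
  "tensor_relations S R i P =
     generate (free_Abelian_group (carrier S \<times> carrier P))
       ({frag_of (s \<oplus>\<^bsub>S\<^esub> t, p) - frag_of (s, p) - frag_of (t, p) | s t p.
           s \<in> carrier S \<and> t \<in> carrier S \<and> p \<in> carrier P} \<union>
        {frag_of (s, p \<oplus>\<^bsub>P\<^esub> q) - frag_of (s, p) - frag_of (s, q) | s p q.
           s \<in> carrier S \<and> p \<in> carrier P \<and> q \<in> carrier P} \<union>
        {frag_of (s \<otimes>\<^bsub>S\<^esub> i r, p) - frag_of (s, r \<odot>\<^bsub>P\<^esub> p) | s r p.
           s \<in> carrier S \<and> r \<in> carrier R \<and> p \<in> carrier P})"

definition tensor ::
  "'s ring \<Rightarrow> 'r ring \<Rightarrow> ('r \<Rightarrow> 's) \<Rightarrow> ('r, 'p) module \<Rightarrow> ('s, ('s \<times> 'p \<Rightarrow>\<^sub>0 int) set) module" where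
  "tensor S R i P =
     (let F = free_Abelian_group (carrier S \<times> carrier P); K = tensor_relations S R i P in
      \<lparr>carrier = carrier (F Mod K), mult = undefined, one = undefined,
       ring.zero = \<one>\<^bsub>F Mod K\<^esub>, ring.add = mult (F Mod K),
       smult = (\<lambda>s X. \<Union>f\<in>X. K #>\<^bsub>F\<^esub> frag_extend (\<lambda>(t, p). frag_of (s \<otimes>\<^bsub>S\<^esub> t, p)) f)\<rparr>)"

definition tensor_map ::
  "'s ring \<Rightarrow> 'r ring \<Rightarrow> ('r \<Rightarrow> 's) \<Rightarrow> ('r, 'q) module \<Rightarrow> ('p \<Rightarrow> 'q)
     \<Rightarrow> ('s \<times> 'p \<Rightarrow>\<^sub>0 int) set \<Rightarrow> ('s \<times> 'q \<Rightarrow>\<^sub>0 int) set" where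
  "tensor_map S R i Q h X =
     (\<Union>f\<in>X. tensor_relations S R i Q #>\<^bsub>free_Abelian_group (carrier S \<times> carrier Q)\<^esub>
        frag_extend (\<lambda>(s, p). frag_of (s, h p)) f)"

text \<open>The differential \<open>d n\<close> maps \<open>C (Suc n)\<close> to \<open>C n\<close>.\<close>

fun cycles :: "(nat \<Rightarrow> ('s, 'c) module) \<Rightarrow> (nat \<Rightarrow> 'c \<Rightarrow> 'c) \<Rightarrow> nat \<Rightarrow> 'c set" where
  "cycles C d 0 = carrier (C 0)"
| "cycles C d (Suc n) = {x \<in> carrier (C (Suc n)). d n x = \<zero>\<^bsub>C n\<^esub>}"

definition homology_module ::
  "(nat \<Rightarrow> ('s, 'c) module) \<Rightarrow> (nat \<Rightarrow> 'c \<Rightarrow> 'c) \<Rightarrow> nat \<Rightarrow> ('s, 'c set) module" where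
  "homology_module C d n =
     quot_module ((C n)\<lparr>carrier := cycles C d n\<rparr>) (d n ` carrier (C (Suc n)))"

text \<open>Tor is computed from an arbitrarily chosen free resolution. The elements of its modules are
  functions on the type \<open>cell\<close> below, which is large enough to label bases of the free modules in
  some free resolution of any \<open>R\<close>-module \<open>N\<close>; see \<open>free_resolution_exists\<close>.\<close>

datatype ('r, 'n) cell = Gen 'n | Syz "(('r, 'n) cell \<times> 'r) list"

definition chosen_resolution ::
  "'r ring \<Rightarrow> ('r, 'n) module \<Rightarrow>
     (nat \<Rightarrow> ('r, ('r, 'n) cell \<Rightarrow> 'r) module) \<times>
     (nat \<Rightarrow> (('r, 'n) cell \<Rightarrow> 'r) \<Rightarrow> (('r, 'n) cell \<Rightarrow> 'r)) \<times> ((('r, 'n) cell \<Rightarrow> 'r) \<Rightarrow> 'n)" where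
  "chosen_resolution R N = (SOME (P, d, e). free_resolution R N P d e)"

definition Tor ::
  "'s ring \<Rightarrow> 'r ring \<Rightarrow> ('r \<Rightarrow> 's) \<Rightarrow> ('r, 'n) module \<Rightarrow> nat
     \<Rightarrow> ('s, ('s \<times> (('r, 'n) cell \<Rightarrow> 'r) \<Rightarrow>\<^sub>0 int) set set) module" where
  "Tor S R i N n =
     (let (P, d, e) = chosen_resolution R N in
      homology_module (\<lambda>k. tensor S R i (P k)) (\<lambda>k. tensor_map S R i (P k) (d k)) n)"

subsection \<open>Existence of free resolutions\<close>

definition free_mod :: "'r ring \<Rightarrow> 'x set \<Rightarrow> ('r, 'x \<Rightarrow> 'r) module" where
  "free_mod R X =
     \<lparr>carrier = {f. f \<in> UNIV \<rightarrow> carrier R \<and> finite {x. f x \<noteq> \<zero>\<^bsub>R\<^esub>} \<and> {x. f x \<noteq> \<zero>\<^bsub>R\<^esub>} \<subseteq> X},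
      mult = undefined, one = undefined,
      ring.zero = (\<lambda>_. \<zero>\<^bsub>R\<^esub>), ring.add = (\<lambda>f g x. f x \<oplus>\<^bsub>R\<^esub> g x), smult = (\<lambda>r f x. r \<otimes>\<^bsub>R\<^esub> f x)\<rparr>"

definition lin_ext :: "'r ring \<Rightarrow> ('r, 'a) module \<Rightarrow> ('x \<Rightarrow> 'a) \<Rightarrow> ('x \<Rightarrow> 'r) \<Rightarrow> 'a" where
  "lin_ext R M \<phi> f = (\<Oplus>\<^bsub>M\<^esub>x\<in>{x. f x \<noteq> \<zero>\<^bsub>R\<^esub>}. f x \<odot>\<^bsub>M\<^esub> \<phi> x)"

lemma free_mod_module:
  assumes "cring R" shows "Module.module R (free_mod R X)"
proof -
  interpret cring R by fact
  have fin: "finite {x. f x \<oplus>\<^bsub>R\<^esub> g x \<noteq> \<zero>\<^bsub>R\<^esub>}"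
    if "finite {x. f x \<noteq> \<zero>\<^bsub>R\<^esub>}" "finite {x. g x \<noteq> \<zero>\<^bsub>R\<^esub>}" for f g :: "'b \<Rightarrow> 'a"
    by (rule finite_subset[of _ "{x. f x \<noteq> \<zero>\<^bsub>R\<^esub>} \<union> {x. g x \<noteq> \<zero>\<^bsub>R\<^esub>}"]) (use that in auto)
  show ?thesis
  proof (rule moduleI)
    show "cring R" by fact
    show "abelian_group (free_mod R X)"
    proof (rule abelian_groupI)
      fix f g assume fg: "f \<in> carrier (free_mod R X)" "g \<in> carrier (free_mod R X)"
      then have "{x. f x \<oplus>\<^bsub>R\<^esub> g x \<noteq> \<zero>\<^bsub>R\<^esub>} \<subseteq> {x. f x \<noteq> \<zero>\<^bsub>R\<^esub>} \<union> {x. g x \<noteq> \<zero>\<^bsub>R\<^esub>}" by auto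
      moreover have "\<dots> \<subseteq> X" using fg by (auto simp: free_mod_def)
      ultimately show "f \<oplus>\<^bsub>free_mod R X\<^esub> g \<in> carrier (free_mod R X)"
        using fg fin[of f g] by (auto simp: free_mod_def Pi_iff)
    next
      fix f assume f: "f \<in> carrier (free_mod R X)"
      have "(\<lambda>x. \<ominus>\<^bsub>R\<^esub> f x) \<in> carrier (free_mod R X)"
        using f finite_subset[of "{x. \<ominus>\<^bsub>R\<^esub> f x \<noteq> \<zero>\<^bsub>R\<^esub>}" "{x. f x \<noteq> \<zero>\<^bsub>R\<^esub>}"]
        by (fastforce simp: free_mod_def Pi_iff subset_eq)
      moreover have "(\<lambda>x. \<ominus>\<^bsub>R\<^esub> f x) \<oplus>\<^bsub>free_mod R X\<^esub> f = \<zero>\<^bsub>free_mod R X\<^esub>"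
        using f by (auto simp: free_mod_def Pi_iff l_neg)
      ultimately show "\<exists>g\<in>carrier (free_mod R X). g \<oplus>\<^bsub>free_mod R X\<^esub> f = \<zero>\<^bsub>free_mod R X\<^esub>"
        by blast
    qed (auto simp: free_mod_def Pi_iff intro!: ext a_assoc a_comm)
    fix a f assume af: "a \<in> carrier R" "f \<in> carrier (free_mod R X)"
    then have "{x. a \<otimes>\<^bsub>R\<^esub> f x \<noteq> \<zero>\<^bsub>R\<^esub>} \<subseteq> {x. f x \<noteq> \<zero>\<^bsub>R\<^esub>}" by auto
    with af show "a \<odot>\<^bsub>free_mod R X\<^esub> f \<in> carrier (free_mod R X)"
      by (auto simp: free_mod_def Pi_iff intro: finite_subset)
  qed (auto simp: free_mod_def Pi_iff l_distr r_distr m_assoc intro!: ext)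
qed

lemma lin_ext_superset:
  assumes "Module.module R M" "finite A" "{x. f x \<noteq> \<zero>\<^bsub>R\<^esub>} \<subseteq> A"
    and "\<And>x. x \<in> A \<Longrightarrow> f x \<in> carrier R" "\<And>x. x \<in> A \<Longrightarrow> \<phi> x \<in> carrier M"
  shows "lin_ext R M \<phi> f = (\<Oplus>\<^bsub>M\<^esub>x\<in>A. f x \<odot>\<^bsub>M\<^esub> \<phi> x)"
proof -
  interpret Module.module R M by fact
  show ?thesis unfolding lin_ext_def
    by (rule M.add.finprod_mono_neutral_cong_left) (use assms(2-5) in auto)
qed

lemma lin_ext_hom:
  assumes M: "Module.module R M" and \<phi>: "\<And>x. x \<in> X \<Longrightarrow> \<phi> x \<in> carrier M"
  shows "lin_ext R M \<phi> \<in> mod_hom R (free_mod R X) M"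
proof -
  interpret Module.module R M by fact
  have closed: "lin_ext R M \<phi> f \<in> carrier M" if "f \<in> carrier (free_mod R X)" for f
    unfolding lin_ext_def using that \<phi> by (intro M.finsum_closed) (auto simp: free_mod_def Pi_iff)
  have add: "lin_ext R M \<phi> (f \<oplus>\<^bsub>free_mod R X\<^esub> g) = lin_ext R M \<phi> f \<oplus>\<^bsub>M\<^esub> lin_ext R M \<phi> g"
    if fg: "f \<in> carrier (free_mod R X)" "g \<in> carrier (free_mod R X)" for f g
  proof -
    let ?A = "{x. f x \<noteq> \<zero>\<^bsub>R\<^esub>} \<union> {x. g x \<noteq> \<zero>\<^bsub>R\<^esub>}"
    have A: "finite ?A" "?A \<subseteq> X" and c: "\<And>x. f x \<in> carrier R" "\<And>x. g x \<in> carrier R"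
      using fg by (auto simp: free_mod_def Pi_iff)
    have \<phi>A: "\<And>x. x \<in> ?A \<Longrightarrow> \<phi> x \<in> carrier M" using A \<phi> by blast
    have "lin_ext R M \<phi> (\<lambda>x. f x \<oplus>\<^bsub>R\<^esub> g x) = (\<Oplus>\<^bsub>M\<^esub>x\<in>?A. (f x \<oplus>\<^bsub>R\<^esub> g x) \<odot>\<^bsub>M\<^esub> \<phi> x)"
      by (rule lin_ext_superset[OF M A(1)]) (use c \<phi>A in auto)
    also have "\<dots> = (\<Oplus>\<^bsub>M\<^esub>x\<in>?A. f x \<odot>\<^bsub>M\<^esub> \<phi> x \<oplus>\<^bsub>M\<^esub> g x \<odot>\<^bsub>M\<^esub> \<phi> x)"
      by (rule M.finsum_cong') (use c \<phi>A in \<open>auto simp: smult_l_distr Pi_iff\<close>)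
    also have "\<dots> = (\<Oplus>\<^bsub>M\<^esub>x\<in>?A. f x \<odot>\<^bsub>M\<^esub> \<phi> x) \<oplus>\<^bsub>M\<^esub> (\<Oplus>\<^bsub>M\<^esub>x\<in>?A. g x \<odot>\<^bsub>M\<^esub> \<phi> x)"
      by (rule M.finsum_addf) (use c \<phi>A in \<open>auto simp: Pi_iff\<close>)
    also have "(\<Oplus>\<^bsub>M\<^esub>x\<in>?A. f x \<odot>\<^bsub>M\<^esub> \<phi> x) = lin_ext R M \<phi> f"
      by (rule lin_ext_superset[OF M A(1), symmetric]) (use c \<phi>A in auto)
    also have "(\<Oplus>\<^bsub>M\<^esub>x\<in>?A. g x \<odot>\<^bsub>M\<^esub> \<phi> x) = lin_ext R M \<phi> g"
      by (rule lin_ext_superset[OF M A(1), symmetric]) (use c \<phi>A in auto)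
    finally show ?thesis by (simp add: free_mod_def)
  qed
  have smult: "lin_ext R M \<phi> (r \<odot>\<^bsub>free_mod R X\<^esub> f) = r \<odot>\<^bsub>M\<^esub> lin_ext R M \<phi> f"
    if r: "r \<in> carrier R" and f: "f \<in> carrier (free_mod R X)" for r f
  proof -
    let ?A = "{x. f x \<noteq> \<zero>\<^bsub>R\<^esub>}"
    have A: "finite ?A" "?A \<subseteq> X" and c: "\<And>x. f x \<in> carrier R"
      using f by (auto simp: free_mod_def Pi_iff)
    have \<phi>A: "\<And>x. x \<in> ?A \<Longrightarrow> \<phi> x \<in> carrier M" using A \<phi> by blast
    have "lin_ext R M \<phi> (\<lambda>x. r \<otimes>\<^bsub>R\<^esub> f x) = (\<Oplus>\<^bsub>M\<^esub>x\<in>?A. (r \<otimes>\<^bsub>R\<^esub> f x) \<odot>\<^bsub>M\<^esub> \<phi> x)"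
      by (rule lin_ext_superset[OF M A(1)]) (use r c \<phi>A in auto)
    also have "\<dots> = (\<Oplus>\<^bsub>M\<^esub>x\<in>?A. r \<odot>\<^bsub>M\<^esub> (f x \<odot>\<^bsub>M\<^esub> \<phi> x))"
      by (rule M.finsum_cong') (use r c \<phi>A in \<open>auto simp: smult_assoc1 Pi_iff\<close>)
    also have "\<dots> = r \<odot>\<^bsub>M\<^esub> (\<Oplus>\<^bsub>M\<^esub>x\<in>?A. f x \<odot>\<^bsub>M\<^esub> \<phi> x)"
      by (rule finsum_smult_ldistr[symmetric]) (use A r c \<phi>A in \<open>auto simp: Pi_iff\<close>)
    finally show ?thesis by (simp add: free_mod_def lin_ext_def)
  qed
  show ?thesis using closed add smult by (auto simp: mod_hom_def)
qed

definition unit_fun :: "'r ring \<Rightarrow> 'x \<Rightarrow> 'x \<Rightarrow> 'r" where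
  "unit_fun R x = (\<lambda>y. if y = x then \<one>\<^bsub>R\<^esub> else \<zero>\<^bsub>R\<^esub>)"

lemma unit_fun_closed: "cring R \<Longrightarrow> x \<in> X \<Longrightarrow> unit_fun R x \<in> carrier (free_mod R X)"
  by (auto simp: free_mod_def unit_fun_def Pi_iff cring_def ring_def ring.is_monoid
      abelian_group.axioms abelian_monoid.zero_closed monoid.one_closed
      intro: finite_subset[of _ "{x}"])

lemma lin_ext_unit:
  assumes M: "Module.module R M" and "\<phi> x \<in> carrier M"
  shows "lin_ext R M \<phi> (unit_fun R x) = \<phi> x"
proof -
  interpret Module.module R M by fact
  have "lin_ext R M \<phi> (unit_fun R x) = (\<Oplus>\<^bsub>M\<^esub>y\<in>{x}. unit_fun R x y \<odot>\<^bsub>M\<^esub> \<phi> y)"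
    by (rule lin_ext_superset[OF M]) (use assms(2) in \<open>auto simp: unit_fun_def\<close>)
  then show ?thesis using assms(2) by (simp add: unit_fun_def)
qed

lemma lin_ext_unit_fun:
  assumes R: "cring R" and f: "f \<in> carrier (free_mod R X)"
  shows "lin_ext R (free_mod R X) (unit_fun R) f = f"
proof -
  interpret cring R by fact
  interpret F: Module.module R "free_mod R X" by (rule free_mod_module[OF R])
  have val: "(\<Oplus>\<^bsub>free_mod R X\<^esub>x\<in>A. f x \<odot>\<^bsub>free_mod R X\<^esub> unit_fun R x) =
      (\<lambda>y. if y \<in> A then f y else \<zero>\<^bsub>R\<^esub>)" if "finite A" "A \<subseteq> X" for A
    using that
  proof (induction A)
    case empty
    then show ?case by (simp add: free_mod_def F.M.finsum_empty[unfolded free_mod_def])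
  next
    case (insert a A)
    have u: "f x \<odot>\<^bsub>free_mod R X\<^esub> unit_fun R x \<in> carrier (free_mod R X)" if "x \<in> X" for x
      by (intro F.smult_closed unit_fun_closed R that) (use f in \<open>auto simp: free_mod_def Pi_iff\<close>)
    have "(\<Oplus>\<^bsub>free_mod R X\<^esub>x\<in>insert a A. f x \<odot>\<^bsub>free_mod R X\<^esub> unit_fun R x) =
      f a \<odot>\<^bsub>free_mod R X\<^esub> unit_fun R a \<oplus>\<^bsub>free_mod R X\<^esub> (\<lambda>y. if y \<in> A then f y else \<zero>\<^bsub>R\<^esub>)"
      using insert u by (subst F.M.finsum_insert) (auto simp: Pi_iff subset_eq)
    also have "\<dots> = (\<lambda>y. if y \<in> insert a A then f y else \<zero>\<^bsub>R\<^esub>)"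
      using insert f by (auto simp: free_mod_def unit_fun_def Pi_iff intro!: ext)
    finally show ?case .
  qed
  show ?thesis unfolding lin_ext_def
    by (subst val) (use f in \<open>auto simp: free_mod_def\<close>)
qed

lemma free_mod_basis:
  assumes R: "cring R" and ne: "\<one>\<^bsub>R\<^esub> \<noteq> \<zero>\<^bsub>R\<^esub>"
  shows "is_basis R (free_mod R X) (unit_fun R ` X)"
proof -
  interpret cring R by fact
  interpret F: Module.module R "free_mod R X" by (rule free_mod_module[OF R])
  have inj: "inj (unit_fun R)"
    using ne by (auto simp: inj_def unit_fun_def fun_eq_iff split: if_splits)
  have sum_eq: "(\<Oplus>\<^bsub>free_mod R X\<^esub>b\<in>{b. c b \<noteq> \<zero>\<^bsub>R\<^esub>}. c b \<odot>\<^bsub>free_mod R X\<^esub> b) = c \<circ> unit_fun R"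
    and mem: "c \<circ> unit_fun R \<in> carrier (free_mod R X)"
    if c: "c \<in> UNIV \<rightarrow> carrier R" "finite {b. c b \<noteq> \<zero>\<^bsub>R\<^esub>}" "{b. c b \<noteq> \<zero>\<^bsub>R\<^esub>} \<subseteq> unit_fun R ` X" for c
  proof -
    let ?A = "{x. (c \<circ> unit_fun R) x \<noteq> \<zero>\<^bsub>R\<^esub>}"
    have im: "unit_fun R ` ?A = {b. c b \<noteq> \<zero>\<^bsub>R\<^esub>}" using c(3) by auto
    have "finite ?A" using c(2) im inj by (metis finite_imageD inj_on_subset subset_UNIV)
    moreover have sub: "?A \<subseteq> X"
      using c(3) inj by (auto dest: injD)
    ultimately show mem: "c \<circ> unit_fun R \<in> carrier (free_mod R X)"
      using c(1) by (auto simp: free_mod_def)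
    have "(\<Oplus>\<^bsub>free_mod R X\<^esub>b\<in>unit_fun R ` ?A. c b \<odot>\<^bsub>free_mod R X\<^esub> b) =
        (\<Oplus>\<^bsub>free_mod R X\<^esub>x\<in>?A. c (unit_fun R x) \<odot>\<^bsub>free_mod R X\<^esub> unit_fun R x)"
      using c(1) sub inj
      by (intro F.M.finsum_reindex)
         (auto intro!: F.smult_closed unit_fun_closed R simp: inj_on_def dest: injD)
    also have "\<dots> = lin_ext R (free_mod R X) (unit_fun R) (c \<circ> unit_fun R)"
      by (simp add: lin_ext_def)
    also have "\<dots> = c \<circ> unit_fun R" by (rule lin_ext_unit_fun[OF R mem])
    finally show "(\<Oplus>\<^bsub>free_mod R X\<^esub>b\<in>{b. c b \<noteq> \<zero>\<^bsub>R\<^esub>}. c b \<odot>\<^bsub>free_mod R X\<^esub> b) = c \<circ> unit_fun R"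
      by (simp only: im)
  qed
  show ?thesis unfolding is_basis_def
  proof (intro conjI ballI ex_ex1I)
    show "unit_fun R ` X \<subseteq> carrier (free_mod R X)" using unit_fun_closed[OF R] by auto
  next
    fix f assume f: "f \<in> carrier (free_mod R X)"
    define c where "c = (\<lambda>b. if b \<in> range (unit_fun R) then f (inv_into UNIV (unit_fun R) b) else \<zero>\<^bsub>R\<^esub>)"
    have cf: "c \<circ> unit_fun R = f" by (rule ext) (simp add: c_def inv_f_f[OF inj])
    have supp: "{b. c b \<noteq> \<zero>\<^bsub>R\<^esub>} = unit_fun R ` {x. f x \<noteq> \<zero>\<^bsub>R\<^esub>}"
    proof (intro equalityI subsetI)
      fix b assume "b \<in> {b. c b \<noteq> \<zero>\<^bsub>R\<^esub>}"
      then have b: "c b \<noteq> \<zero>\<^bsub>R\<^esub>" by simp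
      then obtain x where "b = unit_fun R x" unfolding c_def by (auto split: if_splits)
      with b show "b \<in> unit_fun R ` {x. f x \<noteq> \<zero>\<^bsub>R\<^esub>}" using fun_cong[OF cf, of x] by auto
    next
      fix b assume "b \<in> unit_fun R ` {x. f x \<noteq> \<zero>\<^bsub>R\<^esub>}"
      then obtain x where "b = unit_fun R x" "f x \<noteq> \<zero>\<^bsub>R\<^esub>" by auto
      then show "b \<in> {b. c b \<noteq> \<zero>\<^bsub>R\<^esub>}" using fun_cong[OF cf, of x] by auto
    qed
    have c: "c \<in> UNIV \<rightarrow> carrier R" "finite {b. c b \<noteq> \<zero>\<^bsub>R\<^esub>}" "{b. c b \<noteq> \<zero>\<^bsub>R\<^esub>} \<subseteq> unit_fun R ` X"
      unfolding supp using f by (auto simp: c_def free_mod_def Pi_iff)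
    show "\<exists>c. c \<in> UNIV \<rightarrow> carrier R \<and> finite {b. c b \<noteq> \<zero>\<^bsub>R\<^esub>} \<and> {b. c b \<noteq> \<zero>\<^bsub>R\<^esub>} \<subseteq> unit_fun R ` X \<and>
        f = (\<Oplus>\<^bsub>free_mod R X\<^esub>b\<in>{b. c b \<noteq> \<zero>\<^bsub>R\<^esub>}. c b \<odot>\<^bsub>free_mod R X\<^esub> b)"
      by (intro exI[of _ c] conjI c) (simp only: sum_eq[OF c] cf)
  next
    fix f c c'
    assume 1: "c \<in> UNIV \<rightarrow> carrier R \<and> finite {b. c b \<noteq> \<zero>\<^bsub>R\<^esub>} \<and> {b. c b \<noteq> \<zero>\<^bsub>R\<^esub>} \<subseteq> unit_fun R ` X \<and>
        f = (\<Oplus>\<^bsub>free_mod R X\<^esub>b\<in>{b. c b \<noteq> \<zero>\<^bsub>R\<^esub>}. c b \<odot>\<^bsub>free_mod R X\<^esub> b)"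
      and 2: "c' \<in> UNIV \<rightarrow> carrier R \<and> finite {b. c' b \<noteq> \<zero>\<^bsub>R\<^esub>} \<and> {b. c' b \<noteq> \<zero>\<^bsub>R\<^esub>} \<subseteq> unit_fun R ` X \<and>
        f = (\<Oplus>\<^bsub>free_mod R X\<^esub>b\<in>{b. c' b \<noteq> \<zero>\<^bsub>R\<^esub>}. c' b \<odot>\<^bsub>free_mod R X\<^esub> b)"
    have eq: "c \<circ> unit_fun R = c' \<circ> unit_fun R" 
    proof -
      have "c \<circ> unit_fun R = f" using sum_eq[of c] 1 by argo
      moreover have "c' \<circ> unit_fun R = f" using sum_eq[of c'] 2 by argo
      ultimately show ?thesis by (rule trans[OF _ sym])
    qed
    show "c = c'"
    proof
      fix b
      show "c b = c' b"
      proof (cases "b \<in> unit_fun R ` X")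
        case True then show ?thesis using eq by (auto simp: fun_eq_iff)
      next
        case False
        then have "c b = \<zero>\<^bsub>R\<^esub>" "c' b = \<zero>\<^bsub>R\<^esub>" using 1 2 by blast+
        then show ?thesis by simp
      qed
    qed
  qed
qed

lemma free_mod_basis_exists:
  assumes R: "cring R" shows "\<exists>B. is_basis R (free_mod R X) B"
proof (cases "\<one>\<^bsub>R\<^esub> = \<zero>\<^bsub>R\<^esub>")
  case False then show ?thesis using free_mod_basis[OF R] by blast
next
  case True
  interpret cring R by fact
  interpret F: Module.module R "free_mod R X" by (rule free_mod_module[OF R])
  have z: "r = \<zero>\<^bsub>R\<^esub>" if "r \<in> carrier R" for r using True that by (metis l_null l_one)
  have "is_basis R (free_mod R X) {}"
    unfolding is_basis_def
  proof (intro conjI ballI ex_ex1I)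
    fix f assume "f \<in> carrier (free_mod R X)"
    then have "f = \<zero>\<^bsub>free_mod R X\<^esub>" using z by (auto simp: free_mod_def Pi_iff)
    then show "\<exists>c. c \<in> UNIV \<rightarrow> carrier R \<and> finite {b. c b \<noteq> \<zero>\<^bsub>R\<^esub>} \<and> {b. c b \<noteq> \<zero>\<^bsub>R\<^esub>} \<subseteq> {} \<and>
        f = (\<Oplus>\<^bsub>free_mod R X\<^esub>b\<in>{b. c b \<noteq> \<zero>\<^bsub>R\<^esub>}. c b \<odot>\<^bsub>free_mod R X\<^esub> b)"
      by (intro exI[of _ "\<lambda>_. \<zero>\<^bsub>R\<^esub>"]) (simp add: F.M.finsum_empty)
  next
    fix f c c'
    assume "c \<in> UNIV \<rightarrow> carrier R \<and> finite {b. c b \<noteq> \<zero>\<^bsub>R\<^esub>} \<and> {b. c b \<noteq> \<zero>\<^bsub>R\<^esub>} \<subseteq> {} \<and>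
        f = (\<Oplus>\<^bsub>free_mod R X\<^esub>b\<in>{b. c b \<noteq> \<zero>\<^bsub>R\<^esub>}. c b \<odot>\<^bsub>free_mod R X\<^esub> b)"
      and "c' \<in> UNIV \<rightarrow> carrier R \<and> finite {b. c' b \<noteq> \<zero>\<^bsub>R\<^esub>} \<and> {b. c' b \<noteq> \<zero>\<^bsub>R\<^esub>} \<subseteq> {} \<and>
        f = (\<Oplus>\<^bsub>free_mod R X\<^esub>b\<in>{b. c' b \<noteq> \<zero>\<^bsub>R\<^esub>}. c' b \<odot>\<^bsub>free_mod R X\<^esub> b)"
    then have "{b. c b \<noteq> \<zero>\<^bsub>R\<^esub>} \<subseteq> {}" "{b. c' b \<noteq> \<zero>\<^bsub>R\<^esub>} \<subseteq> {}" by blast+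
    then have "\<And>b. c b = \<zero>\<^bsub>R\<^esub>" "\<And>b. c' b = \<zero>\<^bsub>R\<^esub>" by blast+
    then show "c = c'" by (simp add: fun_eq_iff)
  qed simp
  then show ?thesis by blast
qed

lemma mod_hom_smult:
  "h \<in> mod_hom R M N \<Longrightarrow> r \<in> carrier R \<Longrightarrow> x \<in> carrier M \<Longrightarrow> h (r \<odot>\<^bsub>M\<^esub> x) = r \<odot>\<^bsub>N\<^esub> h x"
  by (simp add: mod_hom_def)

lemma mod_hom_zero:
  assumes "Module.module R M" "Module.module R N" "h \<in> mod_hom R M N"
  shows "h \<zero>\<^bsub>M\<^esub> = \<zero>\<^bsub>N\<^esub>"
proof -
  interpret M: Module.module R M by fact
  interpret N: Module.module R N by fact
  have h: "h \<zero>\<^bsub>M\<^esub> \<in> carrier N" using assms(3) by (auto simp: mod_hom_def)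
  have "h (\<zero>\<^bsub>R\<^esub> \<odot>\<^bsub>M\<^esub> \<zero>\<^bsub>M\<^esub>) = \<zero>\<^bsub>R\<^esub> \<odot>\<^bsub>N\<^esub> h \<zero>\<^bsub>M\<^esub>" by (rule mod_hom_smult[OF assms(3)]) auto
  then show ?thesis using h by simp
qed

lemma lin_ext_image_kernel:
  assumes M: "Module.module R M" and N: "Module.module R N" and h: "h \<in> mod_hom R M N"
    and \<phi>: "\<phi> ` X = {x \<in> carrier M. h x = \<zero>\<^bsub>N\<^esub>}"
  shows "lin_ext R M \<phi> ` carrier (free_mod R X) = {x \<in> carrier M. h x = \<zero>\<^bsub>N\<^esub>}"
proof -
  interpret M: Module.module R M by fact
  interpret N: Module.module R N by fact
  have \<phi>c: "\<phi> x \<in> carrier M" and \<phi>k: "h (\<phi> x) = \<zero>\<^bsub>N\<^esub>" if "x \<in> X" for x using \<phi> that by auto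
  have hom: "lin_ext R M \<phi> \<in> mod_hom R (free_mod R X) M" by (rule lin_ext_hom[OF M \<phi>c])
  have ker: "h (\<Oplus>\<^bsub>M\<^esub>x\<in>A. f x \<odot>\<^bsub>M\<^esub> \<phi> x) = \<zero>\<^bsub>N\<^esub>"
    if "finite A" "A \<subseteq> X" "f \<in> UNIV \<rightarrow> carrier R" for A f
    using that
  proof (induction A)
    case empty then show ?case using mod_hom_zero[OF M N h] by simp
  next
    case (insert a A)
    have in_c: "f x \<odot>\<^bsub>M\<^esub> \<phi> x \<in> carrier M" if "x \<in> X" for x using that \<phi>c insert.prems by auto
    have fs: "(\<Oplus>\<^bsub>M\<^esub>x\<in>A. f x \<odot>\<^bsub>M\<^esub> \<phi> x) \<in> carrier M"
      using insert.prems in_c by (intro M.finsum_closed) auto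
    have "(\<Oplus>\<^bsub>M\<^esub>x\<in>insert a A. f x \<odot>\<^bsub>M\<^esub> \<phi> x) = f a \<odot>\<^bsub>M\<^esub> \<phi> a \<oplus>\<^bsub>M\<^esub> (\<Oplus>\<^bsub>M\<^esub>x\<in>A. f x \<odot>\<^bsub>M\<^esub> \<phi> x)"
      using insert in_c by (intro M.finsum_insert) auto
    moreover have "h (f a \<odot>\<^bsub>M\<^esub> \<phi> a \<oplus>\<^bsub>M\<^esub> (\<Oplus>\<^bsub>M\<^esub>x\<in>A. f x \<odot>\<^bsub>M\<^esub> \<phi> x)) =
        h (f a \<odot>\<^bsub>M\<^esub> \<phi> a) \<oplus>\<^bsub>N\<^esub> h (\<Oplus>\<^bsub>M\<^esub>x\<in>A. f x \<odot>\<^bsub>M\<^esub> \<phi> x)"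
      using h fs in_c insert.prems by (auto simp: mod_hom_def)
    moreover have "h (f a \<odot>\<^bsub>M\<^esub> \<phi> a) = f a \<odot>\<^bsub>N\<^esub> h (\<phi> a)"
      using insert.prems \<phi>c by (intro mod_hom_smult[OF h]) auto
    moreover have "f a \<in> carrier R" using insert.prems by auto
    ultimately show ?case using insert \<phi>k[of a] by auto
  qed
  show ?thesis
  proof (intro equalityI subsetI)
    fix y assume "y \<in> lin_ext R M \<phi> ` carrier (free_mod R X)"
    then obtain f where f: "f \<in> carrier (free_mod R X)" "y = lin_ext R M \<phi> f" by blast
    have "y \<in> carrier M" using hom f by (auto simp: mod_hom_def)
    moreover have "h y = \<zero>\<^bsub>N\<^esub>"
      unfolding f(2) lin_ext_def using f(1) by (intro ker) (auto simp: free_mod_def)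
    ultimately show "y \<in> {x \<in> carrier M. h x = \<zero>\<^bsub>N\<^esub>}" by blast
  next
    fix y assume y: "y \<in> {x \<in> carrier M. h x = \<zero>\<^bsub>N\<^esub>}"
    then obtain x where x: "x \<in> X" "y = \<phi> x" using \<phi> by blast
    then have "y = lin_ext R M \<phi> (unit_fun R x)" using lin_ext_unit[OF M, of \<phi> x] \<phi>c by simp
    then show "y \<in> lin_ext R M \<phi> ` carrier (free_mod R X)"
      using unit_fun_closed[OF M.R.is_cring x(1)] by blast
  qed
qed

text \<open>The code \<open>Syz l\<close> labels the basis vector mapped to the finitely supported function
  with graph \<open>l\<close>.\<close>

fun decode :: "'r ring \<Rightarrow> ('r, 'n) cell \<Rightarrow> ('r, 'n) cell \<Rightarrow> 'r" where
  "decode R (Gen a) = (\<lambda>_. \<zero>\<^bsub>R\<^esub>)"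
| "decode R (Syz l) = (\<lambda>x. case map_of l x of None \<Rightarrow> \<zero>\<^bsub>R\<^esub> | Some r \<Rightarrow> r)"

fun ungen :: "('r, 'n) cell \<Rightarrow> 'n" where
  "ungen (Gen a) = a"
| "ungen (Syz l) = undefined"

lemma decode_surj:
  assumes "finite {x. f x \<noteq> \<zero>\<^bsub>R\<^esub>}" shows "\<exists>l. decode R (Syz l) = f"
proof -
  obtain xs where xs: "set xs = {x. f x \<noteq> \<zero>\<^bsub>R\<^esub>}" using finite_list[OF assms] by blast
  have "decode R (Syz (map (\<lambda>x. (x, f x)) xs)) = f"
    using xs by (auto simp: map_of_map_restrict restrict_map_def intro!: ext)
  then show ?thesis by blast
qed

primrec res_stage ::
  "'r ring \<Rightarrow> ('r, 'n) module \<Rightarrow> nat \<Rightarrow> ('r, 'n) cell set \<times> (('r, 'n) cell \<Rightarrow> 'r) set" where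
  "res_stage R N 0 =
     (let X = Gen ` carrier N in (X, {f \<in> carrier (free_mod R X). lin_ext R N ungen f = \<zero>\<^bsub>N\<^esub>}))"
| "res_stage R N (Suc n) =
     (let (X, K) = res_stage R N n; Y = {Syz l | l. decode R (Syz l) \<in> K} in
      (Y, {f \<in> carrier (free_mod R Y). lin_ext R (free_mod R X) (decode R) f = \<zero>\<^bsub>free_mod R X\<^esub>}))"

lemma free_resolution_exists:
  assumes N: "Module.module R N"
  shows "\<exists>(P :: nat \<Rightarrow> ('r, ('r, 'n) cell \<Rightarrow> 'r) module) d e.
     free_resolution R (N :: ('r, 'n) module) P d e"
proof -
  interpret N: Module.module R N by fact
  have R: "cring R" by (rule N.R.is_cring)
  define X where "X n = fst (res_stage R N n)" for n
  define K where "K n = snd (res_stage R N n)" for n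
  define P where "P n = free_mod R (X n)" for n
  define e where "e = lin_ext R N (ungen :: ('r, 'n) cell \<Rightarrow> 'n)"
  define d where "d n = lin_ext R (P n) (decode R)" for n
  have X0: "X 0 = Gen ` carrier N" by (simp add: X_def Let_def)
  have K0: "K 0 = {f \<in> carrier (P 0). e f = \<zero>\<^bsub>N\<^esub>}"
    by (simp add: K_def X_def Let_def P_def e_def)
  have XS: "X (Suc n) = {Syz l | l. decode R (Syz l) \<in> K n}" for n
    by (simp add: K_def X_def Let_def split_beta)
  have KS: "K (Suc n) = {f \<in> carrier (P (Suc n)). d n f = \<zero>\<^bsub>P n\<^esub>}" for n
    by (simp add: K_def X_def Let_def split_beta P_def d_def)
  have Pmod: "Module.module R (P n)" for n unfolding P_def by (rule free_mod_module[OF R])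
  have KP: "K n \<subseteq> carrier (P n)" for n by (cases n) (auto simp: K0 KS)
  have img: "decode R ` X (Suc n) = K n" for n
  proof
    show "K n \<subseteq> decode R ` X (Suc n)"
    proof
      fix f assume f: "f \<in> K n"
      then have "finite {x. f x \<noteq> \<zero>\<^bsub>R\<^esub>}" using KP[of n] by (auto simp: P_def free_mod_def)
      then obtain l where "decode R (Syz l) = f" using decode_surj by blast
      then show "f \<in> decode R ` X (Suc n)" using f unfolding XS by blast
    qed
  qed (auto simp: XS)
  have d_hom: "d n \<in> mod_hom R (P (Suc n)) (P n)" for n
    unfolding d_def P_def[of "Suc n"]
    by (rule lin_ext_hom[OF Pmod]) (use img[of n] KP[of n] in auto)
  have e_hom: "e \<in> mod_hom R (P 0) N"
    unfolding e_def P_def by (rule lin_ext_hom[OF N]) (auto simp: X0)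
  have e_surj: "e ` carrier (P 0) = carrier N"
  proof
    show "e ` carrier (P 0) \<subseteq> carrier N" using e_hom by (auto simp: mod_hom_def)
    show "carrier N \<subseteq> e ` carrier (P 0)"
    proof
      fix a assume a: "a \<in> carrier N"
      have "e (unit_fun R (Gen a)) = a"
        unfolding e_def using lin_ext_unit[OF N, of ungen "Gen a"] a by simp
      moreover have "unit_fun R (Gen a) \<in> carrier (P 0)"
        unfolding P_def using a by (intro unit_fun_closed[OF R]) (auto simp: X0)
      ultimately show "a \<in> e ` carrier (P 0)" by (metis imageI)
    qed
  qed
  have ex0: "d 0 ` carrier (P (Suc 0)) = {x \<in> carrier (P 0). e x = \<zero>\<^bsub>N\<^esub>}"
    unfolding d_def P_def[of "Suc 0"]
    by (rule lin_ext_image_kernel[OF Pmod N e_hom]) (simp add: img K0)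
  have exS: "d (Suc n) ` carrier (P (Suc (Suc n))) = {x \<in> carrier (P (Suc n)). d n x = \<zero>\<^bsub>P n\<^esub>}" for n
    unfolding d_def[of "Suc n"] P_def[of "Suc (Suc n)"]
    by (rule lin_ext_image_kernel[OF Pmod Pmod d_hom]) (simp add: img KS)
  have "\<exists>B. is_basis R (P n) B" for n unfolding P_def by (rule free_mod_basis_exists[OF R])
  then have "free_resolution R N P d e"
    unfolding free_resolution_def by (intro conjI allI Pmod e_hom d_hom e_surj ex0 exS)
  then show ?thesis by blast
qed


section \<open>Dimension over a commutative ring with involution and trace\<close>

definition power_module :: "'s ring \<Rightarrow> nat \<Rightarrow> ('s, nat \<Rightarrow> 's) module" where
  "power_module S k =
     \<lparr>carrier = {..<k} \<rightarrow>\<^sub>E carrier S, mult = undefined, one = undefined,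
      ring.zero = (\<lambda>j\<in>{..<k}. \<zero>\<^bsub>S\<^esub>),
      ring.add = (\<lambda>v w. \<lambda>j\<in>{..<k}. v j \<oplus>\<^bsub>S\<^esub> w j),
      smult = (\<lambda>s v. \<lambda>j\<in>{..<k}. s \<otimes>\<^bsub>S\<^esub> v j)\<rparr>"

definition fg_projective :: "'s ring \<Rightarrow> ('s, 'a) module \<Rightarrow> bool" where
  "fg_projective S P \<longleftrightarrow>
     Module.module S P \<and>
     (\<exists>k. \<exists>j\<in>mod_hom S P (power_module S k). \<exists>r\<in>mod_hom S (power_module S k) P.
        \<forall>x\<in>carrier P. r (j x) = x)"

definition projection_matrix :: "'s ring \<Rightarrow> ('s \<Rightarrow> 's) \<Rightarrow> nat \<Rightarrow> (nat \<Rightarrow> nat \<Rightarrow> 's) \<Rightarrow> bool" where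
  "projection_matrix S star k E \<longleftrightarrow>
     (\<forall>i<k. \<forall>j<k. E i j \<in> carrier S \<and> E i j = star (E j i) \<and>
        (\<Oplus>\<^bsub>S\<^esub>l\<in>{..<k}. E i l \<otimes>\<^bsub>S\<^esub> E l j) = E i j)"

text \<open>The module of row vectors \<open>v E\<close>.\<close>

definition row_module :: "'s ring \<Rightarrow> nat \<Rightarrow> (nat \<Rightarrow> nat \<Rightarrow> 's) \<Rightarrow> ('s, nat \<Rightarrow> 's) module" where
  "row_module S k E =
     (power_module S k)
       \<lparr>carrier := (\<lambda>v. \<lambda>j\<in>{..<k}. \<Oplus>\<^bsub>S\<^esub>i\<in>{..<k}. v i \<otimes>\<^bsub>S\<^esub> E i j) ` carrier (power_module S k)\<rparr>"

definition fgp_dim :: "'s ring \<Rightarrow> ('s \<Rightarrow> 's) \<Rightarrow> ('s \<Rightarrow> complex) \<Rightarrow> ('s, 'a) module \<Rightarrow> real" where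
  "fgp_dim S star tr P =
     (THE t. \<exists>k E. projection_matrix S star k E \<and> mod_iso S P (row_module S k E) \<and>
        complex_of_real t = (\<Sum>i<k. tr (E i i)))"

definition lueck_dim :: "'s ring \<Rightarrow> ('s \<Rightarrow> 's) \<Rightarrow> ('s \<Rightarrow> complex) \<Rightarrow> ('s, 'a) module \<Rightarrow> ennreal" where
  "lueck_dim S star tr Q =
     Sup {ennreal (fgp_dim S star tr (Q\<lparr>carrier := P\<rparr>)) | P.
            Module.submodule P S Q \<and> fg_projective S (Q\<lparr>carrier := P\<rparr>)}"


section \<open>The von Neumann algebra and the Betti numbers\<close>

definition ess_bounded :: "'g measure \<Rightarrow> ('g \<Rightarrow> complex) set" where
  "ess_bounded \<mu> = {f \<in> borel_measurable \<mu>. \<exists>C. AE x in \<mu>. cmod (f x) \<le> C}"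

definition ae_zero :: "'g measure \<Rightarrow> ('g \<Rightarrow> complex) set" where
  "ae_zero \<mu> = {f \<in> ess_bounded \<mu>. AE x in \<mu>. f x = 0}"

definition Linf :: "'g measure \<Rightarrow> ('g \<Rightarrow> complex) set ring" where
  "Linf \<mu> = fun_ring (ess_bounded \<mu>) Quot ae_zero \<mu>"

definition Linf_class :: "'g measure \<Rightarrow> ('g \<Rightarrow> complex) \<Rightarrow> ('g \<Rightarrow> complex) set" where
  "Linf_class \<mu> f = ae_zero \<mu> +>\<^bsub>fun_ring (ess_bounded \<mu>)\<^esub> f"

definition Linf_star :: "('g \<Rightarrow> complex) set \<Rightarrow> ('g \<Rightarrow> complex) set" where
  "Linf_star X = (\<lambda>f x. cnj (f x)) ` X"

definition haar_trace :: "'g measure \<Rightarrow> ('g \<Rightarrow> complex) set \<Rightarrow> complex" where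
  "haar_trace \<mu> X = (\<integral>x. (SOME f. f \<in> X) x \<partial>\<mu>)"

text \<open>The complex numbers as a module over the coefficient algebra via the counit, that is, via
  evaluation at the identity.\<close>

definition counit_module :: "'g monoid \<Rightarrow> ('g \<Rightarrow> complex, complex) module" where
  "counit_module G =
     \<lparr>carrier = UNIV, mult = undefined, one = undefined, ring.zero = 0, ring.add = (+),
      smult = (\<lambda>f z. f \<one>\<^bsub>G\<^esub> * z)\<rparr>"

definition l2_betti :: "'g::topological_space monoid \<Rightarrow> 'g measure \<Rightarrow> nat \<Rightarrow> ennreal" where
  "l2_betti G \<mu> n =
     lueck_dim (Linf \<mu>) Linf_star (haar_trace \<mu>)
       (Tor (Linf \<mu>) (coeff_algebra G) (Linf_class \<mu>) (counit_module G) n)"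

end

theory Submission
  imports Defs "HOL-Complex_Analysis.Great_Picard"
begin

text \<open>
  The Betti numbers vanish because a single element \<open>a\<close> of the coefficient algebra satisfies
  \<open>a(\<one>) = 0\<close> and is nonzero almost everywhere. Through the counit, \<open>a\<close> acts as zero on the complex
  numbers, so multiplication by \<open>a\<close> on a free resolution is null-homotopic and \<open>a\<close> annihilates every
  Tor module (\<open>Tor_annihilated\<close>). On the other hand \<open>a\<close> is a regular element of
  \<open>L\<^sup>\<infinity>\<close>, so a finitely generated projective module, which embeds into a free one, is zero as soon as
  it is annihilated by \<open>a\<close>. Hence the only finitely generated projective submodule of Tor is zero,
  and the dimension is zero (\<open>lueck_dim_annihilated\<close>).

  To find \<open>a\<close>, take a nonconstant continuous function \<open>g\<close> in a finite-dimensional space of functions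
  invariant under left translations \<open>L s\<close>, and put \<open>a(s) = \<langle>g, g\<rangle> - \<langle>g, L s g\<rangle>\<close>. Its zero set is the
  stabilizer of \<open>g\<close>, a closed subgroup different from the group. In a connected group such a
  subgroup has infinite index, and since its cosets are disjoint and have equal measure, it is null
  (\<open>stabilizer_null\<close>).

  The space containing \<open>g\<close> comes from the argument behind the Peter-Weyl theorem. Convolution with a
  symmetric nonzero function of mean zero is a self-adjoint operator that commutes with left
  translations and annihilates constants. By equicontinuity it maps bounded sequences to sequences
  with uniformly convergent subsequences, so its square has an eigenfunction for its largest
  eigenvalue (\<open>eigenvector_exists\<close>). The eigenspace has finite dimension by Bessel's inequality and
  contains no nonzero constants.

  The coefficient algebra is spanned by coefficients of irreducible representations. That it
  contains \<open>a\<close>, and that it is closed under products and hence a ring at all, both follow from complete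
  reducibility: coefficients of any finite-dimensional unitary action lie in this span
  (\<open>coefficient_closed\<close>).
\<close>

section \<open>Base change of a module\<close>

lemma keys_frag_diff_subset:
  "Poly_Mapping.keys f \<subseteq> A \<Longrightarrow> Poly_Mapping.keys g \<subseteq> A \<Longrightarrow> Poly_Mapping.keys (f - g) \<subseteq> A"
  using keys_diff[of f g] by blast

lemma keys_frag_add_subset:
  "Poly_Mapping.keys f \<subseteq> A \<Longrightarrow> Poly_Mapping.keys g \<subseteq> A \<Longrightarrow> Poly_Mapping.keys (f + g) \<subseteq> A"
  using Poly_Mapping.keys_add[of f g] by blast

locale base_change = S: cring S + R: cring R for S :: "'s ring" and R :: "'r ring" +
  fixes i :: "'r \<Rightarrow> 's"
  assumes i_hom: "i \<in> ring_hom R S"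
begin

definition bilinear_relators :: "('r, 'p) module \<Rightarrow> ('s \<times> 'p \<Rightarrow>\<^sub>0 int) set" where
  "bilinear_relators P =
     {frag_of (s \<oplus>\<^bsub>S\<^esub> t, p) - frag_of (s, p) - frag_of (t, p) | s t p.
        s \<in> carrier S \<and> t \<in> carrier S \<and> p \<in> carrier P} \<union>
     {frag_of (s, p \<oplus>\<^bsub>P\<^esub> q) - frag_of (s, p) - frag_of (s, q) | s p q.
        s \<in> carrier S \<and> p \<in> carrier P \<and> q \<in> carrier P} \<union>
     {frag_of (s \<otimes>\<^bsub>S\<^esub> i r, p) - frag_of (s, r \<odot>\<^bsub>P\<^esub> p) | s r p.
        s \<in> carrier S \<and> r \<in> carrier R \<and> p \<in> carrier P}"

abbreviation K where "K P \<equiv> tensor_relations S R i P"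

lemma i_closed: "r \<in> carrier R \<Longrightarrow> i r \<in> carrier S"
  using i_hom by (rule ring_hom_closed)

lemma tensor_relations_eq:
  "K P = generate (free_Abelian_group (carrier S \<times> carrier P)) (bilinear_relators P)"
  by (simp add: tensor_relations_def bilinear_relators_def)

lemma relators_closed:
  assumes "Module.module R P"
  shows "bilinear_relators P \<subseteq> carrier (free_Abelian_group (carrier S \<times> carrier P))"
proof -
  interpret P: Module.module R P by fact
  show ?thesis
    unfolding bilinear_relators_def
    by (intro Un_least subsetI;
        elim CollectE exE conjE;
        hypsubst;
        unfold carrier_free_Abelian_group_iff;
        intro keys_frag_diff_subset;
        simp add: i_closed)
qed

context
  fixes P :: "('r, 'p) module"
  assumes P: "Module.module R P"
begin

lemma K_subgroup: "subgroup (K P) (free_Abelian_group (carrier S \<times> carrier P))"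
  unfolding tensor_relations_eq
  by (rule group.generate_is_subgroup[OF group_free_Abelian_group relators_closed[OF P]])

lemma K_zero: "0 \<in> K P"
  using subgroup.one_closed[OF K_subgroup] by simp

lemma K_add: "x \<in> K P \<Longrightarrow> y \<in> K P \<Longrightarrow> x + y \<in> K P"
  using subgroup.m_closed[OF K_subgroup] by simp

lemma K_keys: "x \<in> K P \<Longrightarrow> Poly_Mapping.keys x \<subseteq> carrier S \<times> carrier P"
  using subgroup.subset[OF K_subgroup] by (auto simp: subset_iff)

lemma K_minus: "x \<in> K P \<Longrightarrow> - x \<in> K P"
  using subgroup.m_inv_closed[OF K_subgroup] K_keys by simp

lemma K_diff: "x \<in> K P \<Longrightarrow> y \<in> K P \<Longrightarrow> x - y \<in> K P"
  using K_add[of x "- y"] K_minus by simp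

lemma relators_in_K: "x \<in> bilinear_relators P \<Longrightarrow> x \<in> K P"
  unfolding tensor_relations_eq by (rule generate.incl)

lemma K_add_left:
  "s \<in> carrier S \<Longrightarrow> t \<in> carrier S \<Longrightarrow> p \<in> carrier P \<Longrightarrow>
     frag_of (s \<oplus>\<^bsub>S\<^esub> t, p) - frag_of (s, p) - frag_of (t, p) \<in> K P"
  by (rule relators_in_K) (unfold bilinear_relators_def, blast)

lemma K_add_right:
  "s \<in> carrier S \<Longrightarrow> p \<in> carrier P \<Longrightarrow> q \<in> carrier P \<Longrightarrow>
     frag_of (s, p \<oplus>\<^bsub>P\<^esub> q) - frag_of (s, p) - frag_of (s, q) \<in> K P"
  by (rule relators_in_K) (unfold bilinear_relators_def, blast)

lemma K_balance:
  "s \<in> carrier S \<Longrightarrow> r \<in> carrier R \<Longrightarrow> p \<in> carrier P \<Longrightarrow>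
     frag_of (s \<otimes>\<^bsub>S\<^esub> i r, p) - frag_of (s, r \<odot>\<^bsub>P\<^esub> p) \<in> K P"
  by (rule relators_in_K) (unfold bilinear_relators_def, blast)

lemma K_zero_right: assumes "s \<in> carrier S" shows "frag_of (s, \<zero>\<^bsub>P\<^esub>) \<in> K P"
proof -
  interpret P: Module.module R P by (rule P)
  have "- (frag_of (s, \<zero>\<^bsub>P\<^esub> \<oplus>\<^bsub>P\<^esub> \<zero>\<^bsub>P\<^esub>) - frag_of (s, \<zero>\<^bsub>P\<^esub>) - frag_of (s, \<zero>\<^bsub>P\<^esub>)) \<in> K P"
    by (intro K_minus K_add_right assms) auto
  then show ?thesis by simp
qed

lemma frag_extend_K:
  assumes A: "\<And>x. x \<in> bilinear_relators P \<Longrightarrow> frag_extend b x \<in> A"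
    and A0: "0 \<in> A" and Am: "\<And>x. x \<in> A \<Longrightarrow> - x \<in> A" and Aa: "\<And>x y. x \<in> A \<Longrightarrow> y \<in> A \<Longrightarrow> x + y \<in> A"
    and f: "f \<in> K P"
  shows "frag_extend b f \<in> A"
  using f unfolding tensor_relations_eq
proof (induction rule: generate.induct)
  case (inv h)
  have "Poly_Mapping.keys h \<subseteq> carrier S \<times> carrier P"
    using relators_closed[OF P] inv by (auto simp: subset_iff)
  then show ?case using A[OF inv] Am by (simp add: frag_extend_minus)
qed (auto simp: A A0 Aa frag_extend_add)

lemma in_coset_iff: "x \<in> K P #>\<^bsub>free_Abelian_group (carrier S \<times> carrier P)\<^esub> f \<longleftrightarrow> x - f \<in> K P"
  unfolding r_coset_def by (auto simp: algebra_simps intro: exI[of _ "x - f"] bexI[of _ "x - f"])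

lemma coset_eqI:
  assumes "f - g \<in> K P"
  shows "K P #>\<^bsub>free_Abelian_group (carrier S \<times> carrier P)\<^esub> f = K P #>\<^bsub>free_Abelian_group (carrier S \<times> carrier P)\<^esub> g"
proof (rule Set.set_eqI)
  fix x
  have "x - f \<in> K P \<longleftrightarrow> x - g \<in> K P"
    using K_add[OF _ assms, of "x - f"] K_diff[OF _ assms, of "x - g"] by (auto simp: algebra_simps)
  then show "x \<in> K P #>\<^bsub>free_Abelian_group (carrier S \<times> carrier P)\<^esub> f \<longleftrightarrow>
      x \<in> K P #>\<^bsub>free_Abelian_group (carrier S \<times> carrier P)\<^esub> g"
    by (simp add: in_coset_iff)
qed

lemma coset_eqD:
  assumes "K P #>\<^bsub>free_Abelian_group (carrier S \<times> carrier P)\<^esub> f = K P"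
  shows "f \<in> K P"
proof -
  have "f \<in> K P #>\<^bsub>free_Abelian_group (carrier S \<times> carrier P)\<^esub> f" by (simp add: in_coset_iff K_zero)
  with assms show ?thesis by simp
qed

lemma coset_zero_iff: "K P #>\<^bsub>free_Abelian_group (carrier S \<times> carrier P)\<^esub> f = K P \<longleftrightarrow> f \<in> K P"
proof
  assume "f \<in> K P"
  then have "K P #>\<^bsub>free_Abelian_group (carrier S \<times> carrier P)\<^esub> f =
      K P #>\<^bsub>free_Abelian_group (carrier S \<times> carrier P)\<^esub> 0"
    by (intro coset_eqI) simp
  also have "\<dots> = K P" by (auto simp: r_coset_def)
  finally show "K P #>\<^bsub>free_Abelian_group (carrier S \<times> carrier P)\<^esub> f = K P" .
qed (rule coset_eqD)

end

definition cls :: "('r, 'p) module \<Rightarrow> ('s \<times> 'p \<Rightarrow>\<^sub>0 int) \<Rightarrow> ('s \<times> 'p \<Rightarrow>\<^sub>0 int) set" where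
  "cls P f = K P #>\<^bsub>free_Abelian_group (carrier S \<times> carrier P)\<^esub> f"

lemma tensor_carrier:
  "carrier (tensor S R i P) = {cls P f | f. Poly_Mapping.keys f \<subseteq> carrier S \<times> carrier P}"
  by (auto simp: tensor_def Let_def FactGroup_def RCOSETS_def cls_def)

lemma tensor_zero: "\<zero>\<^bsub>tensor S R i P\<^esub> = K P"
  by (simp add: tensor_def Let_def FactGroup_def)

lemma cls_eqI: "Module.module R P \<Longrightarrow> f - g \<in> K P \<Longrightarrow> cls P f = cls P g"
  unfolding cls_def by (rule coset_eqI)

lemma cls_zero_iff: "Module.module R P \<Longrightarrow> cls P f = K P \<longleftrightarrow> f \<in> K P"
  unfolding cls_def by (rule coset_zero_iff)

lemma cls_add:
  assumes P: "Module.module R P"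
  shows "cls P f \<oplus>\<^bsub>tensor S R i P\<^esub> cls P g = cls P (f + g)"
proof -
  have eq: "cls P f \<oplus>\<^bsub>tensor S R i P\<^esub> cls P g = {x + y | x y. x - f \<in> K P \<and> y - g \<in> K P}"
    by (fastforce simp: tensor_def Let_def FactGroup_def set_mult_def cls_def in_coset_iff[OF P])
  show ?thesis unfolding eq
  proof (intro equalityI subsetI)
    fix z assume "z \<in> {x + y | x y. x - f \<in> K P \<and> y - g \<in> K P}"
    then obtain x y where xy: "z = x + y" "x - f \<in> K P" "y - g \<in> K P" by blast
    have "(x - f) + (y - g) \<in> K P" using xy by (intro K_add[OF P])
    then show "z \<in> cls P (f + g)" by (simp add: cls_def in_coset_iff[OF P] xy algebra_simps)
  next
    fix z assume "z \<in> cls P (f + g)"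
    then have "z - g - f \<in> K P" by (simp add: cls_def in_coset_iff[OF P] algebra_simps)
    then show "z \<in> {x + y | x y. x - f \<in> K P \<and> y - g \<in> K P}"
      by (intro CollectI exI[of _ "z - g"] exI[of _ g]) (simp add: K_zero[OF P])
  qed
qed

text \<open>Scalar multiplication and functoriality of the tensor product are defined by a union over all
  representatives. Once the relators are respected, a single representative suffices.\<close>

lemma cls_lift:
  assumes P: "Module.module R P" and Q: "Module.module R Q"
    and b: "\<And>x. x \<in> bilinear_relators P \<Longrightarrow> frag_extend b x \<in> K Q"
  shows "(\<Union>g\<in>cls P f. cls Q (frag_extend b g)) = cls Q (frag_extend b f)"
proof -
  have "cls Q (frag_extend b g) = cls Q (frag_extend b f)" if "g \<in> cls P f" for g
  proof (rule cls_eqI[OF Q])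
    have "g - f \<in> K P" using that by (simp add: cls_def in_coset_iff[OF P])
    then have "frag_extend b (g - f) \<in> K Q"
      by (intro frag_extend_K[OF P b K_zero[OF Q] K_minus[OF Q] K_add[OF Q]])
    then show "frag_extend b g - frag_extend b f \<in> K Q" by (simp add: frag_extend_diff)
  qed
  moreover have "f \<in> cls P f" by (simp add: cls_def in_coset_iff[OF P] K_zero[OF P])
  ultimately show ?thesis by blast
qed

text \<open>What \<open>tensor_map\<close> and scalar multiplication do on representatives.\<close>

definition push :: "('p \<Rightarrow> 'q) \<Rightarrow> ('s \<times> 'p \<Rightarrow>\<^sub>0 int) \<Rightarrow> ('s \<times> 'q \<Rightarrow>\<^sub>0 int)" where
  "push h = frag_extend (\<lambda>(s, p). frag_of (s, h p))"

definition scale :: "'s \<Rightarrow> ('s \<times> 'p \<Rightarrow>\<^sub>0 int) \<Rightarrow> ('s \<times> 'p \<Rightarrow>\<^sub>0 int)" where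
  "scale s = frag_extend (\<lambda>(t, p). frag_of (s \<otimes>\<^bsub>S\<^esub> t, p))"

lemma push_relators:
  assumes P: "Module.module R P" and Q: "Module.module R Q" and h: "h \<in> mod_hom R P Q"
    and x: "x \<in> bilinear_relators P"
  shows "push h x \<in> K Q"
proof -
  interpret P: Module.module R P by fact
  have hc: "\<And>p. p \<in> carrier P \<Longrightarrow> h p \<in> carrier Q"
    and ha: "\<And>p q. p \<in> carrier P \<Longrightarrow> q \<in> carrier P \<Longrightarrow> h (p \<oplus>\<^bsub>P\<^esub> q) = h p \<oplus>\<^bsub>Q\<^esub> h q"
    and hs: "\<And>r p. r \<in> carrier R \<Longrightarrow> p \<in> carrier P \<Longrightarrow> h (r \<odot>\<^bsub>P\<^esub> p) = r \<odot>\<^bsub>Q\<^esub> h p"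
    using h by (auto simp: mod_hom_def)
  show ?thesis using x unfolding bilinear_relators_def push_def
    by (auto simp: frag_extend_diff hc ha hs
        intro!: K_add_left[OF Q] K_add_right[OF Q] K_balance[OF Q])
qed

lemma push_K:
  assumes P: "Module.module R P" and Q: "Module.module R Q" and h: "h \<in> mod_hom R P Q"
    and f: "f \<in> K P"
  shows "push h f \<in> K Q"
  unfolding push_def
  by (rule frag_extend_K[OF P _ K_zero[OF Q] K_minus[OF Q] K_add[OF Q] f])
     (use push_relators[OF P Q h] in \<open>auto simp: push_def\<close>)

lemma scale_relators:
  assumes P: "Module.module R P" and s: "s \<in> carrier S" and x: "x \<in> bilinear_relators P"
  shows "scale s x \<in> K P"
proof -
  interpret P: Module.module R P by fact
  have *: "frag_of (s \<otimes>\<^bsub>S\<^esub> (t \<otimes>\<^bsub>S\<^esub> i r), p) - frag_of (s \<otimes>\<^bsub>S\<^esub> t, r \<odot>\<^bsub>P\<^esub> p) \<in> K P"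
    if "t \<in> carrier S" "r \<in> carrier R" "p \<in> carrier P" for t r p
    using K_balance[OF P, of "s \<otimes>\<^bsub>S\<^esub> t" r p] that s by (simp add: S.m_assoc i_closed)
  show ?thesis using x s unfolding bilinear_relators_def scale_def
    by (auto simp: frag_extend_diff S.r_distr * intro!: K_add_left[OF P] K_add_right[OF P])
qed

lemma tensor_map_cls:
  assumes "Module.module R P" "Module.module R Q" "h \<in> mod_hom R P Q"
  shows "tensor_map S R i Q h (cls P f) = cls Q (push h f)"
  using cls_lift[OF assms(1,2), of "\<lambda>(s, p). frag_of (s, h p)" f] push_relators[OF assms]
  by (simp add: tensor_map_def push_def cls_def)

lemma tensor_smult_cls:
  assumes "Module.module R P" "s \<in> carrier S"
  shows "s \<odot>\<^bsub>tensor S R i P\<^esub> cls P f = cls P (scale s f)"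
  using cls_lift[OF assms(1,1), of "\<lambda>(t, p). frag_of (s \<otimes>\<^bsub>S\<^esub> t, p)" f] scale_relators[OF assms]
  by (simp add: tensor_def Let_def scale_def cls_def)

lemma push_keys:
  assumes "Poly_Mapping.keys f \<subseteq> carrier S \<times> carrier P" "h \<in> carrier P \<rightarrow> carrier Q"
  shows "Poly_Mapping.keys (push h f) \<subseteq> carrier S \<times> carrier Q"
proof -
  have "Poly_Mapping.keys (push h f) \<subseteq>
      (\<Union>x\<in>Poly_Mapping.keys f. Poly_Mapping.keys ((\<lambda>(s, p). frag_of (s, h p)) x))"
    unfolding push_def by (rule keys_frag_extend)
  also have "\<dots> \<subseteq> carrier S \<times> carrier Q" using assms by fastforce
  finally show ?thesis .
qed

text \<open>On the tensor product, multiplication by \<open>i a\<close> on the left factor is multiplication by \<open>a\<close> on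
  the right factor; a decomposition of the latter therefore gives one of the former.\<close>

lemma scale_decompose:
  assumes P: "Module.module R P" and a: "a \<in> carrier R"
    and uc: "u \<in> carrier P \<rightarrow> carrier P" and vc: "v \<in> carrier P \<rightarrow> carrier P"
    and uv: "\<And>p. p \<in> carrier P \<Longrightarrow> a \<odot>\<^bsub>P\<^esub> p = u p \<oplus>\<^bsub>P\<^esub> v p"
    and f: "Poly_Mapping.keys f \<subseteq> carrier S \<times> carrier P"
  shows "scale (i a) f - push u f - push v f \<in> K P"
  using f
proof (induction rule: frag_induction)
  case zero
  show ?case by (simp add: scale_def push_def K_zero[OF P])
next
  case (one x)
  obtain s p where x: "x = (s, p)" "s \<in> carrier S" "p \<in> carrier P" using one by auto
  have "i a \<otimes>\<^bsub>S\<^esub> s = s \<otimes>\<^bsub>S\<^esub> i a" using x a i_closed S.m_comm by simp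
  moreover have "(frag_of (s \<otimes>\<^bsub>S\<^esub> i a, p) - frag_of (s, a \<odot>\<^bsub>P\<^esub> p)) +
      (frag_of (s, u p \<oplus>\<^bsub>P\<^esub> v p) - frag_of (s, u p) - frag_of (s, v p)) \<in> K P"
    using x a uc vc by (intro K_add[OF P] K_balance[OF P] K_add_right[OF P]) auto
  ultimately show ?case using x uv by (simp add: scale_def push_def algebra_simps)
next
  case (diff f g)
  have "scale (i a) (f - g) - push u (f - g) - push v (f - g) =
      (scale (i a) f - push u f - push v f) - (scale (i a) g - push u g - push v g)"
    by (simp add: scale_def push_def frag_extend_diff)
  then show ?case using K_diff[OF P diff] by simp
qed

lemma push_compose: "push g (push h f) = push (g \<circ> h) f"
  using frag_extend_compose[of "\<lambda>(s, p). frag_of (s, g p)" "\<lambda>(s, p). (s, h p)" f]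
  by (simp add: push_def comp_def case_prod_unfold)

lemma push_zero:
  assumes P: "Module.module R P" and h: "\<And>q. q \<in> carrier Q \<Longrightarrow> h q = \<zero>\<^bsub>P\<^esub>"
    and f: "Poly_Mapping.keys f \<subseteq> carrier S \<times> carrier Q"
  shows "push h f \<in> K P"
  using f
proof (induction rule: frag_induction)
  case (one x)
  then show ?case using h K_zero_right[OF P] by (auto simp: push_def)
qed (auto simp: push_def frag_extend_diff K_zero[OF P] K_diff[OF P])

end

section \<open>Lifting through a free module and null-homotopies\<close>

text \<open>Choose preimages under \<open>g\<close> of the values of \<open>f\<close> on the basis and extend linearly. Linear
  extension is available for functions on the basis, so the proof first identifies \<open>P\<close> with
  \<open>free_mod R B\<close> by taking coordinates.\<close>

lemma free_module_lift:
  assumes P: "Module.module R P" and M: "Module.module R M" and Q: "Module.module R Q"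
    and basis: "is_basis R P B"
    and f: "f \<in> mod_hom R P M" and g: "g \<in> mod_hom R Q M"
    and im: "f ` carrier P \<subseteq> g ` carrier Q"
  shows "\<exists>h\<in>mod_hom R P Q. \<forall>x\<in>carrier P. g (h x) = f x"
proof -
  interpret P: Module.module R P by fact
  interpret M: Module.module R M by fact
  interpret Q: Module.module R Q by fact
  have R: "cring R" by (rule P.R.is_cring)
  interpret F: Module.module R "free_mod R B" by (rule free_mod_module[OF R])
  have B: "B \<subseteq> carrier P" using basis by (simp add: is_basis_def)
  let ?c = "lin_ext R P (\<lambda>b. b)"
  have c_hom: "?c \<in> mod_hom R (free_mod R B) P" by (rule lin_ext_hom[OF P]) (use B in auto)
  have ex1: "\<exists>!c. c \<in> carrier (free_mod R B) \<and> x = ?c c" if "x \<in> carrier P" for x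
    using basis that unfolding is_basis_def free_mod_def lin_ext_def
    by (simp add: conj_assoc)
  \<comment> \<open>the coordinates of \<open>x\<close> in the basis\<close>
  define k where "k x = (THE c. c \<in> carrier (free_mod R B) \<and> x = ?c c)" for x
  have k: "k x \<in> carrier (free_mod R B)" "?c (k x) = x" if "x \<in> carrier P" for x
    using theI'[OF ex1[OF that]] unfolding k_def by simp_all
  have k_eq: "k x = c" if "c \<in> carrier (free_mod R B)" "x = ?c c" for x c
  proof -
    have "x \<in> carrier P" using that c_hom by (auto simp: mod_hom_def)
    from the1_equality[OF ex1[OF this]] show ?thesis unfolding k_def using that by simp
  qed
  have k_hom: "k \<in> mod_hom R P (free_mod R B)"
    unfolding mod_hom_def
  proof (intro CollectI conjI ballI)
    show "k \<in> carrier P \<rightarrow> carrier (free_mod R B)" using k by simp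
  next
    fix x y assume "x \<in> carrier P" "y \<in> carrier P"
    then show "k (x \<oplus>\<^bsub>P\<^esub> y) = k x \<oplus>\<^bsub>free_mod R B\<^esub> k y"
      using k c_hom by (intro k_eq) (simp_all add: mod_hom_def)
  next
    fix r x assume "r \<in> carrier R" "x \<in> carrier P"
    then show "k (r \<odot>\<^bsub>P\<^esub> x) = r \<odot>\<^bsub>free_mod R B\<^esub> k x"
      using k c_hom by (intro k_eq) (simp_all add: mod_hom_def)
  qed
  define \<phi> where "\<phi> b = (SOME q. q \<in> carrier Q \<and> g q = f b)" for b
  have \<phi>: "\<phi> b \<in> carrier Q" "g (\<phi> b) = f b" if "b \<in> B" for b
  proof -
    have "b \<in> carrier P" using B that by (rule subsetD)
    then have "f b \<in> g ` carrier Q" by (rule subsetD[OF im imageI])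
    then have "\<exists>q. q \<in> carrier Q \<and> g q = f b" by auto
    then show "\<phi> b \<in> carrier Q" "g (\<phi> b) = f b" unfolding \<phi>_def by (metis (mono_tags, lifting) someI)+
  qed
  have l_hom: "lin_ext R Q \<phi> \<in> mod_hom R (free_mod R B) Q"
    by (rule lin_ext_hom[OF Q]) (rule \<phi>(1))
  define h where "h x = lin_ext R Q \<phi> (k x)" for x
  have h_hom: "h \<in> mod_hom R P Q"
    using k_hom l_hom by (auto simp: mod_hom_def h_def Pi_iff)
  have fin: "g (\<Oplus>\<^bsub>Q\<^esub>b\<in>A. c b \<odot>\<^bsub>Q\<^esub> \<phi> b) = f (\<Oplus>\<^bsub>P\<^esub>b\<in>A. c b \<odot>\<^bsub>P\<^esub> b)"
    if "finite A" "A \<subseteq> B" "c \<in> UNIV \<rightarrow> carrier R" for A c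
    using that
  proof (induction A)
    case empty
    then show ?case using mod_hom_zero[OF P M f] mod_hom_zero[OF Q M g] by simp
  next
    case (insert a A)
    have cQ: "c b \<odot>\<^bsub>Q\<^esub> \<phi> b \<in> carrier Q" and cP: "c b \<odot>\<^bsub>P\<^esub> b \<in> carrier P" if "b \<in> insert a A" for b
      using that insert.prems \<phi> B by (auto intro!: Q.smult_closed P.smult_closed)
    have a: "a \<in> B" "c a \<in> carrier R" using insert.prems by auto
    have "g (\<Oplus>\<^bsub>Q\<^esub>b\<in>insert a A. c b \<odot>\<^bsub>Q\<^esub> \<phi> b) = g (c a \<odot>\<^bsub>Q\<^esub> \<phi> a \<oplus>\<^bsub>Q\<^esub> (\<Oplus>\<^bsub>Q\<^esub>b\<in>A. c b \<odot>\<^bsub>Q\<^esub> \<phi> b))"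
      using insert cQ by (subst Q.M.finsum_insert) (auto simp: Pi_iff)
    also have "\<dots> = g (c a \<odot>\<^bsub>Q\<^esub> \<phi> a) \<oplus>\<^bsub>M\<^esub> g (\<Oplus>\<^bsub>Q\<^esub>b\<in>A. c b \<odot>\<^bsub>Q\<^esub> \<phi> b)"
      using g cQ by (auto simp: mod_hom_def intro!: Q.M.finsum_closed)
    also have "g (c a \<odot>\<^bsub>Q\<^esub> \<phi> a) = c a \<odot>\<^bsub>M\<^esub> g (\<phi> a)" by (rule mod_hom_smult[OF g a(2) \<phi>(1)[OF a(1)]])
    also have "\<dots> = f (c a \<odot>\<^bsub>P\<^esub> a)" using a B \<phi> by (subst mod_hom_smult[OF f]) auto
    also have "g (\<Oplus>\<^bsub>Q\<^esub>b\<in>A. c b \<odot>\<^bsub>Q\<^esub> \<phi> b) = f (\<Oplus>\<^bsub>P\<^esub>b\<in>A. c b \<odot>\<^bsub>P\<^esub> b)" using insert by auto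
    also have "f (c a \<odot>\<^bsub>P\<^esub> a) \<oplus>\<^bsub>M\<^esub> f (\<Oplus>\<^bsub>P\<^esub>b\<in>A. c b \<odot>\<^bsub>P\<^esub> b) = f (c a \<odot>\<^bsub>P\<^esub> a \<oplus>\<^bsub>P\<^esub> (\<Oplus>\<^bsub>P\<^esub>b\<in>A. c b \<odot>\<^bsub>P\<^esub> b))"
      using f cP by (auto simp: mod_hom_def intro!: P.M.finsum_closed)
    also have "\<dots> = f (\<Oplus>\<^bsub>P\<^esub>b\<in>insert a A. c b \<odot>\<^bsub>P\<^esub> b)"
      using insert cP by (subst P.M.finsum_insert) (auto simp: Pi_iff)
    finally show ?case .
  qed
  have "g (h x) = f x" if x: "x \<in> carrier P" for x
  proof -
    have "k x \<in> carrier (free_mod R B)" by (rule k(1)[OF x])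
    then have "g (h x) = f (?c (k x))"
      unfolding h_def lin_ext_def by (intro fin) (auto simp: free_mod_def)
    then show ?thesis by (simp add: k(2)[OF x])
  qed
  with h_hom show ?thesis by blast
qed

lemma mod_hom_closed: "h \<in> mod_hom R M N \<Longrightarrow> x \<in> carrier M \<Longrightarrow> h x \<in> carrier N"
  by (auto simp: mod_hom_def)

lemma mod_hom_add:
  "h \<in> mod_hom R M N \<Longrightarrow> x \<in> carrier M \<Longrightarrow> y \<in> carrier M \<Longrightarrow> h (x \<oplus>\<^bsub>M\<^esub> y) = h x \<oplus>\<^bsub>N\<^esub> h y"
  by (simp add: mod_hom_def)

lemma mod_hom_minus:
  assumes M: "Module.module R M" and N: "Module.module R N" and h: "h \<in> mod_hom R M N"
    and x: "x \<in> carrier M"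
  shows "h (\<ominus>\<^bsub>M\<^esub> x) = \<ominus>\<^bsub>N\<^esub> h x"
proof -
  interpret M: Module.module R M by fact
  interpret N: Module.module R N by fact
  have "h (\<ominus>\<^bsub>M\<^esub> x) \<oplus>\<^bsub>N\<^esub> h x = \<zero>\<^bsub>N\<^esub>"
    using mod_hom_add[OF h, of "\<ominus>\<^bsub>M\<^esub> x" x] x mod_hom_zero[OF M N h] by (simp add: M.M.l_neg)
  then show ?thesis using x mod_hom_closed[OF h] by (metis M.M.a_inv_closed N.M.minus_equality)
qed

lemma mod_hom_diff:
  assumes M: "Module.module R M" and N: "Module.module R N"
    and f: "f \<in> mod_hom R M N" and g: "g \<in> mod_hom R M N"
  shows "(\<lambda>x. f x \<ominus>\<^bsub>N\<^esub> g x) \<in> mod_hom R M N"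
proof -
  interpret M: Module.module R M by fact
  interpret N: Module.module R N by fact
  have "(a \<oplus>\<^bsub>N\<^esub> b) \<ominus>\<^bsub>N\<^esub> (c \<oplus>\<^bsub>N\<^esub> d) = (a \<ominus>\<^bsub>N\<^esub> c) \<oplus>\<^bsub>N\<^esub> (b \<ominus>\<^bsub>N\<^esub> d)"
    if "a \<in> carrier N" "b \<in> carrier N" "c \<in> carrier N" "d \<in> carrier N" for a b c d
    using that by (simp add: a_minus_def N.M.minus_add N.M.a_ac)
  moreover have "r \<odot>\<^bsub>N\<^esub> a \<ominus>\<^bsub>N\<^esub> r \<odot>\<^bsub>N\<^esub> b = r \<odot>\<^bsub>N\<^esub> (a \<ominus>\<^bsub>N\<^esub> b)"
    if "r \<in> carrier R" "a \<in> carrier N" "b \<in> carrier N" for a b r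
    using that by (simp add: a_minus_def N.smult_r_distr N.smult_r_minus)
  ultimately show ?thesis using f g by (auto simp: mod_hom_def Pi_iff)
qed

lemma smult_mod_hom:
  assumes M: "Module.module R M" and a: "a \<in> carrier R"
  shows "(\<lambda>x. a \<odot>\<^bsub>M\<^esub> x) \<in> mod_hom R M M"
proof -
  interpret M: Module.module R M by fact
  have "a \<odot>\<^bsub>M\<^esub> (r \<odot>\<^bsub>M\<^esub> x) = r \<odot>\<^bsub>M\<^esub> (a \<odot>\<^bsub>M\<^esub> x)" if "r \<in> carrier R" "x \<in> carrier M" for r x
    using that a by (metis M.smult_assoc1 M.R.m_comm)
  then show ?thesis using a by (auto simp: mod_hom_def M.smult_r_distr)
qed

locale resolution =
  fixes R :: "'r ring" and N :: "('r, 'n) module"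
    and P :: "nat \<Rightarrow> ('r, 'p) module" and d :: "nat \<Rightarrow> 'p \<Rightarrow> 'p" and e :: "'p \<Rightarrow> 'n"
  assumes N: "Module.module R N" and res: "free_resolution R N P d e"
begin

lemma P: "Module.module R (P n)"
  using res by (simp add: free_resolution_def)

lemma basis: "\<exists>B. is_basis R (P n) B"
  using res by (simp add: free_resolution_def)

lemma e: "e \<in> mod_hom R (P 0) N"
  using res by (simp add: free_resolution_def)

lemma d: "d n \<in> mod_hom R (P (Suc n)) (P n)"
  using res by (simp add: free_resolution_def)

lemma exact: "d n ` carrier (P (Suc n)) =
    (case n of 0 \<Rightarrow> {x \<in> carrier (P 0). e x = \<zero>\<^bsub>N\<^esub>}
     | Suc m \<Rightarrow> {x \<in> carrier (P n). d m x = \<zero>\<^bsub>P m\<^esub>})"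
  using res by (cases n) (simp_all add: free_resolution_def)

lemma d_d: "x \<in> carrier (P (Suc (Suc n))) \<Longrightarrow> d n (d (Suc n) x) = \<zero>\<^bsub>P n\<^esub>"
  using exact[of "Suc n"] by auto

definition contracts :: "'r \<Rightarrow> nat \<Rightarrow> ('p \<Rightarrow> 'p) \<Rightarrow> bool" where
  "contracts a n h \<longleftrightarrow> h \<in> mod_hom R (P n) (P (Suc n)) \<and>
     (\<forall>y\<in>cycles P d n. d n (h y) = a \<odot>\<^bsub>P n\<^esub> y)"

text \<open>Once \<open>h\<close> contracts on cycles in degree \<open>n\<close>, the map \<open>x \<mapsto> a x - h (d x)\<close> takes values in the
  cycles of degree \<open>Suc n\<close>. By exactness these are boundaries, and the map lifts to the next homotopy
  \<open>k\<close>.\<close>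

lemma contracts_step:
  assumes a: "a \<in> carrier R" and h: "contracts a n h"
  shows "\<exists>k. contracts a (Suc n) k \<and>
     (\<forall>x\<in>carrier (P (Suc n)). a \<odot>\<^bsub>P (Suc n)\<^esub> x = d (Suc n) (k x) \<oplus>\<^bsub>P (Suc n)\<^esub> h (d n x))"
proof -
  interpret P0: Module.module R "P n" by (rule P)
  interpret P1: Module.module R "P (Suc n)" by (rule P)
  interpret P2: Module.module R "P (Suc (Suc n))" by (rule P)
  have hh: "h \<in> mod_hom R (P n) (P (Suc n))" using h by (simp add: contracts_def)
  have hd: "(\<lambda>x. h (d n x)) \<in> mod_hom R (P (Suc n)) (P (Suc n))"
    using hh d[of n] by (auto simp: mod_hom_def Pi_iff)
  define f where "f x = a \<odot>\<^bsub>P (Suc n)\<^esub> x \<ominus>\<^bsub>P (Suc n)\<^esub> h (d n x)" for x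
  have f: "f \<in> mod_hom R (P (Suc n)) (P (Suc n))"
    unfolding f_def[abs_def] by (rule mod_hom_diff[OF P P smult_mod_hom[OF P a] hd])
  have dn_cycle: "d n x \<in> cycles P d n" if "x \<in> carrier (P (Suc n))" for x
    using that d_d mod_hom_closed[OF d] by (cases n) auto
  have "d n (f x) = \<zero>\<^bsub>P n\<^esub>" if x: "x \<in> carrier (P (Suc n))" for x
  proof -
    have c: "a \<odot>\<^bsub>P (Suc n)\<^esub> x \<in> carrier (P (Suc n))" "h (d n x) \<in> carrier (P (Suc n))"
      using x a mod_hom_closed[OF hd] by auto
    have "d n (f x) = d n (a \<odot>\<^bsub>P (Suc n)\<^esub> x) \<ominus>\<^bsub>P n\<^esub> d n (h (d n x))"
      unfolding f_def using c
      by (simp add: a_minus_def mod_hom_add[OF d] mod_hom_minus[OF P P d])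
    also have "d n (h (d n x)) = a \<odot>\<^bsub>P n\<^esub> d n x"
      using h dn_cycle[OF x] by (simp add: contracts_def)
    also have "d n (a \<odot>\<^bsub>P (Suc n)\<^esub> x) = a \<odot>\<^bsub>P n\<^esub> d n x" by (rule mod_hom_smult[OF d a x])
    finally show ?thesis using a x mod_hom_closed[OF d] by (simp add: a_minus_def P0.M.r_neg)
  qed
  then have im: "f ` carrier (P (Suc n)) \<subseteq> d (Suc n) ` carrier (P (Suc (Suc n)))"
    unfolding exact using mod_hom_closed[OF f] by auto
  obtain B where "is_basis R (P (Suc n)) B" using basis by blast
  then obtain k where k: "k \<in> mod_hom R (P (Suc n)) (P (Suc (Suc n)))"
    "\<And>x. x \<in> carrier (P (Suc n)) \<Longrightarrow> d (Suc n) (k x) = f x"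
    using free_module_lift[OF P P P _ f d im] by blast
  have eq: "a \<odot>\<^bsub>P (Suc n)\<^esub> x = d (Suc n) (k x) \<oplus>\<^bsub>P (Suc n)\<^esub> h (d n x)"
    if x: "x \<in> carrier (P (Suc n))" for x
    using x a mod_hom_closed[OF hd x]
    by (simp add: k(2) f_def a_minus_def P1.M.a_assoc P1.M.l_neg)
  have "d (Suc n) (k y) = a \<odot>\<^bsub>P (Suc n)\<^esub> y" if y: "y \<in> cycles P d (Suc n)" for y
  proof -
    have "y \<in> carrier (P (Suc n))" "d n y = \<zero>\<^bsub>P n\<^esub>" using y by auto
    with eq[of y] show ?thesis
      using mod_hom_zero[OF P P hh] mod_hom_closed[OF d] mod_hom_closed[OF k(1)] by simp
  qed
  with k eq show ?thesis unfolding contracts_def by blast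
qed

lemma contracts_exists:
  assumes a: "a \<in> carrier R" and aN: "\<And>x. x \<in> carrier N \<Longrightarrow> a \<odot>\<^bsub>N\<^esub> x = \<zero>\<^bsub>N\<^esub>"
  shows "\<exists>h. contracts a n h"
proof (induction n)
  case 0
  have "(\<lambda>x. a \<odot>\<^bsub>P 0\<^esub> x) ` carrier (P 0) \<subseteq> d 0 ` carrier (P (Suc 0))"
    unfolding exact using mod_hom_closed[OF smult_mod_hom[OF P a]] aN mod_hom_closed[OF e]
    by (auto simp: mod_hom_smult[OF e a])
  moreover obtain B where "is_basis R (P 0) B" using basis by blast
  ultimately show ?case
    using free_module_lift[OF P P P _ smult_mod_hom[OF P a] d]
    unfolding contracts_def cycles.simps by blast
next
  case (Suc n)
  then show ?case using contracts_step[OF a] by blast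
qed

end

section \<open>Null-homotopic multiplication kills homology\<close>

text \<open>Since \<open>a\<close> acts as zero on \<open>N\<close>, multiplication by \<open>a\<close> on the resolution has a contracting
  homotopy. Base change turns it into a homotopy for multiplication by \<open>i a\<close>, which therefore sends
  every cycle to a boundary.\<close>

lemma homology_annihilated:
  assumes bc: "base_change S R i" and rs: "resolution R N P d e"
    and a: "a \<in> carrier R" and aN: "\<And>x. x \<in> carrier N \<Longrightarrow> a \<odot>\<^bsub>N\<^esub> x = \<zero>\<^bsub>N\<^esub>"
    and H_def: "H = homology_module (\<lambda>k. tensor S R i (P k)) (\<lambda>k. tensor_map S R i (P k) (d k)) n"
    and X: "X \<in> carrier H"
  shows "i a \<odot>\<^bsub>H\<^esub> X = \<zero>\<^bsub>H\<^esub>"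
proof -
  interpret base_change S R i by fact
  interpret resolution R N P d e by fact
  have ia: "i a \<in> carrier S" by (rule i_closed[OF a])
  let ?C = "\<lambda>k. tensor S R i (P k)" and ?D = "\<lambda>k. tensor_map S R i (P k) (d k)"
  let ?Z = "cycles ?C ?D n"
  define B where "B = ?D n ` carrier (?C (Suc n))"
  have B_eq: "B = {cls (P n) (push (d n) g) | g. Poly_Mapping.keys g \<subseteq> carrier S \<times> carrier (P (Suc n))}"
  proof -
    have "?D n ` {cls (P (Suc n)) g | g. Q g} = {?D n (cls (P (Suc n)) g) | g. Q g}" for Q by blast
    then show ?thesis unfolding B_def tensor_carrier tensor_map_cls[OF P P d] .
  qed
  have key: "i a \<odot>\<^bsub>?C n\<^esub> x \<in> B" if x: "x \<in> ?Z" for x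
  proof -
    have "x \<in> carrier (?C n)" using x by (cases n) auto
    then obtain f where f: "x = cls (P n) f" "Poly_Mapping.keys f \<subseteq> carrier S \<times> carrier (P n)"
      by (auto simp: tensor_carrier)
    \<comment> \<open>the homotopy in degree \<open>n\<close>, together with a term that vanishes on cycles\<close>
    obtain k v where k: "k \<in> mod_hom R (P n) (P (Suc n))" and v: "v \<in> carrier (P n) \<rightarrow> carrier (P n)"
      and dec: "\<And>p. p \<in> carrier (P n) \<Longrightarrow> a \<odot>\<^bsub>P n\<^esub> p = (d n \<circ> k) p \<oplus>\<^bsub>P n\<^esub> v p"
      and vf: "push v f \<in> K (P n)"
    proof (cases n)
      case 0
      interpret P0: Module.module R "P 0" by (rule P)
      obtain h where h: "contracts a 0 h" using contracts_exists[OF a aN] by blast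
      then have hh: "h \<in> mod_hom R (P 0) (P (Suc 0))" by (simp add: contracts_def)
      show thesis
      proof (rule that)
        show "h \<in> mod_hom R (P n) (P (Suc n))" using hh 0 by simp
        show "(\<lambda>_. \<zero>\<^bsub>P 0\<^esub>) \<in> carrier (P n) \<rightarrow> carrier (P n)" using 0 by simp
        show "a \<odot>\<^bsub>P n\<^esub> p = (d n \<circ> h) p \<oplus>\<^bsub>P n\<^esub> \<zero>\<^bsub>P 0\<^esub>" if "p \<in> carrier (P n)" for p
          using h that 0 mod_hom_closed[OF d, of "h p" 0] mod_hom_closed[OF hh, of p]
          by (simp add: contracts_def)
        show "push (\<lambda>_. \<zero>\<^bsub>P 0\<^esub>) f \<in> K (P n)" using push_zero[OF P _ f(2)] 0 by simp
      qed
    next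
      case (Suc m)
      obtain h where h: "contracts a m h" using contracts_exists[OF a aN] by blast
      then have hh: "h \<in> mod_hom R (P m) (P (Suc m))" by (simp add: contracts_def)
      obtain k where k: "contracts a (Suc m) k"
        "\<And>x. x \<in> carrier (P (Suc m)) \<Longrightarrow> a \<odot>\<^bsub>P (Suc m)\<^esub> x = d (Suc m) (k x) \<oplus>\<^bsub>P (Suc m)\<^esub> h (d m x)"
        using contracts_step[OF a h] by blast
      have "?D m x = K (P m)" using x Suc by (simp add: tensor_zero)
      then have "push (d m) f \<in> K (P m)"
        using f Suc by (simp add: tensor_map_cls[OF P P d] cls_zero_iff[OF P])
      then have "push h (push (d m) f) \<in> K (P n)" using push_K[OF P P hh] Suc by simp
      then show thesis
        using k Suc mod_hom_closed[OF hh] mod_hom_closed[OF d]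
        by (intro that[of k "h \<circ> d m"]) (auto simp: push_compose contracts_def)
    qed
    have "scale (i a) f - push (d n \<circ> k) f - push v f \<in> K (P n)"
      by (rule scale_decompose[OF P a _ v dec f(2)])
         (use mod_hom_closed[OF d] mod_hom_closed[OF k] in auto)
    from K_add[OF P this vf] have "scale (i a) f - push (d n) (push k f) \<in> K (P n)"
      by (simp add: push_compose)
    then have "i a \<odot>\<^bsub>?C n\<^esub> x = cls (P n) (push (d n) (push k f))"
      unfolding f(1) tensor_smult_cls[OF P ia] by (rule cls_eqI[OF P])
    moreover have "Poly_Mapping.keys (push k f) \<subseteq> carrier S \<times> carrier (P (Suc n))"
      by (rule push_keys[OF f(2)]) (use mod_hom_closed[OF k] in auto)
    ultimately show ?thesis unfolding B_eq by blast
  qed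
  \<comment> \<open>scalar multiplication on the quotient is a union over the whole coset, so boundaries must absorb
    each other and translates of \<open>z\<close> by boundaries must be cycles\<close>
  let ?M = "(?C n)\<lparr>carrier := ?Z\<rparr>"
  have H: "H = quot_module ?M B" by (simp add: H_def homology_module_def B_def)
  have coset: "B +>\<^bsub>?M\<^esub> y = {b \<oplus>\<^bsub>?C n\<^esub> y | b. b \<in> B}" for y
    by (auto simp: a_r_coset_def')
  have absorb: "B +>\<^bsub>?M\<^esub> y = B" if y: "y \<in> B" for y
  proof -
    obtain g where g: "y = cls (P n) (push (d n) g)"
      "Poly_Mapping.keys g \<subseteq> carrier S \<times> carrier (P (Suc n))" using y unfolding B_eq by blast
    have "B +>\<^bsub>?M\<^esub> y = {cls (P n) (push (d n) (f + g)) | f.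
        Poly_Mapping.keys f \<subseteq> carrier S \<times> carrier (P (Suc n))}"
    proof -
      have "{b \<oplus>\<^bsub>?C n\<^esub> y | b. b \<in> {F f | f. Q f}} = {F f \<oplus>\<^bsub>?C n\<^esub> y | f. Q f}"
        for Q :: "('a \<times> 'd \<Rightarrow>\<^sub>0 int) \<Rightarrow> bool" and F by blast
      then show ?thesis
        unfolding coset unfolding B_eq g(1) push_def frag_extend_add cls_add[OF P, symmetric] .
    qed
    also have "\<dots> = B"
    proof (intro equalityI subsetI)
      fix z assume "z \<in> B"
      then obtain f where f: "z = cls (P n) (push (d n) f)"
        "Poly_Mapping.keys f \<subseteq> carrier S \<times> carrier (P (Suc n))" unfolding B_eq by blast
      then show "z \<in> {cls (P n) (push (d n) (f + g)) | f.
          Poly_Mapping.keys f \<subseteq> carrier S \<times> carrier (P (Suc n))}"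
        using keys_frag_diff_subset[OF f(2) g(2)] by (intro CollectI exI[of _ "f - g"]) simp
    next
      fix z assume "z \<in> {cls (P n) (push (d n) (f + g)) | f.
          Poly_Mapping.keys f \<subseteq> carrier S \<times> carrier (P (Suc n))}"
      then show "z \<in> B" unfolding B_eq using keys_frag_add_subset[OF _ g(2)] by blast
    qed
    finally show ?thesis .
  qed
  obtain z where z: "z \<in> ?Z" "X = B +>\<^bsub>?M\<^esub> z"
    using X unfolding H quot_module_def by (auto simp: A_RCOSETS_def')
  have BZ: "b \<oplus>\<^bsub>?C n\<^esub> z \<in> ?Z" if b: "b \<in> B" for b
  proof -
    have "z \<in> carrier (?C n)" using z by (cases n) auto
    then obtain f where f: "z = cls (P n) f" "Poly_Mapping.keys f \<subseteq> carrier S \<times> carrier (P n)"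
      by (auto simp: tensor_carrier)
    obtain g where g: "b = cls (P n) (push (d n) g)"
      "Poly_Mapping.keys g \<subseteq> carrier S \<times> carrier (P (Suc n))" using b unfolding B_eq by blast
    have keys: "Poly_Mapping.keys (push (d n) g + f) \<subseteq> carrier S \<times> carrier (P n)"
      by (intro keys_frag_add_subset push_keys[OF g(2)] f(2)) (use mod_hom_closed[OF d] in auto)
    have eq: "b \<oplus>\<^bsub>?C n\<^esub> z = cls (P n) (push (d n) g + f)" by (simp add: f g cls_add[OF P])
    have in_C: "b \<oplus>\<^bsub>?C n\<^esub> z \<in> carrier (?C n)" unfolding eq tensor_carrier using keys by blast
    show ?thesis
    proof (cases n)
      case 0 then show ?thesis using in_C by simp
    next
      case (Suc m)
      have "push (d m) f \<in> K (P m)"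
        using z(1) f Suc by (simp add: tensor_map_cls[OF P P d] cls_zero_iff[OF P] tensor_zero)
      moreover have "push (d m) (push (d n) g) \<in> K (P m)"
        unfolding push_compose using g(2) d_d Suc by (intro push_zero[OF P]) auto
      ultimately have "push (d m) (push (d n) g + f) \<in> K (P m)"
        using K_add[OF P] by (simp add: push_def frag_extend_add)
      then have "?D m (b \<oplus>\<^bsub>?C n\<^esub> z) = \<zero>\<^bsub>?C m\<^esub>"
        unfolding eq using Suc by (simp add: tensor_map_cls[OF P P d] cls_zero_iff[OF P] tensor_zero)
      then show ?thesis using in_C Suc by simp
    qed
  qed
  have "cls (P n) (push (d n) 0) \<in> B" unfolding B_eq by (intro CollectI exI[of _ 0]) simp
  then have "X \<noteq> {}" unfolding z coset by blast
  moreover have "B +>\<^bsub>?M\<^esub> (i a \<odot>\<^bsub>?C n\<^esub> x) = B" if "x \<in> X" for x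
  proof -
    have "x \<in> ?Z" using that BZ unfolding z(2) coset by blast
    then show ?thesis by (intro absorb key)
  qed
  ultimately show ?thesis unfolding H quot_module_def by auto
qed

lemma Tor_annihilated:
  assumes bc: "base_change S R i" and N: "Module.module R N"
    and a: "a \<in> carrier R" and aN: "\<And>x. x \<in> carrier N \<Longrightarrow> a \<odot>\<^bsub>N\<^esub> x = \<zero>\<^bsub>N\<^esub>"
    and X: "X \<in> carrier (Tor S R i N n)"
  shows "i a \<odot>\<^bsub>Tor S R i N n\<^esub> X = \<zero>\<^bsub>Tor S R i N n\<^esub>"
proof -
  obtain P d e where c: "chosen_resolution R N = (P, d, e)" by (metis prod_cases3)
  have "(\<lambda>(P, d, e). free_resolution R N P d e) (chosen_resolution R N)"
    unfolding chosen_resolution_def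
    by (rule someI_ex[of "\<lambda>(P, d, e). free_resolution R N P d e"])
       (use free_resolution_exists[OF N] in auto)
  then have "free_resolution R N P d e" by (simp add: c)
  then have "resolution R N P d e" using N by (simp add: resolution_def)
  from homology_annihilated[OF bc this a aN _ X] show ?thesis by (simp add: Tor_def c)
qed

section \<open>Dimension of a module killed by a regular element\<close>

text \<open>The rows of \<open>E\<close> are images of unit vectors; in a one-element row module they agree with the image
  of the zero vector.\<close>

lemma row_module_singleton:
  assumes S: "cring S" and E: "projection_matrix S star k E"
    and single: "\<And>x y. x \<in> carrier (row_module S k E) \<Longrightarrow> y \<in> carrier (row_module S k E) \<Longrightarrow> x = y"
    and ij: "i < k" "j < k"
  shows "E i j = \<zero>\<^bsub>S\<^esub>"
proof -
  interpret cring S by fact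
  have Ec: "E i j \<in> carrier S" if "i < k" "j < k" for i j
    using E that unfolding projection_matrix_def by blast
  let ?row = "\<lambda>v. \<lambda>j\<in>{..<k}. \<Oplus>\<^bsub>S\<^esub>i\<in>{..<k}. v i \<otimes>\<^bsub>S\<^esub> E i j"
  define u where "u = (\<lambda>l\<in>{..<k}. if l = i then \<one>\<^bsub>S\<^esub> else \<zero>\<^bsub>S\<^esub>)"
  define o' where "o' = (\<lambda>l\<in>{..<k}. \<zero>\<^bsub>S\<^esub>)"
  have "u \<in> carrier (power_module S k)" "o' \<in> carrier (power_module S k)"
    by (auto simp: power_module_def u_def o'_def)
  then have "?row u = ?row o'" by (intro single) (auto simp: row_module_def)
  then have "?row u j = ?row o' j" by simp
  moreover have "?row u j = E i j"
  proof -
    have "?row u j = (\<Oplus>\<^bsub>S\<^esub>l\<in>{..<k}. if i = l then E l j else \<zero>\<^bsub>S\<^esub>)"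
      using ij Ec by (auto simp: u_def intro!: finsum_cong')
    also have "\<dots> = E i j" using ij Ec by (intro add.finprod_singleton) auto
    finally show ?thesis .
  qed
  moreover have "?row o' j = \<zero>\<^bsub>S\<^esub>"
  proof -
    have "?row o' j = (\<Oplus>\<^bsub>S\<^esub>l\<in>{..<k}. o' l \<otimes>\<^bsub>S\<^esub> E l j)" using ij by simp
    also have "\<dots> = (\<Oplus>\<^bsub>S\<^esub>l\<in>{..<k}. \<zero>\<^bsub>S\<^esub>)"
      by (rule finsum_cong') (use ij Ec in \<open>auto simp: o'_def\<close>)
    finally show ?thesis by simp
  qed
  ultimately show ?thesis by simp
qed

text \<open>The empty matrix presents the zero module, and any other projection matrix presenting it has
  zero entries, so the number defined by the description is unique.\<close>

lemma fgp_dim_trivial: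
  assumes S: "cring S" and P: "Module.module S P" and triv: "carrier P = {\<zero>\<^bsub>P\<^esub>}"
    and tr: "tr \<zero>\<^bsub>S\<^esub> = 0"
  shows "fgp_dim S star tr P = 0"
  unfolding fgp_dim_def
proof (rule the_equality)
  interpret cring S by fact
  interpret P: Module.module S P by fact
  have "projection_matrix S star 0 (\<lambda>_ _. \<zero>\<^bsub>S\<^esub>)" by (simp add: projection_matrix_def)
  moreover have "mod_iso S P (row_module S 0 (\<lambda>_ _. \<zero>\<^bsub>S\<^esub>))"
    unfolding mod_iso_def
    by (rule bexI[of _ "\<lambda>_ _. undefined"])
       (auto simp: mod_hom_def row_module_def power_module_def triv bij_betw_def restrict_def)
  ultimately show "\<exists>k E. projection_matrix S star k E \<and> mod_iso S P (row_module S k E) \<and>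
      complex_of_real 0 = (\<Sum>i<k. tr (E i i))"
    by (intro exI[of _ 0] exI[of _ "\<lambda>_ _. \<zero>\<^bsub>S\<^esub>"]) simp
next
  fix t assume "\<exists>k E. projection_matrix S star k E \<and> mod_iso S P (row_module S k E) \<and>
      complex_of_real t = (\<Sum>i<k. tr (E i i))"
  then obtain k E h where E: "projection_matrix S star k E"
    and h: "bij_betw h (carrier P) (carrier (row_module S k E))"
    and t: "complex_of_real t = (\<Sum>i<k. tr (E i i))"
    unfolding mod_iso_def by blast
  have "carrier (row_module S k E) = {h \<zero>\<^bsub>P\<^esub>}" using h by (simp add: bij_betw_def triv)
  then have "E i j = \<zero>\<^bsub>S\<^esub>" if "i < k" "j < k" for i j
    using that by (intro row_module_singleton[OF S E]) auto
  then show "t = 0" using t tr by simp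
qed

text \<open>A finitely generated projective submodule embeds into some \<open>S\<^sup>k\<close>, where multiplication by the
  regular element \<open>c\<close> is injective; being killed by \<open>c\<close>, it is zero.\<close>

lemma lueck_dim_annihilated:
  assumes S: "cring S" and c: "c \<in> carrier S"
    and regular: "\<And>s. s \<in> carrier S \<Longrightarrow> c \<otimes>\<^bsub>S\<^esub> s = \<zero>\<^bsub>S\<^esub> \<Longrightarrow> s = \<zero>\<^bsub>S\<^esub>"
    and kill: "\<And>x. x \<in> carrier Q \<Longrightarrow> c \<odot>\<^bsub>Q\<^esub> x = \<zero>\<^bsub>Q\<^esub>"
    and tr: "tr \<zero>\<^bsub>S\<^esub> = 0"
  shows "lueck_dim S star tr Q = 0"
proof -
  interpret cring S by fact
  have "fgp_dim S star tr (Q\<lparr>carrier := P\<rparr>) = 0"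
    if sub: "Module.submodule P S Q" and fg: "fg_projective S (Q\<lparr>carrier := P\<rparr>)" for P
  proof (rule fgp_dim_trivial[where tr = tr, OF S _ _ tr])
    let ?P = "Q\<lparr>carrier := P\<rparr>"
    show P: "Module.module S ?P" using fg by (simp add: fg_projective_def)
    then interpret P: Module.module S ?P .
    obtain k j r where j: "j \<in> mod_hom S ?P (power_module S k)"
      and rj: "\<And>x. x \<in> P \<Longrightarrow> r (j x) = x"
    proof -
      have "\<exists>k. \<exists>j\<in>mod_hom S ?P (power_module S k). \<exists>r. \<forall>x\<in>P. r (j x) = x"
        using fg unfolding fg_projective_def by fastforce
      with that show thesis by blast
    qed
    have PQ: "P \<subseteq> carrier Q" using sub by (auto simp: submodule_def subgroup_def)
    have j_zero: "j x = (\<lambda>l\<in>{..<k}. \<zero>\<^bsub>S\<^esub>)" if x: "x \<in> P" for x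
    proof -
      have jc: "j x \<in> {..<k} \<rightarrow>\<^sub>E carrier S" "j \<zero>\<^bsub>Q\<^esub> \<in> {..<k} \<rightarrow>\<^sub>E carrier S"
        using mod_hom_closed[OF j, of x] mod_hom_closed[OF j, of "\<zero>\<^bsub>Q\<^esub>"] x P.M.zero_closed
        by (simp_all add: power_module_def)
      have sm: "j (s \<odot>\<^bsub>Q\<^esub> y) = (\<lambda>l\<in>{..<k}. s \<otimes>\<^bsub>S\<^esub> j y l)" if "s \<in> carrier S" "y \<in> P" for s y
        using mod_hom_smult[OF j, of s y] that by (simp add: power_module_def)
      have "\<zero>\<^bsub>S\<^esub> \<odot>\<^bsub>Q\<^esub> \<zero>\<^bsub>Q\<^esub> = \<zero>\<^bsub>Q\<^esub>" using P.smult_l_null[of "\<zero>\<^bsub>Q\<^esub>"] P.M.zero_closed by simp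
      then have "j \<zero>\<^bsub>Q\<^esub> = (\<lambda>l\<in>{..<k}. \<zero>\<^bsub>S\<^esub> \<otimes>\<^bsub>S\<^esub> j \<zero>\<^bsub>Q\<^esub> l)"
        using sm[of "\<zero>\<^bsub>S\<^esub>" "\<zero>\<^bsub>Q\<^esub>"] P.M.zero_closed by simp
      also have "\<dots> = (\<lambda>l\<in>{..<k}. \<zero>\<^bsub>S\<^esub>)" 
        by (rule restrict_ext) (simp add: PiE_mem[OF jc(2)])
      finally have j0: "j \<zero>\<^bsub>Q\<^esub> = (\<lambda>l\<in>{..<k}. \<zero>\<^bsub>S\<^esub>)" .
      have cx: "(\<lambda>l\<in>{..<k}. c \<otimes>\<^bsub>S\<^esub> j x l) = (\<lambda>l\<in>{..<k}. \<zero>\<^bsub>S\<^esub>)"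
        using sm[OF c x] kill[of x] PQ x j0 by auto
      have cl: "c \<otimes>\<^bsub>S\<^esub> j x l = \<zero>\<^bsub>S\<^esub>" if "l < k" for l
      proof -
        from cx have "(\<lambda>l\<in>{..<k}. c \<otimes>\<^bsub>S\<^esub> j x l) l = (\<lambda>l\<in>{..<k}. \<zero>\<^bsub>S\<^esub>) l" by (rule fun_cong)
        with that show ?thesis by simp
      qed
      have jl: "j x l = \<zero>\<^bsub>S\<^esub>" if "l < k" for l
        by (rule regular[OF PiE_mem[OF jc(1)] cl[OF that]]) (simp add: that)
      show ?thesis
        by (rule PiE_ext[OF jc(1)]) (simp_all add: jl)
    qed
    have "x = \<zero>\<^bsub>Q\<^esub>" if "x \<in> P" for x
      using rj[of x] rj[of "\<zero>\<^bsub>Q\<^esub>"] j_zero[of x] j_zero[of "\<zero>\<^bsub>Q\<^esub>"] that P.M.zero_closed by simp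
    then have "P \<subseteq> {\<zero>\<^bsub>Q\<^esub>}" by blast
    moreover have "\<zero>\<^bsub>Q\<^esub> \<in> P" using P.M.zero_closed by simp
    ultimately show "carrier ?P = {\<zero>\<^bsub>?P\<^esub>}" by (simp add: set_eq_subset)
  qed
  then have "lueck_dim S star tr Q \<le> 0" unfolding lueck_dim_def by (intro Sup_least) auto
  then show ?thesis by simp
qed

section \<open>Finite-dimensional inner product spaces of functions\<close>

text \<open>Vectors are functions, so that spaces of continuous functions on the group and coordinate
  spaces are covered alike. The inner product is linear in its second argument.\<close>

locale inner_function_space =
  fixes V :: "('x \<Rightarrow> complex) set"
    and ip :: "('x \<Rightarrow> complex) \<Rightarrow> ('x \<Rightarrow> complex) \<Rightarrow> complex"
  assumes zero_closed: "(\<lambda>_. 0) \<in> V"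
    and add_closed: "u \<in> V \<Longrightarrow> v \<in> V \<Longrightarrow> (\<lambda>x. u x + v x) \<in> V"
    and scale_closed: "v \<in> V \<Longrightarrow> (\<lambda>x. c * v x) \<in> V"
    and ip_add: "u \<in> V \<Longrightarrow> v \<in> V \<Longrightarrow> w \<in> V \<Longrightarrow> ip u (\<lambda>x. v x + w x) = ip u v + ip u w"
    and ip_scale: "u \<in> V \<Longrightarrow> v \<in> V \<Longrightarrow> ip u (\<lambda>x. c * v x) = c * ip u v"
    and ip_cnj: "u \<in> V \<Longrightarrow> v \<in> V \<Longrightarrow> ip v u = cnj (ip u v)"
    and ip_nonneg: "v \<in> V \<Longrightarrow> 0 \<le> Re (ip v v)"
    and ip_definite: "v \<in> V \<Longrightarrow> ip v v = 0 \<Longrightarrow> v = (\<lambda>_. 0)"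
begin

definition orthonormal :: "nat \<Rightarrow> (nat \<Rightarrow> 'x \<Rightarrow> complex) \<Rightarrow> bool" where
  "orthonormal m e \<longleftrightarrow> (\<forall>i<m. e i \<in> V) \<and> (\<forall>i<m. \<forall>j<m. ip (e i) (e j) = (if i = j then 1 else 0))"

lemma diff_closed: "u \<in> V \<Longrightarrow> v \<in> V \<Longrightarrow> (\<lambda>x. u x - v x) \<in> V"
  using add_closed[OF _ scale_closed[of v "-1"], of u] by simp

lemma ip_diff: "u \<in> V \<Longrightarrow> v \<in> V \<Longrightarrow> w \<in> V \<Longrightarrow> ip u (\<lambda>x. v x - w x) = ip u v - ip u w"
  using ip_add[OF _ _ scale_closed[of w "-1"], of u v] ip_scale[of u w "-1"] by simp

lemma ip_add_left:
  "u \<in> V \<Longrightarrow> v \<in> V \<Longrightarrow> w \<in> V \<Longrightarrow> ip (\<lambda>x. v x + w x) u = ip v u + ip w u"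
  using ip_cnj[of u "\<lambda>x. v x + w x"] ip_cnj[of u v] ip_cnj[of u w] by (simp add: ip_add add_closed)

lemma ip_diff_left:
  "u \<in> V \<Longrightarrow> v \<in> V \<Longrightarrow> w \<in> V \<Longrightarrow> ip (\<lambda>x. v x - w x) u = ip v u - ip w u"
  using ip_cnj[of u "\<lambda>x. v x - w x"] ip_cnj[of u v] ip_cnj[of u w] by (simp add: ip_diff diff_closed)

lemma ip_zero: "u \<in> V \<Longrightarrow> ip u (\<lambda>_. 0) = 0"
  using ip_scale[of u "\<lambda>_. 0" 0] zero_closed by simp

lemma ip_self: "v \<in> V \<Longrightarrow> ip v v = of_real (Re (ip v v))"
  using ip_cnj[of v v] by (simp add: complex_eq_iff)

lemma sum_closed:
  "finite I \<Longrightarrow> (\<And>i. i \<in> I \<Longrightarrow> e i \<in> V) \<Longrightarrow> (\<lambda>x. \<Sum>i\<in>I. c i * e i x) \<in> V"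
proof (induction I rule: finite_induct)
  case (insert i I)
  then show ?case using add_closed[OF scale_closed[of "e i" "c i"]] by simp
qed (simp add: zero_closed)

lemma ip_sum:
  assumes "finite I" "\<And>i. i \<in> I \<Longrightarrow> e i \<in> V" "u \<in> V"
  shows "ip u (\<lambda>x. \<Sum>i\<in>I. c i * e i x) = (\<Sum>i\<in>I. c i * ip u (e i))"
  using assms
proof (induction I rule: finite_induct)
  case (insert i I)
  have "ip u (\<lambda>x. \<Sum>i\<in>insert i I. c i * e i x) = ip u (\<lambda>x. c i * e i x + (\<Sum>i\<in>I. c i * e i x))"
    using insert by simp
  also have "\<dots> = c i * ip u (e i) + ip u (\<lambda>x. \<Sum>i\<in>I. c i * e i x)"
    using insert by (subst ip_add) (auto simp: ip_scale intro!: scale_closed sum_closed)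
  finally show ?case using insert by simp
qed (simp add: ip_zero)

definition proj :: "nat \<Rightarrow> (nat \<Rightarrow> 'x \<Rightarrow> complex) \<Rightarrow> ('x \<Rightarrow> complex) \<Rightarrow> 'x \<Rightarrow> complex" where
  "proj m e v = (\<lambda>x. \<Sum>i<m. ip (e i) v * e i x)"

lemma proj_closed: "orthonormal m e \<Longrightarrow> proj m e v \<in> V"
  unfolding proj_def by (rule sum_closed) (auto simp: orthonormal_def)

lemma ip_proj:
  assumes "orthonormal m e" "v \<in> V" "i < m"
  shows "ip (e i) (proj m e v) = ip (e i) v"
proof -
  have "ip (e i) (proj m e v) = (\<Sum>j<m. ip (e j) v * ip (e i) (e j))"
    unfolding proj_def using assms by (intro ip_sum) (auto simp: orthonormal_def)
  also have "\<dots> = (\<Sum>j<m. if j = i then ip (e i) v else 0)"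
    using assms by (intro sum.cong) (auto simp: orthonormal_def)
  finally show ?thesis using assms(3) by simp
qed

lemma ip_residual:
  assumes "orthonormal m e" "v \<in> V" "i < m"
  shows "ip (e i) (\<lambda>x. v x - proj m e v x) = 0"
  using assms ip_proj[OF assms] proj_closed[OF assms(1)] by (subst ip_diff) (auto simp: orthonormal_def)

text \<open>The projection onto the span is orthogonal to the residual, whose squared norm is therefore the
  difference of the two sides.\<close>

lemma bessel:
  assumes e: "orthonormal m e" and v: "v \<in> V"
  shows "(\<Sum>i<m. (cmod (ip (e i) v))\<^sup>2) \<le> Re (ip v v)"
proof -
  let ?p = "proj m e v" and ?r = "\<lambda>x. v x - proj m e v x"
  have eV: "e i \<in> V" if "i < m" for i using e that by (simp add: orthonormal_def)
  have pV: "?p \<in> V" by (rule proj_closed[OF e])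
  have rV: "?r \<in> V" by (rule diff_closed[OF v pV])
  have "ip ?r ?p = (\<Sum>i<m. ip (e i) v * ip ?r (e i))"
    unfolding proj_def[of m e v] using eV rV[unfolded proj_def] by (subst ip_sum) auto
  also have "\<dots> = 0"
    using ip_residual[OF e v] ip_cnj[OF eV rV] by simp
  finally have "ip ?r ?p = 0" .
  then have "ip ?r ?r = ip ?r v" using rV v pV by (subst ip_diff) auto
  also have "\<dots> = ip v v - ip ?p v" using v pV by (subst ip_diff_left) auto
  also have "ip ?p v = cnj (ip v ?p)" by (rule ip_cnj[OF v pV])
  also have "ip v ?p = (\<Sum>i<m. ip (e i) v * ip v (e i))"
    unfolding proj_def using eV v by (intro ip_sum) auto
  also have "\<dots> = (\<Sum>i<m. of_real ((cmod (ip (e i) v))\<^sup>2))"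
    using ip_cnj[OF eV v] by (intro sum.cong refl) (simp add: complex_norm_square del: of_real_power)
  finally have "Re (ip ?r ?r) = Re (ip v v) - (\<Sum>i<m. (cmod (ip (e i) v))\<^sup>2)" by simp
  with ip_nonneg[OF rV] show ?thesis by simp
qed

text \<open>The residual of \<open>v\<close> after projection to the line through \<open>u\<close> has nonnegative squared norm.\<close>

lemma cauchy_schwarz:
  assumes u: "u \<in> V" and v: "v \<in> V"
  shows "(cmod (ip u v))\<^sup>2 \<le> Re (ip u u) * Re (ip v v)"
proof (cases "u = (\<lambda>_. 0)")
  case True
  then have "ip v u = 0" using ip_zero[OF v] by simp
  with ip_cnj[OF v u] have "ip u v = 0" by simp
  then show ?thesis using ip_nonneg[OF u] ip_nonneg[OF v] by simp
next
  case False
  define p where "p = Re (ip u u)"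
  have uu: "ip u u = of_real p" unfolding p_def by (rule ip_self[OF u])
  have "p \<noteq> 0" using False ip_definite[OF u] uu by auto
  moreover have "p \<ge> 0" unfolding p_def by (rule ip_nonneg[OF u])
  ultimately have p: "p > 0" by simp
  define c where "c = ip u v / of_real p"
  let ?w = "\<lambda>x. v x - c * u x"
  have cu: "(\<lambda>x. c * u x) \<in> V" by (rule scale_closed[OF u])
  have w: "?w \<in> V" by (rule diff_closed[OF v cu])
  have "ip u ?w = ip u v - c * ip u u" using ip_diff[OF u v cu] ip_scale[OF u u, of c] by simp
  also have "\<dots> = 0" using p by (simp add: uu c_def)
  finally have "ip u ?w = 0" .
  then have "ip ?w u = 0" using ip_cnj[OF u w] by simp
  then have "ip ?w ?w = ip ?w v" using v cu w u by (subst ip_diff) (auto simp: ip_scale)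
  also have "\<dots> = ip v v - ip (\<lambda>x. c * u x) v" using v cu by (subst ip_diff_left) auto
  also have "ip (\<lambda>x. c * u x) v = cnj (c * ip v u)" using ip_cnj[OF v cu] u v by (simp add: ip_scale)
  also have "\<dots> = of_real ((cmod (ip u v))\<^sup>2 / p)"
    using ip_cnj[OF u v] by (simp add: c_def complex_norm_square mult.commute del: of_real_power)
  finally have "Re (ip ?w ?w) = Re (ip v v) - (cmod (ip u v))\<^sup>2 / p" by simp
  with ip_nonneg[OF w] have "(cmod (ip u v))\<^sup>2 / p \<le> Re (ip v v)" by simp
  then show ?thesis using p by (simp add: p_def divide_le_eq mult.commute)
qed

lemma extend_orthonormal:
  assumes e: "orthonormal m e" and w: "w \<in> V" "w \<noteq> (\<lambda>_. 0)" and orth: "\<And>i. i < m \<Longrightarrow> ip (e i) w = 0"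
  shows "\<exists>f. orthonormal (Suc m) f"
proof -
  define q where "q = Re (ip w w)"
  have ww: "ip w w = of_real q" unfolding q_def by (rule ip_self[OF w(1)])
  have "q \<noteq> 0" using ip_definite[OF w(1)] w(2) ww by auto
  then have q: "q > 0" using ip_nonneg[OF w(1)] by (simp add: q_def)
  define u where "u = (\<lambda>x. of_real (1 / sqrt q) * w x)"
  have u: "u \<in> V" unfolding u_def by (rule scale_closed[OF w(1)])
  have iu: "ip v u = of_real (1 / sqrt q) * ip v w" if "v \<in> V" for v
    unfolding u_def by (rule ip_scale[OF that w(1)])
  have "ip u u = of_real (1 / sqrt q) * cnj (ip w u)" using iu[OF u] ip_cnj[OF w(1) u] by simp
  also have "ip w u = of_real (1 / sqrt q) * of_real q" using iu[OF w(1)] ww by simp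
  also have "of_real (1 / sqrt q) * cnj (of_real (1 / sqrt q) * of_real q) = (of_real (1 / sqrt q * (1 / sqrt q * q)) :: complex)"
    by (simp only: complex_cnj_complex_of_real complex_cnj_mult of_real_mult)
  also have "1 / sqrt q * (1 / sqrt q * q) = 1" using q by (simp add: field_simps)
  finally have uu: "ip u u = 1" by simp
  have eV: "e i \<in> V" if "i < m" for i using e that by (simp add: orthonormal_def)
  have "ip (e i) u = 0" if "i < m" for i using iu[OF eV[OF that]] orth[OF that] by simp
  moreover have "ip u (e i) = 0" if "i < m" for i using ip_cnj[OF eV[OF that] u] calculation[OF that] by simp
  ultimately have "orthonormal (Suc m) (\<lambda>i. if i < m then e i else u)"
    using e u uu by (auto simp: orthonormal_def less_Suc_eq)
  then show ?thesis by blast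
qed

end

text \<open>Finite dimension is a bound on the length of orthonormal families, because this is the form in
  which Bessel's inequality provides it.\<close>

locale finite_inner_space = inner_function_space +
  fixes N :: nat
  assumes dim_bound: "orthonormal m e \<Longrightarrow> m \<le> N"
begin

text \<open>An orthonormal family of maximal length spans: otherwise the normalised residual of a vector
  outside its span would extend it.\<close>

lemma orthonormal_basis_exists:
  "\<exists>m e. orthonormal m e \<and> (\<forall>v\<in>V. v = proj m e v)"
proof -
  let ?m = "Greatest (\<lambda>m. \<exists>e. orthonormal m e)"
  have ex0: "\<exists>e. orthonormal 0 e" by (simp add: orthonormal_def)
  have "\<exists>e. orthonormal ?m e"
    by (rule GreatestI_nat[of "\<lambda>m. \<exists>e. orthonormal m e" 0 N]) (use ex0 dim_bound in auto)
  then obtain e where e: "orthonormal ?m e" by blast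
  have "v = proj ?m e v" if v: "v \<in> V" for v
  proof (rule ccontr)
    assume ne: "v \<noteq> proj ?m e v"
    let ?r = "\<lambda>x. v x - proj ?m e v x"
    have "?r \<in> V" by (rule diff_closed[OF v proj_closed[OF e]])
    moreover have "?r \<noteq> (\<lambda>_. 0)" using ne by (auto simp: fun_eq_iff)
    ultimately have "\<exists>f. orthonormal (Suc ?m) f"
      by (intro extend_orthonormal[OF e]) (auto intro: ip_residual[OF e v])
    then have "Suc ?m \<le> ?m"
      by (intro Greatest_le_nat[of "\<lambda>m. \<exists>e. orthonormal m e" _ N]) (use dim_bound in auto)
    then show False by simp
  qed
  with e show ?thesis by blast
qed

end

context inner_function_space
begin

lemma parseval:
  assumes e: "orthonormal m e" and span: "\<And>v. v \<in> V \<Longrightarrow> v = proj m e v" and u: "u \<in> V" and v: "v \<in> V"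
  shows "ip u v = (\<Sum>k<m. ip u (e k) * ip (e k) v)"
proof -
  have "ip u v = ip u (proj m e v)" using span[OF v] by simp
  also have "\<dots> = (\<Sum>k<m. ip (e k) v * ip u (e k))"
    unfolding proj_def using e u by (intro ip_sum) (auto simp: orthonormal_def)
  finally show ?thesis by (simp add: mult.commute)
qed

lemma subspace:
  assumes "W \<subseteq> V" "(\<lambda>_. 0) \<in> W" "\<And>u v. u \<in> W \<Longrightarrow> v \<in> W \<Longrightarrow> (\<lambda>x. u x + v x) \<in> W"
    "\<And>c v. v \<in> W \<Longrightarrow> (\<lambda>x. c * v x) \<in> W"
  shows "inner_function_space W ip"
proof
  fix u v assume "u \<in> W" "v \<in> W"
  then have "u \<in> V" "v \<in> V" using assms(1) by blast+
  then show "ip v u = cnj (ip u v)" by (rule ip_cnj)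
qed (use assms ip_add ip_scale ip_nonneg ip_definite in \<open>auto simp: subset_iff\<close>)

end

section \<open>The span of the matrix coefficients\<close>

abbreviation coeffs :: "'g::topological_space monoid \<Rightarrow> ('g \<Rightarrow> complex) set" where
  "coeffs G \<equiv> carrier (coeff_algebra G)"

lemma coeffs_def: "coeffs G = {\<lambda>x. \<Sum>u\<in>F. c u * u x | F c. finite F \<and> F \<subseteq> matrix_coeffs G}"
  by (simp add: coeff_algebra_def fun_ring_def)

lemma coeffs_base: "u \<in> matrix_coeffs G \<Longrightarrow> u \<in> coeffs G"
  unfolding coeffs_def by (intro CollectI exI[of _ "{u}"] exI[of _ "\<lambda>_. 1"]) auto

lemma coeffs_zero: "(\<lambda>_. 0) \<in> coeffs G"
  unfolding coeffs_def by (intro CollectI exI[of _ "{}"]) auto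

lemma coeffs_scale:
  assumes "f \<in> coeffs G" shows "(\<lambda>x. a * f x) \<in> coeffs G"
proof -
  obtain F c where "f = (\<lambda>x. \<Sum>u\<in>F. c u * u x)" "finite F" "F \<subseteq> matrix_coeffs G"
    using assms unfolding coeffs_def by blast
  then show ?thesis unfolding coeffs_def
    by (intro CollectI exI[of _ F] exI[of _ "\<lambda>u. a * c u"]) (auto simp: sum_distrib_left mult.assoc)
qed

lemma coeffs_add:
  assumes "f \<in> coeffs G" "g \<in> coeffs G" shows "(\<lambda>x. f x + g x) \<in> coeffs G"
proof -
  obtain F c where f: "f = (\<lambda>x. \<Sum>u\<in>F. c u * u x)" "finite F" "F \<subseteq> matrix_coeffs G"
    using assms unfolding coeffs_def by blast
  obtain H b where g: "g = (\<lambda>x. \<Sum>u\<in>H. b u * u x)" "finite H" "H \<subseteq> matrix_coeffs G"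
    using assms unfolding coeffs_def by blast
  let ?c = "\<lambda>u. (if u \<in> F then c u else 0) + (if u \<in> H then b u else 0)"
  have "f x + g x = (\<Sum>u\<in>F \<union> H. ?c u * u x)" for x
  proof -
    have "f x = (\<Sum>u\<in>F \<union> H. (if u \<in> F then c u else 0) * u x)"
      unfolding f(1) using f(2) g(2) by (intro sum.mono_neutral_cong_left) auto
    moreover have "g x = (\<Sum>u\<in>F \<union> H. (if u \<in> H then b u else 0) * u x)"
      unfolding g(1) using f(2) g(2) by (intro sum.mono_neutral_cong_left) auto
    ultimately show ?thesis by (simp add: sum.distrib distrib_right)
  qed
  then show ?thesis unfolding coeffs_def using f g
    by (intro CollectI exI[of _ "F \<union> H"] exI[of _ ?c]) auto
qed

lemma coeffs_sum:
  "finite I \<Longrightarrow> (\<And>i. i \<in> I \<Longrightarrow> f i \<in> coeffs G) \<Longrightarrow> (\<lambda>x. \<Sum>i\<in>I. f i x) \<in> coeffs G"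
proof (induction I rule: finite_induct)
  case (insert i I)
  then show ?case using coeffs_add[of "f i" G "\<lambda>x. \<Sum>i\<in>I. f i x"] by simp
qed (simp add: coeffs_zero)

section \<open>Complete reducibility\<close>

locale unitary_action = finite_inner_space V ip N
  for V :: "('x \<Rightarrow> complex) set" and ip N +
  fixes G :: "'g::topological_space monoid" and act :: "'g \<Rightarrow> ('x \<Rightarrow> complex) \<Rightarrow> 'x \<Rightarrow> complex"
  assumes group: "group G" and carrier: "carrier G = UNIV"
    and act_closed: "v \<in> V \<Longrightarrow> act s v \<in> V"
    and act_mult: "v \<in> V \<Longrightarrow> act (s \<otimes>\<^bsub>G\<^esub> t) v = act s (act t v)"
    and act_ip: "u \<in> V \<Longrightarrow> v \<in> V \<Longrightarrow> ip (act s u) (act s v) = ip u v"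
    and act_cont: "u \<in> V \<Longrightarrow> v \<in> V \<Longrightarrow> continuous_on UNIV (\<lambda>s. ip u (act s v))"
begin

text \<open>The operator of the unit is idempotent and isometric, which makes \<open>act \<one> v - v\<close> a vector of
  norm zero.\<close>

lemma act_one:
  assumes v: "v \<in> V" shows "act \<one>\<^bsub>G\<^esub> v = v"
proof -
  interpret G: group G by (rule group)
  let ?w = "act \<one>\<^bsub>G\<^esub> v"
  have w: "?w \<in> V" by (rule act_closed[OF v])
  have ww: "ip ?w ?w = ip v v" by (rule act_ip[OF v v])
  have "act \<one>\<^bsub>G\<^esub> ?w = ?w" using act_mult[OF v, of "\<one>\<^bsub>G\<^esub>" "\<one>\<^bsub>G\<^esub>"] by simp
  then have wv: "ip ?w v = ip v v" using act_ip[OF w v, of "\<one>\<^bsub>G\<^esub>"] ww by simp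
  moreover have "ip v ?w = ip v v" using ip_cnj[OF w v] wv ip_cnj[OF v v] by simp
  ultimately have "ip (\<lambda>x. ?w x - v x) (\<lambda>x. ?w x - v x) = 0"
    using ww v w by (simp add: ip_diff ip_diff_left diff_closed)
  from ip_definite[OF diff_closed[OF w v] this] show ?thesis by (simp add: fun_eq_iff)
qed

lemma act_adjoint:
  assumes "u \<in> V" "v \<in> V" shows "ip u (act s v) = ip (act (inv\<^bsub>G\<^esub> s) u) v"
proof -
  interpret G: group G by (rule group)
  have s: "s \<in> carrier G" by (simp add: carrier)
  have "act s (act (inv\<^bsub>G\<^esub> s) u) = u"
    using act_mult[OF assms(1), of s "inv\<^bsub>G\<^esub> s"] s act_one[OF assms(1)] by simp
  then show ?thesis using act_ip[OF act_closed[OF assms(1)] assms(2), of s "inv\<^bsub>G\<^esub> s"] by simp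
qed

definition rep_mat :: "nat \<Rightarrow> (nat \<Rightarrow> 'x \<Rightarrow> complex) \<Rightarrow> 'g \<Rightarrow> complex mat" where
  "rep_mat m e s = mat m m (\<lambda>(i, j). ip (e i) (act s (e j)))"

context
  fixes m e
  assumes e: "orthonormal m e" and span: "\<And>v. v \<in> V \<Longrightarrow> v = proj m e v"
begin

lemma eV: "i < m \<Longrightarrow> e i \<in> V"
  using e by (simp add: orthonormal_def)

lemma coords_act:
  assumes v: "v \<in> V" and u: "u \<in> V"
  shows "ip u (act s v) = (\<Sum>k<m. ip u (act s (e k)) * ip (e k) v)"
proof -
  have "ip u (act s v) = ip (act (inv\<^bsub>G\<^esub> s) u) v" by (rule act_adjoint[OF u v])
  also have "\<dots> = (\<Sum>k<m. ip (act (inv\<^bsub>G\<^esub> s) u) (e k) * ip (e k) v)"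
    by (rule parseval[OF e span act_closed[OF u] v])
  finally show ?thesis using act_adjoint[OF u eV] by simp
qed

lemma unitary_rep_mat: "unitary_rep G m (rep_mat m e)"
  unfolding unitary_rep_def
proof (intro conjI ballI allI impI)
  fix s show "rep_mat m e s \<in> carrier_mat m m" by (simp add: rep_mat_def)
  show "map_mat cnj (transpose_mat (rep_mat m e s)) * rep_mat m e s = 1\<^sub>m m"
  proof (rule eq_matI)
    fix i j assume "i < dim_row (1\<^sub>m m :: complex mat)" "j < dim_col (1\<^sub>m m :: complex mat)"
    then have ij: "i < m" "j < m" by auto
    have "(map_mat cnj (transpose_mat (rep_mat m e s)) * rep_mat m e s) $$ (i, j) =
        (\<Sum>k<m. cnj (ip (e k) (act s (e i))) * ip (e k) (act s (e j)))"
      using ij by (simp add: rep_mat_def scalar_prod_def atLeast0LessThan)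
    also have "\<dots> = (\<Sum>k<m. ip (act s (e i)) (e k) * ip (e k) (act s (e j)))"
      using ip_cnj[OF eV act_closed[OF eV[OF ij(1)]]] by (intro sum.cong refl) simp
    also have "\<dots> = ip (act s (e i)) (act s (e j))"
      by (rule parseval[OF e span, symmetric]) (use ij eV act_closed in auto)
    also have "\<dots> = 1\<^sub>m m $$ (i, j)" using ij e by (simp add: act_ip eV orthonormal_def)
    finally show "(map_mat cnj (transpose_mat (rep_mat m e s)) * rep_mat m e s) $$ (i, j) = 1\<^sub>m m $$ (i, j)" .
  qed (simp_all add: rep_mat_def)
next
  fix s t
  show "rep_mat m e (s \<otimes>\<^bsub>G\<^esub> t) = rep_mat m e s * rep_mat m e t"
  proof (rule eq_matI)
    fix i j assume "i < dim_row (rep_mat m e s * rep_mat m e t)" "j < dim_col (rep_mat m e s * rep_mat m e t)"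
    then have ij: "i < m" "j < m" by (auto simp: rep_mat_def)
    have "ip (e i) (act (s \<otimes>\<^bsub>G\<^esub> t) (e j)) = ip (e i) (act s (act t (e j)))"
      using ij eV by (simp add: act_mult)
    also have "\<dots> = (\<Sum>k<m. ip (e i) (act s (e k)) * ip (e k) (act t (e j)))"
      by (rule coords_act) (use ij eV act_closed in auto)
    finally show "rep_mat m e (s \<otimes>\<^bsub>G\<^esub> t) $$ (i, j) = (rep_mat m e s * rep_mat m e t) $$ (i, j)"
      using ij by (simp add: rep_mat_def scalar_prod_def atLeast0LessThan)
  qed (simp_all add: rep_mat_def)
next
  fix i j assume "i < m" "j < m"
  then show "continuous_on (carrier G) (\<lambda>g. rep_mat m e g $$ (i, j))"
    using act_cont[OF eV eV] by (simp add: rep_mat_def carrier)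
qed

lemma coefficient_irreducible:
  assumes irr: "irreducible_rep G m (rep_mat m e)" and u: "u \<in> V" and v: "v \<in> V"
  shows "(\<lambda>s. ip u (act s v)) \<in> coeffs G"
proof -
  have "(\<lambda>s. ip (e i) (act s (e k))) \<in> coeffs G" if "i < m" "k < m" for i k
  proof (rule coeffs_base)
    have "(\<lambda>s. rep_mat m e s $$ (i, k)) \<in> matrix_coeffs G"
      unfolding matrix_coeffs_def using irr that by blast
    then show "(\<lambda>s. ip (e i) (act s (e k))) \<in> matrix_coeffs G" using that by (simp add: rep_mat_def)
  qed
  then have "(\<lambda>s. \<Sum>k<m. \<Sum>i<m. (ip u (e i) * ip (e k) v) * ip (e i) (act s (e k))) \<in> coeffs G"
    by (intro coeffs_sum coeffs_scale) auto
  moreover have "ip u (act s v) = (\<Sum>k<m. \<Sum>i<m. (ip u (e i) * ip (e k) v) * ip (e i) (act s (e k)))" for s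
  proof -
    have "ip u (act s v) = (\<Sum>k<m. ip u (act s (e k)) * ip (e k) v)" by (rule coords_act[OF v u])
    also have "\<dots> = (\<Sum>k<m. (\<Sum>i<m. ip u (e i) * ip (e i) (act s (e k))) * ip (e k) v)"
    proof (rule sum.cong[OF refl])
      fix k assume "k \<in> {..<m}"
      then show "ip u (act s (e k)) * ip (e k) v = (\<Sum>i<m. ip u (e i) * ip (e i) (act s (e k))) * ip (e k) v"
        using parseval[OF e span u act_closed[OF eV, of k s]] by simp
    qed
    finally show ?thesis by (simp add: sum_distrib_left sum_distrib_right mult_ac)
  qed
  ultimately show ?thesis by (simp add: fun_eq_iff)
qed

text \<open>Irreducibility is a statement about spaces of coordinate vectors; taking coordinates in the
  basis \<open>e\<close> transports it to subspaces of \<open>V\<close>.\<close>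

lemma invariant_subspace_of_reducible:
  assumes red: "\<not> irreducible_rep G m (rep_mat m e)" and m: "0 < m"
  obtains W where "W \<subseteq> V" "(\<lambda>_. 0) \<in> W" "\<And>u v. u \<in> W \<Longrightarrow> v \<in> W \<Longrightarrow> (\<lambda>x. u x + v x) \<in> W"
    "\<And>c v. v \<in> W \<Longrightarrow> (\<lambda>x. c * v x) \<in> W" "\<And>s v. v \<in> W \<Longrightarrow> act s v \<in> W"
    "W \<noteq> V" "W \<noteq> {\<lambda>_. 0}"
proof -
  define co where "co v = vec m (\<lambda>i. ip (e i) v)" for v
  obtain W' where W': "invariant_subspace G m (rep_mat m e) W'" "W' \<noteq> {0\<^sub>v m}" "W' \<noteq> carrier_vec m"
    using red m unitary_rep_mat unfolding irreducible_rep_def by blast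
  have W0: "0\<^sub>v m \<in> W'" and Wc: "W' \<subseteq> carrier_vec m"
    and Wadd: "\<And>v w. v \<in> W' \<Longrightarrow> w \<in> W' \<Longrightarrow> v + w \<in> W'" and Wsc: "\<And>c v. v \<in> W' \<Longrightarrow> c \<cdot>\<^sub>v v \<in> W'"
    and Winv: "\<And>s v. v \<in> W' \<Longrightarrow> rep_mat m e s *\<^sub>v v \<in> W'"
    using W'(1) by (auto simp: invariant_subspace_def carrier)
  have co_surj: "\<exists>v\<in>V. co v = w" if w: "w \<in> carrier_vec m" for w
  proof
    let ?v = "\<lambda>x. \<Sum>i<m. vec_index w i * e i x"
    show "?v \<in> V" by (rule sum_closed) (auto intro: eV)
    have "ip (e j) ?v = vec_index w j" if j: "j < m" for j
    proof -
      have "ip (e j) ?v = (\<Sum>i<m. vec_index w i * ip (e j) (e i))" by (rule ip_sum) (use j eV in auto)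
      also have "\<dots> = (\<Sum>i<m. if i = j then vec_index w j else 0)"
        using j e by (intro sum.cong) (auto simp: orthonormal_def)
      finally show ?thesis using j by simp
    qed
    then show "co ?v = w" using w by (intro eq_vecI) (auto simp: co_def)
  qed
  have co_inj: "v = (\<lambda>_. 0)" if "v \<in> V" "co v = 0\<^sub>v m" for v
  proof -
    have "ip (e i) v = 0" if "i < m" for i
      using arg_cong[OF \<open>co v = 0\<^sub>v m\<close>, of "\<lambda>w. vec_index w i"] that by (simp add: co_def)
    then have "proj m e v = (\<lambda>_. 0)" by (simp add: proj_def)
    then show ?thesis using span[OF \<open>v \<in> V\<close>] by simp
  qed
  define W where "W = {v \<in> V. co v \<in> W'}"
  show thesis
  proof (rule that[of W])
    show "W \<subseteq> V" by (auto simp: W_def)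
    have "co (\<lambda>_. 0) = 0\<^sub>v m" by (intro eq_vecI) (auto simp: co_def ip_zero eV)
    then show "(\<lambda>_. 0) \<in> W" by (simp add: W_def zero_closed W0)
    fix u v assume uv: "u \<in> W" "v \<in> W"
    then have "co (\<lambda>x. u x + v x) = co u + co v"
      by (intro eq_vecI) (auto simp: co_def ip_add eV W_def)
    then show "(\<lambda>x. u x + v x) \<in> W" using uv by (simp add: W_def add_closed Wadd)
  next
    fix c v assume v: "v \<in> W"
    then have "co (\<lambda>x. c * v x) = c \<cdot>\<^sub>v co v"
      by (intro eq_vecI) (auto simp: co_def ip_scale eV W_def)
    then show "(\<lambda>x. c * v x) \<in> W" using v by (simp add: W_def scale_closed Wsc)
  next
    fix s v assume v: "v \<in> W"
    then have "co (act s v) = rep_mat m e s *\<^sub>v co v"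
      using coords_act[of v _ s]
      by (intro eq_vecI) (auto simp: co_def rep_mat_def scalar_prod_def atLeast0LessThan W_def eV)
    then show "act s v \<in> W" using v by (simp add: W_def act_closed Winv)
  next
    obtain w where "w \<in> carrier_vec m" "w \<notin> W'" using W'(3) Wc by blast
    with co_surj[of w] show "W \<noteq> V" by (auto simp: W_def)
  next
    obtain w where w: "w \<in> W'" "w \<noteq> 0\<^sub>v m" using W'(2) W0 by blast
    with Wc co_surj[of w] obtain v where v: "v \<in> V" "co v = w" by blast
    have "co (\<lambda>_. 0) = 0\<^sub>v m" by (intro eq_vecI) (auto simp: co_def ip_zero eV)
    then have "v \<noteq> (\<lambda>_. 0)" using v w by auto
    then show "W \<noteq> {\<lambda>_. 0}" using v w by (auto simp: W_def)
  qed
qed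

end

end

text \<open>Complete reducibility, phrased for coefficient functions: an invariant subspace and its
  orthogonal complement carry actions of smaller dimension, and every coefficient is a sum of
  coefficients of these two.\<close>

lemma coefficient_closed:
  assumes "u \<in> V" "v \<in> V" "unitary_action V ip N G act"
  shows "(\<lambda>s. ip u (act s v)) \<in> coeffs G"
  using assms
proof (induction N arbitrary: V u v rule: less_induct)
  case (less N V u v)
  interpret unitary_action V ip N G act by (rule less.prems(3))
  obtain m e where e: "orthonormal m e" and span: "\<And>v. v \<in> V \<Longrightarrow> v = proj m e v"
    using orthonormal_basis_exists by blast
  consider "m = 0" | "irreducible_rep G m (rep_mat m e)"
    | "0 < m" "\<not> irreducible_rep G m (rep_mat m e)" by blast
  then show ?case
  proof cases
    case 1
    then have "v = (\<lambda>_. 0)" if "v \<in> V" for v using span[OF that] by (simp add: proj_def)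
    then have "ip u (act s v) = 0" for s
      using act_closed[OF less.prems(2)] ip_zero[OF less.prems(1)] by metis
    then show ?thesis by (simp add: coeffs_zero)
  next
    case 2
    then show ?thesis using coefficient_irreducible[OF e span _ less.prems(1,2)] by blast
  next
    case 3
    obtain W where WV: "W \<subseteq> V" and W0: "(\<lambda>_. 0) \<in> W"
      and Wadd: "\<And>u v. u \<in> W \<Longrightarrow> v \<in> W \<Longrightarrow> (\<lambda>x. u x + v x) \<in> W"
      and Wsc: "\<And>c v. v \<in> W \<Longrightarrow> (\<lambda>x. c * v x) \<in> W"
      and Wact: "\<And>s v. v \<in> W \<Longrightarrow> act s v \<in> W"
      and W: "W \<noteq> V" "W \<noteq> {\<lambda>_. 0}"
      by (rule invariant_subspace_of_reducible[OF e span 3(2,1)], assumption) (rule that; assumption)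
    \<comment> \<open>the orthogonal complement\<close>
    define Y where "Y = {v \<in> V. \<forall>w\<in>W. ip w v = 0}"
    have YV: "Y \<subseteq> V" by (auto simp: Y_def)
    have Y0: "(\<lambda>_. 0) \<in> Y" using WV by (auto simp: Y_def zero_closed ip_zero)
    have Yadd: "(\<lambda>x. u x + v x) \<in> Y" if "u \<in> Y" "v \<in> Y" for u v
    proof -
      have "ip w (\<lambda>x. u x + v x) = 0" if "w \<in> W" for w
        using that \<open>u \<in> Y\<close> \<open>v \<in> Y\<close> WV by (subst ip_add) (auto simp: Y_def)
      then show ?thesis using that by (simp add: Y_def add_closed)
    qed
    have Ysc: "(\<lambda>x. c * v x) \<in> Y" if "v \<in> Y" for c v
    proof -
      have "ip w (\<lambda>x. c * v x) = 0" if "w \<in> W" for w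
        using that \<open>v \<in> Y\<close> WV by (subst ip_scale) (auto simp: Y_def)
      then show ?thesis using that by (simp add: Y_def scale_closed)
    qed
    have Yact: "act s v \<in> Y" if "v \<in> Y" for s v
    proof -
      have "ip w (act s v) = 0" if "w \<in> W" for w
        using that \<open>v \<in> Y\<close> WV Wact[OF that, of "inv\<^bsub>G\<^esub> s"] act_adjoint[of w v s] by (auto simp: Y_def)
      then show ?thesis using that by (simp add: Y_def act_closed)
    qed
    interpret WI: inner_function_space W ip by (rule subspace[OF WV W0 Wadd Wsc])
    interpret YI: inner_function_space Y ip by (rule subspace[OF YV Y0 Yadd Ysc])
    have W_on: "orthonormal m f" if "WI.orthonormal m f" for m f
      using that WV by (auto simp: WI.orthonormal_def orthonormal_def)
    have Y_on: "orthonormal m f" if "YI.orthonormal m f" for m f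
      using that YV by (auto simp: YI.orthonormal_def orthonormal_def)
    interpret WF: finite_inner_space W ip N
      by (intro finite_inner_space.intro finite_inner_space_axioms.intro WI.inner_function_space_axioms)
         (rule dim_bound[OF W_on])
    obtain k f where f: "WI.orthonormal k f" and Wspan: "\<And>w. w \<in> W \<Longrightarrow> w = WI.proj k f w"
      using WF.orthonormal_basis_exists by blast
    have fW: "f i \<in> W" if "i < k" for i using f that by (simp add: WI.orthonormal_def)
    have proj_eq: "WI.proj k f v = proj k f v" for v by (simp add: WI.proj_def proj_def)
    have split: "proj k f v \<in> W \<and> (\<lambda>x. v x - proj k f v x) \<in> Y" if v: "v \<in> V" for v
    proof
      show pW: "proj k f v \<in> W" using WI.proj_closed[OF f] proj_eq by simp
      have r: "(\<lambda>x. v x - proj k f v x) \<in> V" by (rule diff_closed[OF v proj_closed[OF W_on[OF f]]])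
      have "ip w (\<lambda>x. v x - proj k f v x) = 0" if w: "w \<in> W" for w
      proof -
        have wV: "w \<in> V" using w WV by blast
        have "ip (\<lambda>x. v x - proj k f v x) w = ip (\<lambda>x. v x - proj k f v x) (\<lambda>x. \<Sum>i<k. ip (f i) w * f i x)"
          using Wspan[OF w] by (simp add: WI.proj_def)
        also have "\<dots> = (\<Sum>i<k. ip (f i) w * ip (\<lambda>x. v x - proj k f v x) (f i))"
          by (rule ip_sum) (use fW WV r in auto)
        also have "\<dots> = 0"
        proof (rule sum.neutral, rule ballI)
          fix i assume i: "i \<in> {..<k}"
          then have "f i \<in> V" using fW WV by auto
          then show "ip (f i) w * ip (\<lambda>x. v x - proj k f v x) (f i) = 0"
            using ip_cnj[OF _ r, of "f i"] ip_residual[OF W_on[OF f] v, of i] i by simp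
        qed
        finally show ?thesis using ip_cnj[OF r wV] by simp
      qed
      then show "(\<lambda>x. v x - proj k f v x) \<in> Y" using r by (simp add: Y_def)
    qed
    obtain w0 where w0: "w0 \<in> W" "w0 \<noteq> (\<lambda>_. 0)" using W(2) W0 by blast
    obtain y0 where y0: "y0 \<in> Y" "y0 \<noteq> (\<lambda>_. 0)"
    proof -
      obtain v where v: "v \<in> V" "v \<notin> W" using W(1) WV by blast
      have "(\<lambda>x. v x - proj k f v x) \<noteq> (\<lambda>_. 0)"
      proof
        assume "(\<lambda>x. v x - proj k f v x) = (\<lambda>_. 0)"
        then have "v = proj k f v" by (simp add: fun_eq_iff)
        then show False using split[OF v(1)] v(2) by simp
      qed
      then show thesis using that split[OF v(1)] by blast
    qed
    \<comment> \<open>an orthonormal family in one summand can be extended by a vector of the other one, so both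
      summands satisfy the bound \<open>N - 1\<close>\<close>
    have W_lt: "m \<le> N - 1" "0 < N" if "WI.orthonormal m g" for m g
    proof -
      have "ip (g i) y0 = 0" if "i < m" for i
        using that y0 \<open>WI.orthonormal m g\<close> by (auto simp: Y_def WI.orthonormal_def)
      then obtain h where "orthonormal (Suc m) h"
        using extend_orthonormal[OF W_on[OF \<open>WI.orthonormal m g\<close>], of y0] y0 YV by blast
      from dim_bound[OF this] show "m \<le> N - 1" "0 < N" by auto
    qed
    have Y_lt: "m \<le> N - 1" if "YI.orthonormal m g" for m g
    proof -
      have "ip (g i) w0 = 0" if "i < m" for i
      proof -
        have "g i \<in> Y" using that \<open>YI.orthonormal m g\<close> by (simp add: YI.orthonormal_def)
        then have "ip w0 (g i) = 0" "g i \<in> V" using w0 by (auto simp: Y_def)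
        then show ?thesis using ip_cnj[of w0 "g i"] w0 WV by auto
      qed
      then obtain h where "orthonormal (Suc m) h"
        using extend_orthonormal[OF Y_on[OF \<open>YI.orthonormal m g\<close>], of w0] w0 WV by blast
      from dim_bound[OF this] show "m \<le> N - 1" by auto
    qed
    have UW: "unitary_action W ip (N - 1) G act"
    proof (intro unitary_action.intro finite_inner_space.intro finite_inner_space_axioms.intro
        unitary_action_axioms.intro WI.inner_function_space_axioms)
      show "\<And>m e. WI.orthonormal m e \<Longrightarrow> m \<le> N - 1" by (rule W_lt)
    qed (use WV Wact group carrier act_mult act_ip act_cont in \<open>auto simp: subset_iff\<close>)
    have UY: "unitary_action Y ip (N - 1) G act"
    proof (intro unitary_action.intro finite_inner_space.intro finite_inner_space_axioms.intro
        unitary_action_axioms.intro YI.inner_function_space_axioms)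
      show "\<And>m e. YI.orthonormal m e \<Longrightarrow> m \<le> N - 1" by (rule Y_lt)
    qed (use YV Yact group carrier act_mult act_ip act_cont in \<open>auto simp: subset_iff\<close>)
    have N: "N - 1 < N" using W_lt[OF f] by simp
    let ?u = "proj k f u" and ?v = "proj k f v"
    let ?u' = "\<lambda>x. u x - ?u x" and ?v' = "\<lambda>x. v x - ?v x"
    have u: "?u \<in> W" "?u' \<in> Y" and v: "?v \<in> W" "?v' \<in> Y"
      using split less.prems by auto
    have orth: "ip w y = 0" "ip y w = 0" if "w \<in> W" "y \<in> Y" for w y
    proof -
      show 1: "ip w y = 0" using that by (auto simp: Y_def)
      show "ip y w = 0" using ip_cnj[of w y] 1 that WV YV by auto
    qed
    have "ip u (act s v) = ip ?u (act s ?v) + ip ?u' (act s ?v')" for s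
    proof -
      have V: "?u \<in> V" "?u' \<in> V" "?v \<in> V" "?v' \<in> V" using u v WV YV by auto
      have "ip u (act s v) = ip (act (inv\<^bsub>G\<^esub> s) u) (\<lambda>x. ?v x + ?v' x)"
        using act_adjoint[OF less.prems(1,2)] by simp
      also have "\<dots> = ip u (act s ?v) + ip u (act s ?v')"
        using less.prems V by (subst ip_add) (auto simp: act_closed act_adjoint)
      also have "ip u (act s ?v) = ip (\<lambda>x. ?u x + ?u' x) (act s ?v)" by simp
      also have "\<dots> = ip ?u (act s ?v)"
        using V orth(2)[OF Wact[OF v(1)] u(2)] by (subst ip_add_left) (auto simp: act_closed)
      also have "ip u (act s ?v') = ip (\<lambda>x. ?u x + ?u' x) (act s ?v')" by simp
      also have "\<dots> = ip ?u' (act s ?v')"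
        using V orth(1)[OF u(1) Yact[OF v(2)]] by (subst ip_add_left) (auto simp: act_closed)
      finally show ?thesis .
    qed
    moreover have "(\<lambda>s. ip ?u (act s ?v) + ip ?u' (act s ?v')) \<in> coeffs G"
      by (intro coeffs_add less.IH[OF N _ _ UW] less.IH[OF N _ _ UY] u v)
    ultimately show ?thesis by simp
  qed
qed

section \<open>Matrix-valued actions and products of coefficients\<close>

text \<open>A unitary matrix representation whose indices range over an arbitrary finite set, so that pairs
  can serve as indices of a Kronecker product.\<close>

locale matrix_action =
  fixes G :: "'g::topological_space monoid" and D :: "'x set" and M :: "'g \<Rightarrow> 'x \<Rightarrow> 'x \<Rightarrow> complex"
  assumes grp: "group G" and UNIV: "carrier G = UNIV" and fin: "finite D"
    and M_mult: "p \<in> D \<Longrightarrow> q \<in> D \<Longrightarrow> M (s \<otimes>\<^bsub>G\<^esub> t) p q = (\<Sum>r\<in>D. M s p r * M t r q)"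
    and M_unitary: "p \<in> D \<Longrightarrow> q \<in> D \<Longrightarrow> (\<Sum>r\<in>D. cnj (M s r p) * M s r q) = (if p = q then 1 else 0)"
    and M_cont: "p \<in> D \<Longrightarrow> q \<in> D \<Longrightarrow> continuous_on UNIV (\<lambda>s. M s p q)"
begin

definition V where "V = {f :: 'x \<Rightarrow> complex. \<forall>p. p \<notin> D \<longrightarrow> f p = 0}"
definition ip where "ip f g = (\<Sum>p\<in>D. cnj (f p) * g p)"
definition act where "act s f = (\<lambda>p. if p \<in> D then \<Sum>q\<in>D. M s p q * f q else 0)"
definition unit where "unit p = (\<lambda>q :: 'x. if q = p then 1 else 0 :: complex)"

lemma ip_unit: "p \<in> D \<Longrightarrow> ip f (unit p) = cnj (f p)"
proof -
  assume p: "p \<in> D"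
  have "ip f (unit p) = (\<Sum>q\<in>D. if q = p then cnj (f p) else 0)"
    unfolding ip_def unit_def by (intro sum.cong) auto
  then show ?thesis using p fin by simp
qed

lemma act_unit: "p \<in> D \<Longrightarrow> q \<in> D \<Longrightarrow> act s (unit q) p = M s p q"
proof -
  assume p: "p \<in> D" and q: "q \<in> D"
  have "act s (unit q) p = (\<Sum>r\<in>D. if r = q then M s p q else 0)"
    using p unfolding act_def unit_def by (auto intro!: sum.cong)
  then show ?thesis using q fin by simp
qed

sublocale inner: inner_function_space V ip
proof
  fix v assume v: "v \<in> V"
  have eq: "ip v v = of_real (\<Sum>p\<in>D. (cmod (v p))\<^sup>2)"
    unfolding ip_def of_real_sum by (intro sum.cong refl) (simp add: complex_norm_square mult.commute del: of_real_power)
  then show "0 \<le> Re (ip v v)" by (simp add: sum_nonneg)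
  assume "ip v v = 0"
  then have "(\<Sum>p\<in>D. (cmod (v p))\<^sup>2) = 0" using eq by (simp del: of_real_sum)
  then have "\<forall>p\<in>D. v p = 0" using fin by (simp add: sum_nonneg_eq_0_iff)
  then show "v = (\<lambda>_. 0)" using v by (auto simp: V_def)
qed (auto simp: V_def ip_def sum.distrib distrib_left sum_distrib_left mult_ac)

text \<open>Bessel's inequality for the unit vectors, summed over the index set.\<close>

lemma orthonormal_card:
  assumes e: "inner.orthonormal m e" shows "m \<le> card D"
proof -
  have eV: "e i \<in> V" and ee: "ip (e i) (e i) = 1" if "i < m" for i
    using e that by (auto simp: inner.orthonormal_def)
  have "real m = (\<Sum>i<m. Re (ip (e i) (e i)))" using ee by simp
  also have "\<dots> = (\<Sum>i<m. \<Sum>p\<in>D. (cmod (e i p))\<^sup>2)"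
    unfolding ip_def Re_sum by (intro sum.cong refl) (simp add: cmod_def power2_eq_square)
  also have "\<dots> = (\<Sum>p\<in>D. \<Sum>i<m. (cmod (ip (e i) (unit p)))\<^sup>2)"
    by (subst sum.swap) (simp add: ip_unit)
  also have "\<dots> \<le> (\<Sum>p\<in>D. 1)"
  proof (rule sum_mono)
    fix p assume p: "p \<in> D"
    then have "unit p \<in> V" by (auto simp: V_def unit_def)
    from inner.bessel[OF e this] show "(\<Sum>i<m. (cmod (ip (e i) (unit p)))\<^sup>2) \<le> 1"
      using ip_unit[OF p, of "unit p"] by (simp add: unit_def)
  qed
  finally show ?thesis by simp
qed

lemma act_ip_eq: "ip (act s u) (act s v) = ip u v"
proof -
  have "ip (act s u) (act s v) =
      (\<Sum>r\<in>D. (\<Sum>p\<in>D. cnj (M s r p * u p)) * (\<Sum>q\<in>D. M s r q * v q))"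
    unfolding ip_def act_def by (intro sum.cong) auto
  also have "\<dots> = (\<Sum>r\<in>D. \<Sum>p\<in>D. \<Sum>q\<in>D. cnj (u p) * v q * (cnj (M s r p) * M s r q))"
    unfolding sum_product by (intro sum.cong refl) (simp add: mult_ac)
  also have "\<dots> = (\<Sum>p\<in>D. \<Sum>q\<in>D. \<Sum>r\<in>D. cnj (u p) * v q * (cnj (M s r p) * M s r q))"
    by (subst sum.swap, rule sum.cong[OF refl], rule sum.swap)
  also have "\<dots> = (\<Sum>p\<in>D. \<Sum>q\<in>D. if p = q then cnj (u p) * v p else 0)"
    by (intro sum.cong refl) (simp add: sum_distrib_left[symmetric] M_unitary)
  also have "\<dots> = ip u v" using fin by (simp add: ip_def)
  finally show ?thesis .
qed

lemma act_act: "act (s \<otimes>\<^bsub>G\<^esub> t) v = act s (act t v)"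
proof
  fix p
  show "act (s \<otimes>\<^bsub>G\<^esub> t) v p = act s (act t v) p"
  proof (cases "p \<in> D")
    case True
    then have "act (s \<otimes>\<^bsub>G\<^esub> t) v p = (\<Sum>q\<in>D. (\<Sum>r\<in>D. M s p r * M t r q) * v q)"
      by (simp add: act_def M_mult)
    also have "\<dots> = (\<Sum>r\<in>D. \<Sum>q\<in>D. M s p r * (M t r q * v q))"
      by (simp only: sum_distrib_right mult.assoc) (rule sum.swap)
    also have "\<dots> = act s (act t v) p" using True by (simp add: act_def sum_distrib_left)
    finally show ?thesis .
  qed (simp add: act_def)
qed

lemma unitary_action: "unitary_action V ip (card D) G act"
proof (intro unitary_action.intro finite_inner_space.intro finite_inner_space_axioms.intro
    unitary_action_axioms.intro inner.inner_function_space_axioms)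
  fix u v assume "u \<in> V" "v \<in> V"
  show "continuous_on UNIV (\<lambda>s. ip u (act s v))"
    unfolding ip_def act_def
    by (intro continuous_on_sum continuous_on_mult continuous_on_const) (auto intro!: continuous_intros M_cont)
qed (auto simp: orthonormal_card grp UNIV act_act act_ip_eq, auto simp: act_def V_def)

lemma entry_in_coeffs:
  assumes "p \<in> D" "q \<in> D" shows "(\<lambda>s. M s p q) \<in> coeffs G"
proof -
  have "unit p \<in> V" "unit q \<in> V" using assms by (auto simp: V_def unit_def)
  from coefficient_closed[OF this unitary_action] have "(\<lambda>s. ip (unit p) (act s (unit q))) \<in> coeffs G" .
  moreover have "ip (unit p) (act s (unit q)) = M s p q" for s
  proof -
    have "ip (unit p) (act s (unit q)) = cnj (ip (act s (unit q)) (unit p))"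
      by (rule inner.ip_cnj) (use assms in \<open>auto simp: V_def unit_def act_def\<close>)
    then show ?thesis using assms by (simp add: ip_unit act_unit)
  qed
  ultimately show ?thesis by simp
qed

end

lemma unitary_rep_entries:
  assumes "unitary_rep G d \<pi>" "carrier G = UNIV"
  shows "i < d \<Longrightarrow> j < d \<Longrightarrow> \<pi> (s \<otimes>\<^bsub>G\<^esub> t) $$ (i, j) = (\<Sum>k<d. \<pi> s $$ (i, k) * \<pi> t $$ (k, j))"
    and "i < d \<Longrightarrow> j < d \<Longrightarrow> (\<Sum>k<d. cnj (\<pi> s $$ (k, i)) * \<pi> s $$ (k, j)) = (if i = j then 1 else 0)"
    and "i < d \<Longrightarrow> j < d \<Longrightarrow> continuous_on UNIV (\<lambda>s. \<pi> s $$ (i, j))"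
proof -
  have c: "\<And>s. \<pi> s \<in> carrier_mat d d" and u: "\<And>s. map_mat cnj (transpose_mat (\<pi> s)) * \<pi> s = 1\<^sub>m d"
    and m: "\<And>s t. \<pi> (s \<otimes>\<^bsub>G\<^esub> t) = \<pi> s * \<pi> t"
    using assms by (auto simp: unitary_rep_def)
  assume ij: "i < d" "j < d"
  show "\<pi> (s \<otimes>\<^bsub>G\<^esub> t) $$ (i, j) = (\<Sum>k<d. \<pi> s $$ (i, k) * \<pi> t $$ (k, j))"
    using ij c[of s] c[of t] by (simp add: m scalar_prod_def atLeast0LessThan)
  have "(\<Sum>k<d. cnj (\<pi> s $$ (k, i)) * \<pi> s $$ (k, j)) = (map_mat cnj (transpose_mat (\<pi> s)) * \<pi> s) $$ (i, j)"
    using ij c[of s] by (simp add: scalar_prod_def atLeast0LessThan)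
  then show "(\<Sum>k<d. cnj (\<pi> s $$ (k, i)) * \<pi> s $$ (k, j)) = (if i = j then 1 else 0)"
    using ij by (simp add: u)
  show "continuous_on UNIV (\<lambda>s. \<pi> s $$ (i, j))" using assms ij by (simp add: unitary_rep_def)
qed

text \<open>The product of two matrix coefficients is a coefficient of the Kronecker product.\<close>

lemma matrix_coeffs_mult:
  assumes G: "group G" "carrier G = UNIV" and f: "f \<in> matrix_coeffs G" and g: "g \<in> matrix_coeffs G"
  shows "(\<lambda>s. f s * g s) \<in> coeffs G"
proof -
  obtain d \<pi> i j where \<pi>: "irreducible_rep G d \<pi>" and ij: "i < d" "j < d" and f: "f = (\<lambda>s. \<pi> s $$ (i, j))"
    using f unfolding matrix_coeffs_def by blast
  obtain d' \<rho> k l where \<rho>: "irreducible_rep G d' \<rho>" and kl: "k < d'" "l < d'" and g: "g = (\<lambda>s. \<rho> s $$ (k, l))"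
    using g unfolding matrix_coeffs_def by blast
  have u: "unitary_rep G d \<pi>" "unitary_rep G d' \<rho>" using \<pi> \<rho> by (auto simp: irreducible_rep_def)
  note p = unitary_rep_entries[OF u(1) G(2)] and r = unitary_rep_entries[OF u(2) G(2)]
  let ?D = "{..<d} \<times> {..<d'}"
  define M where "M s p q = \<pi> s $$ (fst p, fst q) * \<rho> s $$ (snd p, snd q)" for s and p q :: "nat \<times> nat"
  have fact: "(\<Sum>r\<in>?D. a (fst r) * b (snd r)) = (\<Sum>i<d. a i) * (\<Sum>k<d'. b k)" for a b :: "nat \<Rightarrow> complex"
    by (simp add: sum_product sum.cartesian_product case_prod_beta)
  interpret matrix_action G ?D M
  proof (rule matrix_action.intro)
    fix p q s t assume pq: "p \<in> ?D" "q \<in> ?D"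
    show "M (s \<otimes>\<^bsub>G\<^esub> t) p q = (\<Sum>r\<in>?D. M s p r * M t r q)"
    proof -
      have "M (s \<otimes>\<^bsub>G\<^esub> t) p q = (\<Sum>k<d. \<pi> s $$ (fst p, k) * \<pi> t $$ (k, fst q)) *
          (\<Sum>k<d'. \<rho> s $$ (snd p, k) * \<rho> t $$ (k, snd q))"
        unfolding M_def using pq p(1) r(1) by (auto simp: mem_Times_iff)
      also have "\<dots> = (\<Sum>r\<in>?D. M s p r * M t r q)"
        by (subst fact[symmetric]) (simp add: M_def mult_ac)
      finally show ?thesis .
    qed
    show "(\<Sum>r\<in>?D. cnj (M s r p) * M s r q) = (if p = q then 1 else 0)"
    proof -
      have "(\<Sum>r\<in>?D. cnj (M s r p) * M s r q) =
          (\<Sum>k<d. cnj (\<pi> s $$ (k, fst p)) * \<pi> s $$ (k, fst q)) *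
          (\<Sum>k<d'. cnj (\<rho> s $$ (k, snd p)) * \<rho> s $$ (k, snd q))"
        by (subst fact[symmetric]) (simp add: M_def mult_ac)
      also have "\<dots> = (if p = q then 1 else 0)"
        using pq p(2) r(2) by (auto simp: mem_Times_iff prod_eq_iff)
      finally show ?thesis .
    qed
    show "continuous_on UNIV (\<lambda>s. M s p q)"
      unfolding M_def using pq by (intro continuous_on_mult p(3) r(3)) (auto simp: mem_Times_iff)
  qed (use G in auto)
  have "(\<lambda>s. M s (i, k) (j, l)) \<in> coeffs G" using ij kl by (intro entry_in_coeffs) auto
  then show ?thesis by (simp add: M_def f g)
qed

lemma coeffs_mult:
  assumes G: "group G" "carrier G = UNIV" and f: "f \<in> coeffs G" and g: "g \<in> coeffs G"
  shows "(\<lambda>s. f s * g s) \<in> coeffs G"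
proof -
  obtain F c where f: "f = (\<lambda>x. \<Sum>u\<in>F. c u * u x)" "finite F" "F \<subseteq> matrix_coeffs G"
    using f unfolding coeffs_def by blast
  obtain H b where g: "g = (\<lambda>x. \<Sum>u\<in>H. b u * u x)" "finite H" "H \<subseteq> matrix_coeffs G"
    using g unfolding coeffs_def by blast
  have "(\<lambda>s. \<Sum>u\<in>F. \<Sum>v\<in>H. (c u * b v) * (u s * v s)) \<in> coeffs G"
    using f g by (intro coeffs_sum coeffs_scale matrix_coeffs_mult[OF G]) auto
  moreover have "(\<Sum>u\<in>F. c u * u s) * (\<Sum>v\<in>H. b v * v s) =
      (\<Sum>u\<in>F. \<Sum>v\<in>H. (c u * b v) * (u s * v s))" for s
    unfolding sum_product by (intro sum.cong refl) (simp add: mult_ac)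
  ultimately show ?thesis unfolding f(1) g(1) by simp
qed

lemma coeffs_one:
  assumes G: "group G" "carrier G = UNIV"
  shows "(\<lambda>_. 1) \<in> coeffs G"
proof -
  interpret matrix_action G "{()}" "\<lambda>_ _ _. 1"
    by (rule matrix_action.intro) (use G in auto)
  show ?thesis using entry_in_coeffs[of "()" "()"] by simp
qed

lemma fun_ring_cring:
  assumes "(\<lambda>_. 0) \<in> S" "(\<lambda>_. 1) \<in> S" "\<And>f g. f \<in> S \<Longrightarrow> g \<in> S \<Longrightarrow> (\<lambda>x. f x + g x) \<in> S"
    "\<And>f g. f \<in> S \<Longrightarrow> g \<in> S \<Longrightarrow> (\<lambda>x. f x * g x) \<in> S" "\<And>f. f \<in> S \<Longrightarrow> (\<lambda>x. - f x) \<in> S"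
  shows "cring (fun_ring S)"
proof (rule cringI)
  show "abelian_group (fun_ring S)"
  proof (rule abelian_groupI)
    fix f assume "f \<in> carrier (fun_ring S)"
    then show "\<exists>g\<in>carrier (fun_ring S). g \<oplus>\<^bsub>fun_ring S\<^esub> f = \<zero>\<^bsub>fun_ring S\<^esub>"
      using assms(5) by (intro bexI[of _ "\<lambda>x. - f x"]) (auto simp: fun_ring_def)
  qed (use assms in \<open>auto simp: fun_ring_def add_ac\<close>)
  show "Group.comm_monoid (fun_ring S)"
    by (rule comm_monoidI) (use assms in \<open>auto simp: fun_ring_def mult_ac\<close>)
qed (auto simp: fun_ring_def distrib_right)

lemma coeff_algebra_cring:
  assumes "group G" "carrier G = UNIV"
  shows "cring (coeff_algebra G)"
proof -
  have "cring (fun_ring (coeffs G))"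
    using coeffs_zero coeffs_one[OF assms] coeffs_add coeffs_mult[OF assms] coeffs_scale[of _ G "-1"]
    by (intro fun_ring_cring) auto
  then show ?thesis by (simp add: coeff_algebra_def fun_ring_def)
qed

lemma coeffs_continuous:
  assumes "carrier G = UNIV" "f \<in> coeffs G" shows "continuous_on UNIV f"
proof -
  have "continuous_on UNIV u" if "u \<in> matrix_coeffs G" for u
    using that assms(1) by (auto simp: matrix_coeffs_def irreducible_rep_def unitary_rep_def)
  then show ?thesis using assms(2) unfolding coeffs_def
    by (auto intro!: continuous_on_sum continuous_on_mult continuous_on_const)
qed

lemma counit_module:
  assumes "group G" "carrier G = UNIV"
  shows "Module.module (coeff_algebra G) (counit_module G)"
proof (rule moduleI)
  show "cring (coeff_algebra G)" by (rule coeff_algebra_cring[OF assms])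
  show "abelian_group (counit_module G)"
    by (rule abelian_groupI) (auto simp: counit_module_def intro: exI[of _ "- x" for x] add.left_inverse)
qed (auto simp: counit_module_def coeff_algebra_def fun_ring_def distrib_right distrib_left)

section \<open>Equicontinuous sequences on compact spaces\<close>

text \<open>The Arzela-Ascoli theorem for a compact space without a chosen metric: a diagonal argument gives
  convergence on a countable dense set, and equicontinuity over a finite cover makes it uniform.\<close>

lemma equicontinuous_convergent_subsequence:
  fixes h :: "nat \<Rightarrow> 'g::second_countable_topology \<Rightarrow> complex"
  assumes comp: "compact (UNIV :: 'g set)"
    and bd: "\<And>n x. cmod (h n x) \<le> B"
    and eq: "\<And>x0 \<epsilon>. \<epsilon> > 0 \<Longrightarrow> \<exists>U. open U \<and> x0 \<in> U \<and> (\<forall>n. \<forall>x\<in>U. dist (h n x) (h n x0) < \<epsilon>)"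
  obtains r g where "strict_mono (r :: nat \<Rightarrow> nat)" "uniform_limit UNIV (\<lambda>n. h (r n)) g sequentially"
proof -
  obtain \<B> :: "'g set set" where \<B>: "countable \<B>" "topological_basis \<B>"
    using ex_countable_basis by blast
  define D where "D = (\<lambda>b. SOME x. x \<in> b) ` \<B>"
  have "countable D" unfolding D_def using \<B> by simp
  have dense: "\<exists>y\<in>D. y \<in> U" if "open U" "x \<in> U" for U x
  proof -
    obtain b where b: "b \<in> \<B>" "x \<in> b" "b \<subseteq> U" using topological_basisE[OF \<B>(2) \<open>open U\<close> \<open>x \<in> U\<close>] by blast
    then have "(SOME x. x \<in> b) \<in> b" by (metis someI)
    then show ?thesis using b unfolding D_def by blast
  qed
  obtain r :: "nat \<Rightarrow> nat" where r: "strict_mono r" and conv: "\<And>x. x \<in> D \<Longrightarrow> \<exists>l. (\<lambda>n. h (r n) x) \<longlonglongrightarrow> l"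
    by (rule function_convergent_subsequence[OF \<open>countable D\<close>, of h B]) (use bd in auto)
  have "uniformly_Cauchy_on UNIV (\<lambda>n. h (r n))"
  proof (rule uniformly_Cauchy_onI)
    fix \<epsilon> :: real assume "\<epsilon> > 0"
    \<comment> \<open>\<open>h (r m) x\<close> and \<open>h (r n) x\<close> are joined by five steps, through \<open>z\<close> and the nearby dense point \<open>y z\<close>\<close>
    then have e5: "\<epsilon> / 5 > 0" by simp
    obtain U where U: "\<And>z. open (U z)" "\<And>z. z \<in> U z" "\<And>z n x. x \<in> U z \<Longrightarrow> dist (h n x) (h n z) < \<epsilon> / 5"
      using eq[OF e5] by metis
    obtain F where F: "finite F" "UNIV \<subseteq> (\<Union>z\<in>F. U z)"
      by (rule compactE_image[OF comp, of UNIV U]) (use U in auto)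
    obtain y where y: "\<And>z. y z \<in> D" "\<And>z. y z \<in> U z" using dense[OF U(1) U(2)] by metis
    have "\<exists>M. \<forall>m\<ge>M. \<forall>n\<ge>M. dist (h (r m) (y z)) (h (r n) (y z)) < \<epsilon> / 5" for z
    proof -
      have "Cauchy (\<lambda>n. h (r n) (y z))" using conv[OF y(1)] by (metis LIMSEQ_imp_Cauchy)
      then show ?thesis using e5 unfolding Cauchy_def by blast
    qed
    then obtain M where M: "\<And>z m n. m \<ge> M z \<Longrightarrow> n \<ge> M z \<Longrightarrow> dist (h (r m) (y z)) (h (r n) (y z)) < \<epsilon> / 5" by metis
    have "dist (h (r m) x) (h (r n) x) < \<epsilon>" if mn: "m \<ge> Max (M ` F)" "n \<ge> Max (M ` F)" for m n x
    proof -
      obtain z where z: "z \<in> F" "x \<in> U z" using F(2) by blast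
      have "M z \<le> Max (M ` F)" using F(1) z by simp
      then have "dist (h (r m) (y z)) (h (r n) (y z)) < \<epsilon> / 5" using mn by (intro M) auto
      moreover have "dist (h (r m) x) (h (r m) z) < \<epsilon> / 5" "dist (h (r n) x) (h (r n) z) < \<epsilon> / 5"
        "dist (h (r m) (y z)) (h (r m) z) < \<epsilon> / 5" "dist (h (r n) (y z)) (h (r n) z) < \<epsilon> / 5"
        using U(3) z(2) y(2) by blast+
      ultimately show ?thesis unfolding dist_norm by norm
    qed
    then show "\<exists>M. \<forall>x\<in>UNIV. \<forall>m\<ge>M. \<forall>n\<ge>M. dist (h (r m) x) (h (r n) x) < \<epsilon>" by blast
  qed
  then obtain g where "uniform_limit UNIV (\<lambda>n. h (r n)) g sequentially"
    using Cauchy_uniformly_convergent unfolding uniformly_convergent_on_def by blast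
  with r that show thesis by blast
qed

section \<open>Compact groups with Haar measure\<close>

locale compact_group =
  fixes G :: "'g::{t2_space, second_countable_topology} monoid" and \<mu> :: "'g measure"
  assumes group: "group G" and carrier: "carrier G = UNIV"
    and cont_mult: "continuous_on UNIV (\<lambda>(x, y). x \<otimes>\<^bsub>G\<^esub> y)"
    and cont_inv: "continuous_on UNIV (\<lambda>x. inv\<^bsub>G\<^esub> x)"
    and comp: "compact (UNIV :: 'g set)"
    and haar: "haar_probability G \<mu>"

sublocale compact_group \<subseteq> G: group G by (rule group)
sublocale compact_group \<subseteq> P: prob_space \<mu> using haar by (simp add: haar_probability_def)

context compact_group
begin

lemma sets_haar: "sets \<mu> = sets borel"
  using haar by (simp add: haar_probability_def)

lemma space_haar: "space \<mu> = UNIV"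
  using sets_eq_imp_space_eq[OF sets_haar] by simp

lemma in_carrier[simp]: "x \<in> carrier G"
  by (simp add: carrier)

lemma distr_haar: "distr \<mu> borel (\<lambda>t. s \<otimes>\<^bsub>G\<^esub> t) = \<mu>"
  using haar by (simp add: haar_probability_def)

lemma inv_mult_cancel[simp]: "inv\<^bsub>G\<^esub> s \<otimes>\<^bsub>G\<^esub> (s \<otimes>\<^bsub>G\<^esub> x) = x" "s \<otimes>\<^bsub>G\<^esub> (inv\<^bsub>G\<^esub> s \<otimes>\<^bsub>G\<^esub> x) = x"
  by (simp_all add: G.m_assoc[symmetric])

lemma cont_mult': 
  assumes "continuous_on S f" "continuous_on S g"
  shows "continuous_on S (\<lambda>x. f x \<otimes>\<^bsub>G\<^esub> g x)"
  using continuous_on_compose2[OF cont_mult continuous_on_Pair[OF assms]] by simp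

lemma cont_inv': "continuous_on S f \<Longrightarrow> continuous_on S (\<lambda>x. inv\<^bsub>G\<^esub> f x)"
  using continuous_on_compose2[OF cont_inv] by simp

lemma measurable_haar: "continuous_on UNIV (f :: 'g \<Rightarrow> 'b::topological_space) \<Longrightarrow> f \<in> borel_measurable \<mu>"
  using borel_measurable_continuous_onI measurable_cong_sets[OF sets_haar refl] by blast

lemma cont_bounded:
  fixes f :: "'g \<Rightarrow> 'b::real_normed_vector"
  assumes "continuous_on UNIV f" obtains b where "b > 0" "\<And>x. norm (f x) \<le> b"
proof -
  have "compact (range f)" by (rule compact_continuous_image[OF assms comp])
  then obtain b where "b > 0" "\<forall>y\<in>range f. norm y \<le> b"
    using compact_imp_bounded bounded_pos by blast
  then show thesis using that by blast
qed

lemma integrable_haar: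
  fixes f :: "'g \<Rightarrow> 'b::{banach, second_countable_topology}"
  assumes "continuous_on UNIV f" shows "integrable \<mu> f"
proof -
  obtain b where "\<And>x. norm (f x) \<le> b" using cont_bounded[OF assms] by blast
  then show ?thesis by (intro P.integrable_const_bound[of f b] measurable_haar assms) auto
qed

lemma integral_translate:
  fixes f :: "'g \<Rightarrow> 'b::{banach, second_countable_topology}"
  assumes "continuous_on UNIV f" shows "(\<integral>x. f (s \<otimes>\<^bsub>G\<^esub> x) \<partial>\<mu>) = (\<integral>x. f x \<partial>\<mu>)"
proof -
  have m: "(\<lambda>x. s \<otimes>\<^bsub>G\<^esub> x) \<in> measurable \<mu> borel"
    by (rule measurable_haar) (intro cont_mult' continuous_intros)
  have "(\<integral>x. f x \<partial>\<mu>) = (\<integral>x. f x \<partial>distr \<mu> borel (\<lambda>t. s \<otimes>\<^bsub>G\<^esub> t))" by (simp add: distr_haar)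
  also have "\<dots> = (\<integral>x. f (s \<otimes>\<^bsub>G\<^esub> x) \<partial>\<mu>)"
    by (rule integral_distr[OF m borel_measurable_continuous_onI[OF assms]])
  finally show ?thesis by simp
qed

lemma norm_integral_le:
  fixes f :: "'g \<Rightarrow> 'b::{banach, second_countable_topology}"
  assumes "continuous_on UNIV f" "\<And>x. norm (f x) \<le> b"
  shows "norm (\<integral>x. f x \<partial>\<mu>) \<le> b"
proof -
  have "norm (\<integral>x. f x \<partial>\<mu>) \<le> (\<integral>x. norm (f x) \<partial>\<mu>)" by (rule integral_norm_bound)
  also have "\<dots> \<le> (\<integral>x. b \<partial>\<mu>)"
    by (intro integral_mono integrable_haar continuous_on_norm assms) auto
  also have "\<dots> = b" by (simp add: P.prob_space)
  finally show ?thesis .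
qed

text \<open>Finitely many translates of a nonempty open set cover the compact group, so it cannot be null.\<close>

lemma open_not_null:
  assumes "open U" "U \<noteq> {}" shows "U \<notin> null_sets \<mu>"
proof
  assume null: "U \<in> null_sets \<mu>"
  obtain x0 where x0: "x0 \<in> U" using assms by blast
  define W where "W s = {x. s \<otimes>\<^bsub>G\<^esub> x \<in> U}" for s
  have W_null: "W s \<in> null_sets \<mu>" for s
  proof -
    have m: "(\<lambda>x. s \<otimes>\<^bsub>G\<^esub> x) \<in> measurable \<mu> borel"
      by (rule measurable_haar) (intro cont_mult' continuous_intros)
    have W: "W s = (\<lambda>x. s \<otimes>\<^bsub>G\<^esub> x) -` U \<inter> space \<mu>" by (auto simp: W_def space_haar)
    have U: "U \<in> sets borel" using assms by simp
    have "emeasure \<mu> (W s) = emeasure (distr \<mu> borel (\<lambda>t. s \<otimes>\<^bsub>G\<^esub> t)) U"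
      unfolding W by (rule emeasure_distr[OF m U, symmetric])
    also have "\<dots> = 0" using null by (simp add: distr_haar null_setsD1)
    finally show ?thesis using measurable_sets[OF m U] unfolding W by (intro null_setsI)
  qed
  have W_open: "open (W s)" for s
  proof -
    have "continuous_on UNIV (\<lambda>x. s \<otimes>\<^bsub>G\<^esub> x)" by (intro cont_mult' continuous_intros)
    from open_vimage[OF \<open>open U\<close> this] show ?thesis by (simp add: W_def vimage_def)
  qed
  have "x \<in> W (x0 \<otimes>\<^bsub>G\<^esub> inv\<^bsub>G\<^esub> x)" for x using x0 by (simp add: W_def G.m_assoc)
  then have cov: "UNIV \<subseteq> (\<Union>s\<in>UNIV. W s)" by blast
  obtain S where S: "finite S" "UNIV \<subseteq> (\<Union>s\<in>S. W s)"
    by (rule compactE_image[OF comp _ cov]) (auto simp: W_open)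
  have "(\<Union>s\<in>S. W s) \<in> null_sets \<mu>" using S(1) W_null by (intro null_sets.finite_UN) auto
  then have "space \<mu> \<in> null_sets \<mu>" using S(2) by (simp add: space_haar top.extremum_unique)
  then show False using P.emeasure_space_1 by (simp add: null_sets_def)
qed

text \<open>The pre-Hilbert space of continuous functions; its inner product is definite because nonempty
  open sets are not null.\<close>

definition C :: "('g \<Rightarrow> complex) set" where "C = {f. continuous_on UNIV f}"

definition ip :: "('g \<Rightarrow> complex) \<Rightarrow> ('g \<Rightarrow> complex) \<Rightarrow> complex" where
  "ip f g = (\<integral>x. cnj (f x) * g x \<partial>\<mu>)"

definition q :: "('g \<Rightarrow> complex) \<Rightarrow> real" where "q f = Re (ip f f)"

lemma C_cont: "f \<in> C \<Longrightarrow> continuous_on UNIV f"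
  by (simp add: C_def)

lemma ip_integrable: "f \<in> C \<Longrightarrow> g \<in> C \<Longrightarrow> integrable \<mu> (\<lambda>x. cnj (f x) * g x)"
  by (intro integrable_haar continuous_intros C_cont)

lemma ip_self_eq:
  assumes "f \<in> C" shows "ip f f = of_real (\<integral>x. (cmod (f x))\<^sup>2 \<partial>\<mu>)"
proof -
  have "ip f f = (\<integral>x. complex_of_real ((cmod (f x))\<^sup>2) \<partial>\<mu>)"
    unfolding ip_def by (intro Bochner_Integration.integral_cong refl) (simp add: complex_norm_square mult.commute del: of_real_power)
  then show ?thesis by (simp only: integral_complex_of_real)
qed

lemma q_eq: "f \<in> C \<Longrightarrow> q f = (\<integral>x. (cmod (f x))\<^sup>2 \<partial>\<mu>)"
  by (simp add: q_def ip_self_eq)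

sublocale L2: inner_function_space C ip
proof
  fix v assume v: "v \<in> C"
  show "0 \<le> Re (ip v v)" by (simp add: ip_self_eq[OF v])
  assume "ip v v = 0"
  then have z: "(\<integral>x. (cmod (v x))\<^sup>2 \<partial>\<mu>) = 0" by (simp add: ip_self_eq[OF v])
  have "AE x in \<mu>. (cmod (v x))\<^sup>2 = 0"
    using z by (subst (asm) integral_nonneg_eq_0_iff_AE)
      (auto intro!: integrable_haar continuous_intros C_cont[OF v])
  then have ae: "AE x in \<mu>. v x = 0" by simp
  have op: "open {x. v x \<noteq> 0}"
    by (intro open_Collect_neq C_cont[OF v] continuous_on_const)
  then have "{x \<in> space \<mu>. v x \<noteq> 0} \<in> sets \<mu>" by (simp add: space_haar sets_haar)
  with ae have "{x. v x \<noteq> 0} \<in> null_sets \<mu>" by (simp add: AE_iff_null space_haar)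
  then have "{x. v x \<noteq> 0} = {}" using open_not_null[OF op] by blast
  then show "v = (\<lambda>_. 0)" by auto
next
  fix u v :: "'g \<Rightarrow> complex" assume "u \<in> C" "v \<in> C"
  have "ip v u = (\<integral>x. cnj (cnj (u x) * v x) \<partial>\<mu>)" by (simp add: ip_def mult.commute)
  then show "ip v u = cnj (ip u v)" by (simp only: ip_def Bochner_Integration.integral_cnj)
next
  fix u v w assume "u \<in> C" "v \<in> C" "w \<in> C"
  then show "ip u (\<lambda>x. v x + w x) = ip u v + ip u w"
    unfolding ip_def distrib_left by (intro Bochner_Integration.integral_add ip_integrable)
next
  fix u v c assume "u \<in> C" "v \<in> C"
  have "ip u (\<lambda>x. c * v x) = (\<integral>x. c * (cnj (u x) * v x) \<partial>\<mu>)" by (simp add: ip_def mult_ac)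
  then show "ip u (\<lambda>x. c * v x) = c * ip u v" by (simp add: ip_def)
qed (auto simp: C_def intro!: continuous_intros)

lemma q_bound:
  assumes "f \<in> C" "\<And>x. cmod (f x) \<le> b" shows "q f \<le> b\<^sup>2"
proof -
  have "q f \<le> norm (\<integral>x. (cmod (f x))\<^sup>2 \<partial>\<mu>)" by (simp add: q_eq[OF assms(1)])
  also have "\<dots> \<le> b\<^sup>2"
    by (rule norm_integral_le) (auto intro!: continuous_intros C_cont assms power_mono)
  finally show ?thesis .
qed

text \<open>Compactness of the second factor, through the tube lemma.\<close>

lemma near_uniformly:
  fixes F :: "'g \<Rightarrow> 'g \<Rightarrow> 'b::metric_space"
  assumes F: "continuous_on UNIV (\<lambda>(x, y). F x y)" and "\<epsilon> > 0"
  shows "\<exists>U. open U \<and> x0 \<in> U \<and> (\<forall>x\<in>U. \<forall>y. dist (F x y) (F x0 y) < \<epsilon>)"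
proof -
  have F1: "continuous_on UNIV (\<lambda>p. F (fst p) (snd p))" using F by (simp add: case_prod_beta)
  have F2: "continuous_on UNIV (\<lambda>p :: 'g \<times> 'g. F x0 (snd p))"
    using continuous_on_compose2[OF F, of UNIV "\<lambda>p. (x0, snd p)"] by (simp add: continuous_intros)
  let ?W = "{p. dist (F (fst p) (snd p)) (F x0 (snd p)) < \<epsilon>}"
  have W: "open ?W"
    by (intro open_Collect_less continuous_on_dist F1 F2 continuous_on_const)
  have "{x0} \<times> UNIV \<subseteq> ?W" using \<open>\<epsilon> > 0\<close> by auto
  from Elementary_Topology.tube_lemma[OF comp W this]
  obtain U where U: "x0 \<in> U" "open U" "U \<times> UNIV \<subseteq> ?W" by (elim exE conjE)
  have "dist (F x y) (F x0 y) < \<epsilon>" if "x \<in> U" for x y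
    using subsetD[OF U(3), of "(x, y)"] that by simp
  with U show ?thesis by blast
qed

lemma cont_section:
  assumes "continuous_on UNIV (\<lambda>(x, y). F x y)" shows "continuous_on UNIV (F x)"
  using continuous_on_compose2[OF assms, of UNIV "\<lambda>y. (x, y)"] by (simp add: continuous_intros)

lemma cont_parameter_integral:
  fixes F :: "'g \<Rightarrow> 'g \<Rightarrow> 'b::{banach, second_countable_topology}"
  assumes F: "continuous_on UNIV (\<lambda>(x, y). F x y)"
  shows "continuous_on UNIV (\<lambda>x. \<integral>y. F x y \<partial>\<mu>)"
proof (rule continuous_at_imp_continuous_on, rule ballI)
  fix x0 :: 'g
  show "isCont (\<lambda>x. \<integral>y. F x y \<partial>\<mu>) x0"
    unfolding isCont_def
  proof (rule tendstoI)
    fix \<epsilon> :: real assume e: "\<epsilon> > 0"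
    then have "\<epsilon> / 2 > 0" by simp
    from near_uniformly[OF F this, of x0] obtain U where U: "open U" "x0 \<in> U"
      "\<And>x y. x \<in> U \<Longrightarrow> dist (F x y) (F x0 y) < \<epsilon> / 2" by blast
    have "dist (\<integral>y. F x y \<partial>\<mu>) (\<integral>y. F x0 y \<partial>\<mu>) < \<epsilon>" if "x \<in> U" for x
    proof -
      have "dist (\<integral>y. F x y \<partial>\<mu>) (\<integral>y. F x0 y \<partial>\<mu>) = norm (\<integral>y. F x y - F x0 y \<partial>\<mu>)"
        unfolding dist_norm
        by (subst Bochner_Integration.integral_diff) (auto intro!: integrable_haar cont_section[OF F])
      also have "\<dots> \<le> \<epsilon> / 2"
        using U(3)[OF that]
        by (intro norm_integral_le continuous_on_diff cont_section[OF F]) (auto simp: dist_norm less_imp_le)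
      finally show ?thesis using e by simp
    qed
    then show "\<forall>\<^sub>F x in at x0. dist (\<integral>y. F x y \<partial>\<mu>) (\<integral>y. F x0 y \<partial>\<mu>) < \<epsilon>"
      using U(1,2) by (auto simp: eventually_at_topological)
  qed
qed

text \<open>The left regular representation.\<close>

definition L :: "'g \<Rightarrow> ('g \<Rightarrow> complex) \<Rightarrow> 'g \<Rightarrow> complex" where
  "L s f = (\<lambda>x. f (inv\<^bsub>G\<^esub> s \<otimes>\<^bsub>G\<^esub> x))"

lemma L_closed: "f \<in> C \<Longrightarrow> L s f \<in> C"
  unfolding C_def L_def by (auto intro!: continuous_on_compose2[of UNIV f] cont_mult' continuous_intros)

lemma L_mult: "L (s \<otimes>\<^bsub>G\<^esub> t) f = L s (L t f)"
  by (simp add: L_def G.inv_mult_group G.m_assoc)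

lemma L_ip: "f \<in> C \<Longrightarrow> g \<in> C \<Longrightarrow> ip (L s f) (L s g) = ip f g"
  unfolding ip_def L_def
  by (rule integral_translate[of "\<lambda>x. cnj (f x) * g x"]) (intro continuous_intros C_cont)

lemma L_cont:
  assumes "f \<in> C" "g \<in> C" shows "continuous_on UNIV (\<lambda>s. ip f (L s g))"
proof -
  have "continuous_on UNIV (\<lambda>(s, x). cnj (f x) * g (inv\<^bsub>G\<^esub> s \<otimes>\<^bsub>G\<^esub> x))"
    unfolding case_prod_beta
    by (intro continuous_intros continuous_on_compose2[OF C_cont[OF assms(1)]]
        continuous_on_compose2[OF C_cont[OF assms(2)]] cont_mult' cont_inv') auto
  from cont_parameter_integral[OF this] show ?thesis by (simp add: ip_def L_def)
qed

end

section \<open>A translation-invariant compact operator\<close>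

context compact_group
begin

lemma nonconstant_function:
  assumes "UNIV \<noteq> {\<one>\<^bsub>G\<^esub>}"
  obtains f :: "'g \<Rightarrow> real" and x where "continuous_on UNIV f" "range f \<subseteq> {0..1}" "f \<one>\<^bsub>G\<^esub> = 1" "f x = 0"
proof -
  obtain x where x: "x \<noteq> \<one>\<^bsub>G\<^esub>" using assms by auto
  have "\<exists>U V. open U \<and> open V \<and> y \<in> U \<and> z \<in> V \<and> disjnt U V" if "y \<noteq> z" for y z :: 'g
    unfolding disjnt_def by (rule hausdorff[OF that])
  then have "Hausdorff_space (euclidean :: 'g topology)"
    by (simp add: Hausdorff_space_def)
  moreover have "compact_space (euclidean :: 'g topology)" using comp by (simp add: compact_space_def)
  ultimately have "normal_space (euclidean :: 'g topology)"
    using compact_Hausdorff_or_regular_imp_normal_space by blast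
  then obtain f :: "'g \<Rightarrow> real" where f: "continuous_map euclidean (top_of_set {0..1}) f"
    "f ` {x} \<subseteq> {0}" "f ` {\<one>\<^bsub>G\<^esub>} \<subseteq> {1}"
    by (rule Urysohn_lemma[of _ "{x}" "{\<one>\<^bsub>G\<^esub>}" 0 1]) (use x in \<open>auto simp: disjnt_def\<close>)
  then show thesis by (intro that[of f x]) (auto simp: continuous_map_in_subtopology)
qed

text \<open>Symmetrise a nonconstant function and subtract its mean. Symmetry makes the convolution operator
  below self-adjoint, and mean zero makes it annihilate the constants.\<close>

lemma kernel_function:
  assumes "UNIV \<noteq> {\<one>\<^bsub>G\<^esub>}"
  obtains \<kappa> :: "'g \<Rightarrow> real" and x where "continuous_on UNIV \<kappa>" "\<And>x. \<kappa> (inv\<^bsub>G\<^esub> x) = \<kappa> x"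
    "(\<integral>x. \<kappa> x \<partial>\<mu>) = 0" "\<kappa> x \<noteq> 0"
proof -
  obtain f :: "'g \<Rightarrow> real" and x where f: "continuous_on UNIV f" "range f \<subseteq> {0..1}" "f \<one>\<^bsub>G\<^esub> = 1" "f x = 0"
    by (rule nonconstant_function[OF assms])
  define k where "k y = f y + f (inv\<^bsub>G\<^esub> y)" for y
  define \<kappa> where "\<kappa> y = k y - (\<integral>z. k z \<partial>\<mu>)" for y
  have k: "continuous_on UNIV k"
    unfolding k_def using f(1) continuous_on_compose2[OF f(1) cont_inv] by (intro continuous_on_add) auto
  have "k \<one>\<^bsub>G\<^esub> = 2" using f(3) by (simp add: k_def)
  moreover have "k x \<le> 1" using f(2,4) by (auto simp: k_def image_subset_iff)
  ultimately have "\<kappa> \<one>\<^bsub>G\<^esub> \<noteq> 0 \<or> \<kappa> x \<noteq> 0" by (auto simp: \<kappa>_def)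
  then obtain y where y: "\<kappa> y \<noteq> 0" by blast
  have "(\<integral>x. \<kappa> x \<partial>\<mu>) = (\<integral>z. k z \<partial>\<mu>) - (\<integral>z. (\<integral>z. k z \<partial>\<mu>) \<partial>\<mu>)"
    unfolding \<kappa>_def by (rule Bochner_Integration.integral_diff) (auto intro: integrable_haar k)
  also have "\<dots> = 0" by (simp add: P.prob_space)
  finally have "(\<integral>x. \<kappa> x \<partial>\<mu>) = 0" .
  moreover have "continuous_on UNIV \<kappa>" unfolding \<kappa>_def by (intro continuous_intros k)
  moreover have "\<kappa> (inv\<^bsub>G\<^esub> y) = \<kappa> y" for y by (simp add: \<kappa>_def k_def)
  ultimately show thesis using that y by blast
qed

end

locale convolution = compact_group G \<mu> for G :: "'g::{t2_space, second_countable_topology} monoid" and \<mu> +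
  fixes \<kappa> :: "'g \<Rightarrow> real"
  assumes \<kappa>_cont: "continuous_on UNIV \<kappa>" and \<kappa>_inv: "\<kappa> (inv\<^bsub>G\<^esub> x) = \<kappa> x"
    and \<kappa>_mean: "(\<integral>x. \<kappa> x \<partial>\<mu>) = 0" and \<kappa>_nonzero: "\<exists>x. \<kappa> x \<noteq> 0"
begin

text \<open>The kernel depends on \<open>y\<^sup>-\<^sup>1 x\<close> only, which is why the integral operator \<open>T\<close> commutes with left
  translations.\<close>

definition K :: "'g \<Rightarrow> 'g \<Rightarrow> complex" where "K x y = of_real (\<kappa> (inv\<^bsub>G\<^esub> y \<otimes>\<^bsub>G\<^esub> x))"

definition T :: "('g \<Rightarrow> complex) \<Rightarrow> 'g \<Rightarrow> complex" where "T f x = (\<integral>y. K x y * f y \<partial>\<mu>)"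

lemma K_cont: "continuous_on UNIV (\<lambda>(x, y). K x y)"
  unfolding K_def case_prod_beta
  by (intro continuous_intros continuous_on_compose2[OF \<kappa>_cont] cont_mult' cont_inv') auto

lemma K_sym: "K x y = K y x"
  using \<kappa>_inv[of "inv\<^bsub>G\<^esub> y \<otimes>\<^bsub>G\<^esub> x"] by (simp add: K_def G.inv_mult_group)

lemma K_cnj: "cnj (K x y) = K x y"
  by (simp add: K_def)

lemma K_C: "K x \<in> C"
  using cont_section[OF K_cont] by (simp add: C_def)

lemma K_bounded: obtains b where "b > 0" "\<And>x y. cmod (K x y) \<le> b"
proof -
  obtain b where "b > 0" "\<And>x. norm (\<kappa> x) \<le> b" using cont_bounded[OF \<kappa>_cont] by blast
  then show thesis by (intro that[of b]) (auto simp: K_def)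
qed

lemma T_ip: "T f x = ip (K x) f"
  by (simp add: T_def ip_def K_cnj)

lemma T_closed: assumes "f \<in> C" shows "T f \<in> C"
proof -
  have "continuous_on UNIV (\<lambda>(x, y). K x y * f y)"
    using K_cont unfolding case_prod_beta
    by (intro continuous_intros continuous_on_compose2[OF C_cont[OF assms]]) auto
  from cont_parameter_integral[OF this] show ?thesis by (simp add: C_def T_def[abs_def])
qed

lemma T_diff: "f \<in> C \<Longrightarrow> g \<in> C \<Longrightarrow> T (\<lambda>x. f x - g x) = (\<lambda>x. T f x - T g x)"
  by (rule ext) (simp add: T_ip L2.ip_diff K_C)

lemma T_add: "f \<in> C \<Longrightarrow> g \<in> C \<Longrightarrow> T (\<lambda>x. f x + g x) = (\<lambda>x. T f x + T g x)"
  by (rule ext) (simp add: T_ip L2.ip_add K_C)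

lemma T_scale: "f \<in> C \<Longrightarrow> T (\<lambda>x. c * f x) = (\<lambda>x. c * T f x)"
  by (rule ext) (simp add: T_ip L2.ip_scale K_C)

lemma T_zero: "T (\<lambda>_. 0) = (\<lambda>_. 0)"
  by (rule ext) (simp add: T_def)

lemma T_const: "T (\<lambda>_. c) = (\<lambda>_. 0)"
proof
  fix x
  have "T (\<lambda>_. c) x = (\<integral>y. K x y \<partial>\<mu>) * c"
    unfolding T_def by simp
  also have "(\<integral>y. K x y \<partial>\<mu>) = (\<integral>y. of_real (\<kappa> (inv\<^bsub>G\<^esub> x \<otimes>\<^bsub>G\<^esub> y)) \<partial>\<mu>)"
    by (subst K_sym) (simp add: K_def)
  also have "\<dots> = (\<integral>y. of_real (\<kappa> y) \<partial>\<mu>)"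
    by (rule integral_translate) (intro continuous_intros \<kappa>_cont)
  also have "\<dots> = 0" by (simp add: \<kappa>_mean)
  finally show "T (\<lambda>_. c) x = 0" by simp
qed

text \<open>Fubini and symmetry of the kernel.\<close>

lemma T_sym:
  assumes f: "f \<in> C" and g: "g \<in> C" shows "ip (T f) g = ip f (T g)"
proof -
  interpret PP: pair_prob_space \<mu> \<mu> ..
  let ?F = "\<lambda>x y. K x y * cnj (f y) * g x"
  have F: "continuous_on UNIV (\<lambda>(x, y). ?F x y)"
    using K_cont unfolding case_prod_beta
    by (intro continuous_intros continuous_on_compose2[OF C_cont[OF f]] continuous_on_compose2[OF C_cont[OF g]]) auto
  have comp2: "compact (UNIV :: ('g \<times> 'g) set)" using compact_Times[OF comp comp] by simp
  have "compact (range (\<lambda>(x, y). ?F x y))" by (rule compact_continuous_image[OF F comp2])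
  then have "bounded (range (\<lambda>(x, y). ?F x y))" by (rule compact_imp_bounded)
  then obtain b where "\<forall>z\<in>range (\<lambda>(x, y). ?F x y). cmod z \<le> b" unfolding bounded_iff by blast
  then have b: "cmod (?F x y) \<le> b" for x y using rangeI[of "\<lambda>(x, y). ?F x y" "(x, y)"] by fastforce
  have sets: "sets (\<mu> \<Otimes>\<^sub>M \<mu>) = sets borel"
    using sets_pair_measure_cong[OF sets_haar sets_haar] unfolding borel_prod .
  have "(\<lambda>(x, y). ?F x y) \<in> borel_measurable (\<mu> \<Otimes>\<^sub>M \<mu>)"
    using borel_measurable_continuous_onI[OF F] measurable_cong_sets[OF sets refl] by blast
  then have int: "integrable (\<mu> \<Otimes>\<^sub>M \<mu>) (\<lambda>(x, y). ?F x y)"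
    using b by (intro PP.integrable_const_bound[of _ b]) auto
  have "ip (T f) g = (\<integral>x. (\<integral>y. ?F x y \<partial>\<mu>) \<partial>\<mu>)"
  proof -
    have "cnj (T f x) * g x = (\<integral>y. ?F x y \<partial>\<mu>)" for x
    proof -
      have "cnj (T f x) = (\<integral>y. K x y * cnj (f y) \<partial>\<mu>)"
        unfolding T_def by (subst Bochner_Integration.integral_cnj[symmetric]) (simp add: K_cnj)
      then show ?thesis
        by (simp add: integrable_haar continuous_on_mult continuous_on_cnj C_cont K_C f)
    qed
    then show ?thesis by (simp only: ip_def)
  qed
  also have "\<dots> = (\<integral>y. (\<integral>x. ?F x y \<partial>\<mu>) \<partial>\<mu>)" by (rule PP.Fubini_integral[OF int, symmetric])
  also have "\<dots> = ip f (T g)"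
  proof -
    have "cnj (f y) * T g y = (\<integral>x. ?F x y \<partial>\<mu>)" for y
    proof -
      have "cnj (f y) * T g y = (\<integral>x. cnj (f y) * (K y x * g x) \<partial>\<mu>)" by (simp add: T_def)
      also have "\<dots> = (\<integral>x. ?F x y \<partial>\<mu>)"
        by (intro Bochner_Integration.integral_cong refl) (simp add: K_sym[of y] mult_ac)
      finally show ?thesis .
    qed
    then show ?thesis by (simp only: ip_def)
  qed
  finally show ?thesis .
qed

lemma T_translate:
  assumes "f \<in> C" shows "T (L s f) = L s (T f)"
proof
  fix x
  have "T (L s f) x = (\<integral>y. K x (s \<otimes>\<^bsub>G\<^esub> y) * L s f (s \<otimes>\<^bsub>G\<^esub> y) \<partial>\<mu>)"
    unfolding T_def
    by (rule integral_translate[symmetric]) (intro continuous_intros C_cont K_C L_closed assms)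
  also have "\<dots> = L s (T f) x" by (simp add: T_def L_def K_def G.inv_mult_group G.m_assoc)
  finally show "T (L s f) x = L s (T f) x" .
qed

lemma T_pointwise:
  assumes "\<And>x y. cmod (K x y) \<le> b" "f \<in> C"
  shows "(cmod (T f x))\<^sup>2 \<le> b\<^sup>2 * q f"
proof -
  have "(cmod (T f x))\<^sup>2 \<le> q (K x) * q f"
    unfolding T_ip q_def by (rule L2.cauchy_schwarz[OF K_C assms(2)])
  also have "\<dots> \<le> b\<^sup>2 * q f"
    using q_bound[OF K_C assms(1)] L2.ip_nonneg[OF assms(2)] by (intro mult_right_mono) (auto simp: q_def)
  finally show ?thesis .
qed

lemma T_sup:
  assumes "\<And>x y. cmod (K x y) \<le> b" "f \<in> C" "\<And>x. cmod (f x) \<le> c"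
  shows "cmod (T f x) \<le> b * c"
  unfolding T_def using C_cont[OF K_C] C_cont[OF assms(2)] assms(1)[of x] assms(3)
  by (intro norm_integral_le continuous_on_mult)
     (auto simp: norm_mult intro!: mult_mono order_trans[OF norm_ge_zero assms(1)])

lemma T_uniform_limit:
  assumes F: "\<And>n. F n \<in> C" and g: "g \<in> C" and lim: "uniform_limit UNIV F g sequentially"
  shows "uniform_limit UNIV (\<lambda>n. T (F n)) (T g) sequentially"
proof (rule uniform_limitI)
  fix \<epsilon> :: real assume e: "\<epsilon> > 0"
  obtain b where b: "b > 0" "\<And>x y. cmod (K x y) \<le> b" using K_bounded by blast
  have "\<epsilon> / (2 * b) > 0" using e b by simp
  from uniform_limitD[OF lim this]
  have "\<forall>\<^sub>F n in sequentially. \<forall>x\<in>UNIV. dist (F n x) (g x) < \<epsilon> / (2 * b)" .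
  then show "\<forall>\<^sub>F n in sequentially. \<forall>x\<in>UNIV. dist (T (F n) x) (T g x) < \<epsilon>"
  proof (rule eventually_mono)
    fix n assume n: "\<forall>x\<in>UNIV. dist (F n x) (g x) < \<epsilon> / (2 * b)"
    have "dist (T (F n) x) (T g x) < \<epsilon>" for x
    proof -
      have "cmod (T (\<lambda>x. F n x - g x) x) \<le> b * (\<epsilon> / (2 * b))"
        using n by (intro T_sup[OF b(2)] L2.diff_closed F g) (auto simp: dist_norm less_imp_le)
      also have "\<dots> < \<epsilon>" using b(1) e by simp
      finally show ?thesis by (simp add: T_diff F g dist_norm)
    qed
    then show "\<forall>x\<in>UNIV. dist (T (F n) x) (T g x) < \<epsilon>" by blast
  qed
qed

end

section \<open>An eigenvalue of the square of the operator\<close>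

context convolution
begin

lemma T_quadratic_bound:
  assumes "\<And>x y. cmod (K x y) \<le> b" "f \<in> C"
  shows "q (T f) \<le> b\<^sup>2 * q f"
proof -
  have nn: "0 \<le> b\<^sup>2 * q f" using L2.ip_nonneg[OF assms(2)] by (simp add: q_def)
  have "cmod (T f x) \<le> sqrt (b\<^sup>2 * q f)" for x
    using T_pointwise[OF assms] by (rule real_le_rsqrt)
  from q_bound[OF T_closed[OF assms(2)] this] show ?thesis using nn by simp
qed

text \<open>The square of the operator norm of \<open>T\<close>. Working with \<open>T\<^sup>2\<close> instead of \<open>T\<close> avoids deciding which of
  the two candidates for an extremal eigenvalue, with opposite signs, is attained.\<close>

definition \<rho> :: real where "\<rho> = (SUP f\<in>{f \<in> C. q f \<le> 1}. q (T f))"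

lemma q_zero: "q (\<lambda>_. 0) = 0"
  by (simp add: q_def ip_def)

lemma bdd_norms: "bdd_above ((\<lambda>f. q (T f)) ` {f \<in> C. q f \<le> 1})"
proof -
  obtain b where b: "b > 0" "\<And>x y. cmod (K x y) \<le> b" using K_bounded by blast
  have "q (T f) \<le> b\<^sup>2" if "f \<in> C" "q f \<le> 1" for f
    using T_quadratic_bound[OF b(2) that(1)] mult_left_mono[OF that(2), of "b\<^sup>2"] by simp
  then show ?thesis by (intro bdd_aboveI2[of _ _ "b\<^sup>2"]) auto
qed

lemma q_pos: "f \<in> C \<Longrightarrow> f \<noteq> (\<lambda>_. 0) \<Longrightarrow> 0 < q f"
  using L2.ip_definite[of f] L2.ip_self[of f] L2.ip_nonneg[of f] unfolding q_def
  by (metis less_eq_real_def of_real_0)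

lemma q_scale:
  assumes "f \<in> C" shows "q (\<lambda>x. of_real c * f x) = c\<^sup>2 * q f"
proof -
  have "ip (\<lambda>x. of_real c * f x) (\<lambda>x. of_real c * f x) = of_real c * ip (\<lambda>x. of_real c * f x) f"
    by (rule L2.ip_scale[OF L2.scale_closed[OF assms] assms])
  also have "ip (\<lambda>x. of_real c * f x) f = cnj (of_real c * ip f f)"
    using L2.ip_cnj[OF assms L2.scale_closed[OF assms]] L2.ip_scale[OF assms assms] by simp
  finally show ?thesis by (simp add: q_def power2_eq_square)
qed

lemma q_T_le:
  assumes "f \<in> C" shows "q (T f) \<le> \<rho> * q f"
proof (cases "f = (\<lambda>_. 0)")
  case True
  then show ?thesis by (simp add: T_zero q_zero)
next
  case False
  then have q: "q f > 0" by (rule q_pos[OF assms])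
  define c where "c = 1 / sqrt (q f)"
  have c: "c\<^sup>2 * q f = 1" using q by (simp add: c_def power_divide)
  let ?u = "\<lambda>x. of_real c * f x"
  have u: "?u \<in> C" by (rule L2.scale_closed[OF assms])
  have "q ?u = 1" using q_scale[OF assms] c by simp
  then have "q (T ?u) \<le> \<rho>" unfolding \<rho>_def using u by (intro cSUP_upper bdd_norms) auto
  moreover have "q (T ?u) = c\<^sup>2 * q (T f)" using T_scale[OF assms] q_scale[OF T_closed[OF assms]] by simp
  ultimately have "c\<^sup>2 * q (T f) * q f \<le> \<rho> * q f" using q by (intro mult_right_mono) auto
  moreover have "c\<^sup>2 * q (T f) * q f = q (T f) * (c\<^sup>2 * q f)" by simp
  ultimately show ?thesis by (simp add: c)
qed

lemma eigenvalue_pos: "\<rho> > 0"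
proof -
  obtain x where x: "\<kappa> x \<noteq> 0" using \<kappa>_nonzero by blast
  have "K x \<one>\<^bsub>G\<^esub> \<noteq> 0" using x by (simp add: K_def)
  then have Kx: "K x \<noteq> (\<lambda>_. 0)" by (auto simp: fun_eq_iff)
  have qK: "q (K x) > 0" by (rule q_pos[OF K_C Kx])
  have "T (K x) x = ip (K x) (K x)" by (simp add: T_ip)
  then have "T (K x) \<noteq> (\<lambda>_. 0)" using qK unfolding q_def by force
  then have "q (T (K x)) > 0" by (rule q_pos[OF T_closed[OF K_C]])
  with q_T_le[OF K_C, of x] have "0 < \<rho> * q (K x)" by simp
  then show ?thesis using qK by (simp add: zero_less_mult_iff)
qed

text \<open>Functions that nearly attain the supremum are nearly eigenvectors of \<open>T\<^sup>2\<close>: expand the squared norm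
  and use that \<open>T\<close> is self-adjoint.\<close>

lemma almost_eigenvector:
  assumes f: "f \<in> C" "q f \<le> 1"
  shows "q (\<lambda>x. T (T f) x - of_real \<rho> * f x) \<le> \<rho> * (\<rho> - q (T f))"
proof -
  let ?h = "T f" and ?u = "T (T f)" and ?v = "\<lambda>x. of_real \<rho> * f x"
  have h: "?h \<in> C" and u: "?u \<in> C" and v: "?v \<in> C"
    by (intro T_closed f L2.scale_closed)+
  have "ip ?u f = ip ?h ?h" by (rule T_sym[OF h f(1)])
  then have uv: "ip ?u ?v = of_real \<rho> * of_real (q ?h)"
    using L2.ip_scale[OF u f(1)] L2.ip_self[OF h] by (simp add: q_def)
  have "ip (\<lambda>x. ?u x - ?v x) (\<lambda>x. ?u x - ?v x) = ip ?u ?u - ip ?u ?v - (ip ?v ?u - ip ?v ?v)"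
    using u v L2.diff_closed[OF u v] by (simp add: L2.ip_diff L2.ip_diff_left)
  also have "ip ?v ?u = of_real \<rho> * of_real (q ?h)" using L2.ip_cnj[OF u v] uv by simp
  finally have "q (\<lambda>x. ?u x - ?v x) = q ?u - 2 * \<rho> * q ?h + q ?v" by (simp add: q_def uv)
  also have "q ?v = \<rho>\<^sup>2 * q f" by (rule q_scale[OF f(1)])
  also have "\<rho>\<^sup>2 * q f \<le> \<rho>\<^sup>2" using mult_left_mono[OF f(2), of "\<rho>\<^sup>2"] by simp
  finally show ?thesis using q_T_le[OF h] by (simp add: power2_eq_square algebra_simps)
qed

text \<open>Images under \<open>T\<close> of a maximising sequence are bounded and equicontinuous. A uniform limit \<open>g\<close> of a
  subsequence is an eigenvector of \<open>T\<^sup>2\<close>, and it is not zero because the norms tend to that of \<open>T\<close>.\<close>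

lemma eigenvector_exists:
  "\<exists>g\<in>C. g \<noteq> (\<lambda>_. 0) \<and> T (T g) = (\<lambda>x. of_real \<rho> * g x)"
proof -
  obtain b where b: "b > 0" "\<And>x y. cmod (K x y) \<le> b" using K_bounded by blast
  have zero: "(\<lambda>_. 0) \<in> {f \<in> C. q f \<le> 1}" by (simp add: L2.zero_closed q_zero)
  have "\<exists>f. f \<in> C \<and> q f \<le> 1 \<and> \<rho> - inverse (real (Suc n)) < q (T f)" for n
  proof -
    have "\<rho> - inverse (real (Suc n)) < \<rho>" by simp
    then show ?thesis
      unfolding \<rho>_def using zero bdd_norms by (subst (asm) less_cSUP_iff) auto
  qed
  then obtain f where f: "\<And>n. f n \<in> C" "\<And>n. q (f n) \<le> 1"
    "\<And>n. \<rho> - inverse (real (Suc n)) < q (T (f n))" by metis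
  define h where "h n = T (f n)" for n
  have h: "h n \<in> C" for n unfolding h_def by (rule T_closed[OF f(1)])
  have h_bd: "cmod (h n x) \<le> b" for n x
  proof -
    have "(cmod (h n x))\<^sup>2 \<le> b\<^sup>2 * q (f n)" unfolding h_def by (rule T_pointwise[OF b(2) f(1)])
    also have "\<dots> \<le> b\<^sup>2" using mult_left_mono[OF f(2), of "b\<^sup>2" n] by simp
    finally show ?thesis using b(1) by (simp add: power2_le_iff_abs_le)
  qed
  have h_eq: "\<exists>U. open U \<and> x0 \<in> U \<and> (\<forall>n. \<forall>x\<in>U. dist (h n x) (h n x0) < \<epsilon>)" if "\<epsilon> > 0" for x0 \<epsilon>
  proof -
    have "\<epsilon> / 2 > 0" using that by simp
    from near_uniformly[OF K_cont this, of x0]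
    obtain U where U: "open U" "x0 \<in> U" "\<And>x y. x \<in> U \<Longrightarrow> dist (K x y) (K x0 y) < \<epsilon> / 2" by blast
    have "dist (h n x) (h n x0) < \<epsilon>" if x: "x \<in> U" for n x
    proof -
      let ?D = "\<lambda>y. K x y - K x0 y"
      have D: "?D \<in> C" by (rule L2.diff_closed[OF K_C K_C])
      have "h n x - h n x0 = ip ?D (f n)"
        unfolding h_def T_ip by (rule L2.ip_diff_left[OF f(1) K_C K_C, symmetric])
      then have "(cmod (h n x - h n x0))\<^sup>2 \<le> q ?D * q (f n)"
        using L2.cauchy_schwarz[OF D f(1)] by (simp add: q_def)
      also have "\<dots> \<le> (\<epsilon> / 2)\<^sup>2 * 1"
      proof (rule mult_mono)
        show "q ?D \<le> (\<epsilon> / 2)\<^sup>2"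
          using U(3)[OF x] by (intro q_bound[OF D]) (simp add: dist_norm less_imp_le)
        show "0 \<le> q (f n)" using L2.ip_nonneg[OF f(1)] by (simp add: q_def)
      qed (use f(2) in auto)
      finally have "cmod (h n x - h n x0) \<le> \<epsilon> / 2" using \<open>\<epsilon> > 0\<close> by (simp add: power2_le_iff_abs_le)
      then show ?thesis using \<open>\<epsilon> > 0\<close> by (simp add: dist_norm)
    qed
    with U show ?thesis by blast
  qed
  obtain r g where r: "strict_mono r" and lim: "uniform_limit UNIV (\<lambda>n. h (r n)) g sequentially"
    by (rule equicontinuous_convergent_subsequence[OF comp h_bd h_eq])
  have g: "g \<in> C"
  proof -
    have "\<forall>\<^sub>F n in sequentially. continuous_on UNIV (h (r n))" using h by (simp add: C_def)
    from uniform_limit_theorem[OF this lim] show ?thesis by (simp add: C_def)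
  qed
  have TT: "uniform_limit UNIV (\<lambda>n. T (T (h (r n)))) (T (T g)) sequentially"
    by (intro T_uniform_limit T_closed h g lim)
  have "T (T g) x = of_real \<rho> * g x" for x
  proof -
    \<comment> \<open>The residuals of the eigenvector equation tend to zero in norm only. Applying \<open>T\<close> once more makes
      the convergence pointwise and replaces \<open>f n\<close> by the convergent \<open>h n\<close>.\<close>
    let ?w = "\<lambda>n x. T (T (f n)) x - of_real \<rho> * f n x"
    have w: "?w n \<in> C" for n by (intro L2.diff_closed L2.scale_closed T_closed f)
    have Tw: "T (?w n) x = T (T (h n)) x - of_real \<rho> * h n x" for n
      by (simp add: T_diff T_scale T_closed L2.scale_closed f h_def)
    have le: "(cmod (T (?w n) x))\<^sup>2 \<le> b\<^sup>2 * (\<rho> * inverse (real (Suc n)))" for n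
    proof -
      have "(cmod (T (?w n) x))\<^sup>2 \<le> b\<^sup>2 * q (?w n)" by (rule T_pointwise[OF b(2) w])
      also have "q (?w n) \<le> \<rho> * (\<rho> - q (T (f n)))" by (rule almost_eigenvector[OF f(1,2)])
      also have "\<dots> \<le> \<rho> * inverse (real (Suc n))"
        using f(3)[of n] eigenvalue_pos by (intro mult_left_mono) auto
      finally show ?thesis by (simp add: mult_left_mono)
    qed
    have "(\<lambda>n. b\<^sup>2 * (\<rho> * inverse (real (Suc n)))) \<longlonglongrightarrow> b\<^sup>2 * (\<rho> * 0)"
      by (intro tendsto_intros LIMSEQ_inverse_real_of_nat)
    then have lim0: "(\<lambda>n. b\<^sup>2 * (\<rho> * inverse (real (Suc n)))) \<longlonglongrightarrow> 0" by simp
    have "(\<lambda>n. (cmod (T (?w n) x))\<^sup>2) \<longlonglongrightarrow> 0"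
    proof (rule tendsto_sandwich[OF _ _ tendsto_const lim0])
      show "\<forall>\<^sub>F n in sequentially. 0 \<le> (cmod (T (?w n) x))\<^sup>2" by (rule always_eventually) simp
      show "\<forall>\<^sub>F n in sequentially. (cmod (T (?w n) x))\<^sup>2 \<le> b\<^sup>2 * (\<rho> * inverse (real (Suc n)))"
        by (rule always_eventually) (intro allI le)
    qed
    then have "(\<lambda>n. sqrt ((cmod (T (?w n) x))\<^sup>2)) \<longlonglongrightarrow> sqrt 0" by (rule tendsto_real_sqrt)
    then have "(\<lambda>n. cmod (T (?w n) x)) \<longlonglongrightarrow> 0" by simp
    then have "(\<lambda>n. T (?w n) x) \<longlonglongrightarrow> 0" by (rule tendsto_norm_zero_cancel)
    from LIMSEQ_subseq_LIMSEQ[OF this r]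
    have "(\<lambda>n. T (T (h (r n))) x - of_real \<rho> * h (r n) x) \<longlonglongrightarrow> 0" by (simp add: Tw comp_def)
    moreover have "(\<lambda>n. T (T (h (r n))) x - of_real \<rho> * h (r n) x) \<longlonglongrightarrow> T (T g) x - of_real \<rho> * g x"
      by (intro tendsto_intros tendsto_uniform_limitI[OF TT] tendsto_uniform_limitI[OF lim]) auto
    ultimately have "0 = T (T g) x - of_real \<rho> * g x" by (rule LIMSEQ_unique)
    then show ?thesis by simp
  qed
  moreover have "g \<noteq> (\<lambda>_. 0)"
  proof
    assume g0: "g = (\<lambda>_. 0)"
    \<comment> \<open>uniform convergence to zero would bring \<open>q (h (r n))\<close> below half of its limit \<open>\<rho>\<close>\<close>
    define \<epsilon> where "\<epsilon> = sqrt (\<rho> / 2)"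
    have e: "\<epsilon> > 0" "\<epsilon>\<^sup>2 = \<rho> / 2" using eigenvalue_pos by (auto simp: \<epsilon>_def)
    have "\<forall>\<^sub>F n in sequentially. \<forall>x\<in>UNIV. dist (h (r n) x) (g x) < \<epsilon>" by (rule uniform_limitD[OF lim e(1)])
    moreover have "\<forall>\<^sub>F n in sequentially. inverse (real (Suc n)) < \<rho> / 2"
      by (rule order_tendstoD(2)[OF LIMSEQ_inverse_real_of_nat]) (use eigenvalue_pos in simp)
    ultimately have "\<forall>\<^sub>F n in sequentially. (\<forall>x. cmod (h (r n) x) < \<epsilon>) \<and> inverse (real (Suc n)) < \<rho> / 2"
      by eventually_elim (simp add: g0)
    then obtain n where n: "\<And>x. cmod (h (r n) x) < \<epsilon>" "inverse (real (Suc n)) < \<rho> / 2"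
      unfolding eventually_sequentially by blast
    have "q (h (r n)) \<le> \<epsilon>\<^sup>2" using n(1) by (intro q_bound[OF h]) (simp add: less_imp_le)
    moreover have "inverse (real (Suc (r n))) \<le> inverse (real (Suc n))"
      using seq_suble[OF r, of n] by (intro le_imp_inverse_le) auto
    ultimately show False using f(3)[of "r n"] n(2) e(2) by (simp add: h_def)
  qed
  ultimately show ?thesis using g by blast
qed

section \<open>The eigenspace\<close>

definition E :: "('g \<Rightarrow> complex) set" where
  "E = {f \<in> C. T (T f) = (\<lambda>x. of_real \<rho> * f x)}"

sublocale E: inner_function_space E ip
  by (rule L2.subspace)
     (auto simp: E_def L2.zero_closed L2.add_closed L2.scale_closed T_zero T_add T_scale T_closed
        algebra_simps)

text \<open>Bessel's inequality for the rows of the kernel bounds the dimension of the eigenspace.\<close>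

lemma eigenspace_dim: "\<exists>N. \<forall>m e. E.orthonormal m e \<longrightarrow> m \<le> N"
proof -
  obtain b where b: "b > 0" "\<And>x y. cmod (K x y) \<le> b" using K_bounded by blast
  \<comment> \<open>\<open>m \<rho>\<close> is the sum of the \<open>q (T (e i))\<close>, which Bessel bounds by \<open>b\<^sup>2\<close>\<close>
  have "m \<le> nat \<lfloor>b\<^sup>2 / \<rho>\<rfloor>" if e: "E.orthonormal m e" for m e
  proof -
    have eE: "e i \<in> E" and ee: "ip (e i) (e i) = 1" if "i < m" for i
      using e that by (auto simp: E.orthonormal_def)
    have eC: "e i \<in> C" if "i < m" for i using eE[OF that] by (simp add: E_def)
    have on: "L2.orthonormal m e" using e eC unfolding L2.orthonormal_def E.orthonormal_def by blast
    have "q (T (e i)) = \<rho>" if i: "i < m" for i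
    proof -
      have "ip (T (e i)) (T (e i)) = ip (e i) (T (T (e i)))" by (rule T_sym[OF eC[OF i] T_closed[OF eC[OF i]]])
      also have "T (T (e i)) = (\<lambda>x. of_real \<rho> * e i x)" using eE[OF i] by (simp add: E_def)
      finally show ?thesis using ee[OF i] by (simp add: q_def L2.ip_scale[OF eC[OF i] eC[OF i]])
    qed
    then have "real m * \<rho> = (\<Sum>i<m. q (T (e i)))" by simp
    also have "\<dots> = (\<Sum>i<m. \<integral>x. (cmod (T (e i) x))\<^sup>2 \<partial>\<mu>)" by (simp add: q_eq T_closed eC)
    also have "\<dots> = (\<integral>x. (\<Sum>i<m. (cmod (T (e i) x))\<^sup>2) \<partial>\<mu>)"
      by (rule Bochner_Integration.integral_sum[symmetric])
         (auto intro!: integrable_haar continuous_intros C_cont T_closed eC)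
    also have "\<dots> \<le> norm (\<integral>x. (\<Sum>i<m. (cmod (T (e i) x))\<^sup>2) \<partial>\<mu>)" by simp
    also have "\<dots> \<le> b\<^sup>2"
    proof (rule norm_integral_le)
      show "continuous_on UNIV (\<lambda>x. \<Sum>i<m. (cmod (T (e i) x))\<^sup>2)"
        by (auto intro!: continuous_intros C_cont T_closed eC)
      fix x
      have "(\<Sum>i<m. (cmod (T (e i) x))\<^sup>2) = (\<Sum>i<m. (cmod (ip (e i) (K x)))\<^sup>2)"
      proof (rule sum.cong[OF refl])
        fix i assume "i \<in> {..<m}"
        then have "T (e i) x = cnj (ip (e i) (K x))"
          unfolding T_ip by (intro L2.ip_cnj eC K_C) auto
        then show "(cmod (T (e i) x))\<^sup>2 = (cmod (ip (e i) (K x)))\<^sup>2" by simp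
      qed
      also have "\<dots> \<le> q (K x)" unfolding q_def by (rule L2.bessel[OF on K_C])
      also have "\<dots> \<le> b\<^sup>2" by (rule q_bound[OF K_C b(2)])
      finally show "norm (\<Sum>i<m. (cmod (T (e i) x))\<^sup>2) \<le> b\<^sup>2" by (simp add: sum_nonneg)
    qed
    finally have "real m \<le> b\<^sup>2 / \<rho>" using eigenvalue_pos by (simp add: pos_le_divide_eq)
    then show ?thesis by (simp add: le_nat_floor)
  qed
  then show ?thesis by blast
qed

lemma eigenspace_action:
  assumes "\<And>m e. E.orthonormal m e \<Longrightarrow> m \<le> N"
  shows "unitary_action E ip N G L"
proof (intro unitary_action.intro finite_inner_space.intro finite_inner_space_axioms.intro
    unitary_action_axioms.intro E.inner_function_space_axioms)
  have EC: "E \<subseteq> C" by (auto simp: E_def)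
  fix v s assume v: "v \<in> E"
  then have "v \<in> C" "T (T v) = (\<lambda>x. of_real \<rho> * v x)" by (auto simp: E_def)
  then show "L s v \<in> E" by (simp add: E_def L_closed T_translate T_closed) (simp add: L_def)
qed (use assms group carrier L_mult L_ip L_cont in \<open>auto simp: E_def\<close>)

text \<open>Constants are annihilated by the operator, so eigenfunctions are not constant.\<close>

lemma nonconstant_eigenfunction:
  obtains g where "g \<in> E" "\<And>c. g \<noteq> (\<lambda>_. c)"
proof -
  obtain g where g: "g \<in> C" "g \<noteq> (\<lambda>_. 0)" "T (T g) = (\<lambda>x. of_real \<rho> * g x)"
    using eigenvector_exists by blast
  have "g \<noteq> (\<lambda>_. c)" for c
  proof
    assume "g = (\<lambda>_. c)"
    then have "T (T g) = (\<lambda>_. 0)" by (simp add: T_const)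
    then have "of_real \<rho> * g x = 0" for x using g(3) by (metis (no_types))
    then show False using g(2) eigenvalue_pos by auto
  qed
  with g show thesis by (intro that[of g]) (auto simp: E_def)
qed

end

section \<open>A function in the coefficient algebra vanishing exactly on a proper subgroup\<close>

context compact_group
begin

text \<open>For an eigenfunction \<open>g\<close> the coefficient \<open>s \<mapsto> \<langle>g, g\<rangle> - \<langle>g, L s g\<rangle>\<close> vanishes exactly when the
  squared norm of \<open>L s g - g\<close> does.\<close>

lemma stabilizer_function:
  assumes "UNIV \<noteq> {\<one>\<^bsub>G\<^esub>}"
  obtains a g where "a \<in> coeffs G" "g \<in> C" "\<And>c. g \<noteq> (\<lambda>_. c)" "\<And>s. a s = 0 \<longleftrightarrow> L s g = g"
proof -
  obtain \<kappa> :: "'g \<Rightarrow> real" and x where \<kappa>: "continuous_on UNIV \<kappa>" "\<And>x. \<kappa> (inv\<^bsub>G\<^esub> x) = \<kappa> x"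
    "(\<integral>x. \<kappa> x \<partial>\<mu>) = 0" "\<kappa> x \<noteq> 0"
    by (rule kernel_function[OF assms]) (rule that)
  interpret convolution G \<mu> \<kappa>
    by (intro convolution.intro compact_group_axioms convolution_axioms.intro) (use \<kappa> in auto)
  obtain N where N: "\<And>m e. E.orthonormal m e \<Longrightarrow> m \<le> N" using eigenspace_dim by blast
  have ua: "unitary_action E ip N G L" by (rule eigenspace_action[OF N])
  obtain g where g: "g \<in> E" "\<And>c. g \<noteq> (\<lambda>_. c)" by (rule nonconstant_eigenfunction) (rule that)
  have gC: "g \<in> C" using g(1) by (simp add: E_def)
  define a where "a s = ip g g * 1 + (-1) * ip g (L s g)" for s
  have "a \<in> coeffs G" unfolding a_def
    by (intro coeffs_add coeffs_scale coeffs_one group carrier coefficient_closed[OF g(1) g(1) ua])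
  moreover have "a s = 0 \<longleftrightarrow> L s g = g" for s
  proof
    assume "a s = 0"
    then have 1: "ip g (L s g) = ip g g" by (simp add: a_def)
    have Ls: "L s g \<in> C" by (rule L_closed[OF gC])
    have 2: "ip (L s g) g = ip g g" using L2.ip_cnj[OF gC Ls] 1 L2.ip_cnj[OF gC gC] by simp
    have "ip (\<lambda>x. L s g x - g x) (\<lambda>x. L s g x - g x) = 0"
      using gC Ls L2.diff_closed[OF Ls gC] by (simp add: L2.ip_diff L2.ip_diff_left L_ip 1 2)
    from L2.ip_definite[OF L2.diff_closed[OF Ls gC] this] show "L s g = g" by (simp add: fun_eq_iff)
  qed (simp add: a_def)
  ultimately show thesis using that gC g(2) by blast
qed

text \<open>A closed proper subgroup of a connected group has infinite index, so it is null: its cosets are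
  pairwise disjoint and have equal measure.\<close>

lemma stabilizer_null:
  assumes conn: "connected (UNIV :: 'g set)" and a: "continuous_on UNIV (a :: 'g \<Rightarrow> complex)"
    and g: "\<And>c. g \<noteq> (\<lambda>_. c)" and ag: "\<And>s. a s = 0 \<longleftrightarrow> L s g = g"
  shows "AE s in \<mu>. a s \<noteq> 0"
proof -
  define H where "H = {s. a s = 0}"
  have H_L: "s \<in> H \<longleftrightarrow> L s g = g" for s by (simp add: H_def ag)
  have H_closed: "closed H" unfolding H_def by (intro closed_Collect_eq a continuous_on_const)
  have H_one: "\<one>\<^bsub>G\<^esub> \<in> H" by (simp add: H_L L_def)
  have H_mult: "s \<otimes>\<^bsub>G\<^esub> t \<in> H" if "s \<in> H" "t \<in> H" for s t using that by (simp add: H_L L_mult)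
  have H_inv: "inv\<^bsub>G\<^esub> s \<in> H" if "s \<in> H" for s
  proof -
    have "L (inv\<^bsub>G\<^esub> s) (L s g) = g" by (simp add: L_mult[symmetric]) (simp add: L_def)
    then show ?thesis using that by (simp add: H_L)
  qed
  define cst where "cst s = {x. inv\<^bsub>G\<^esub> s \<otimes>\<^bsub>G\<^esub> x \<in> H}" for s
  have cst_closed: "closed (cst s)" for s
  proof -
    have "continuous_on UNIV (\<lambda>x. inv\<^bsub>G\<^esub> s \<otimes>\<^bsub>G\<^esub> x)" by (intro cont_mult' continuous_intros)
    from closed_vimage[OF H_closed this] show ?thesis by (simp add: cst_def vimage_def)
  qed
  have cst_meas: "measure \<mu> (cst s) = measure \<mu> H" for s
  proof -
    have m: "(\<lambda>x. inv\<^bsub>G\<^esub> s \<otimes>\<^bsub>G\<^esub> x) \<in> measurable \<mu> borel"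
      by (rule measurable_haar) (intro cont_mult' continuous_intros)
    have "measure \<mu> H = measure (distr \<mu> borel (\<lambda>x. inv\<^bsub>G\<^esub> s \<otimes>\<^bsub>G\<^esub> x)) H" by (simp add: distr_haar)
    also have "\<dots> = measure \<mu> ((\<lambda>x. inv\<^bsub>G\<^esub> s \<otimes>\<^bsub>G\<^esub> x) -` H \<inter> space \<mu>)"
      by (rule measure_distr[OF m]) (use H_closed in simp)
    finally show ?thesis by (simp add: cst_def space_haar vimage_def)
  qed
  have cst_eq: "cst s = cst t" if x: "x \<in> cst s" "x \<in> cst t" for s t x
  proof -
    have key: "cst s \<subseteq> cst t" if "x \<in> cst s" "x \<in> cst t" for s t
    proof
      fix y assume y: "y \<in> cst s"
      have "inv\<^bsub>G\<^esub> t \<otimes>\<^bsub>G\<^esub> x \<otimes>\<^bsub>G\<^esub> (inv\<^bsub>G\<^esub> (inv\<^bsub>G\<^esub> s \<otimes>\<^bsub>G\<^esub> x) \<otimes>\<^bsub>G\<^esub> (inv\<^bsub>G\<^esub> s \<otimes>\<^bsub>G\<^esub> y)) \<in> H"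
        using that y unfolding cst_def by (intro H_mult[OF _ H_mult[OF H_inv]]) auto
      then show "y \<in> cst t" by (simp add: cst_def G.inv_mult_group G.m_assoc)
    qed
    show ?thesis using key[OF x] key[OF x(2,1)] by blast
  qed
  have cst_self: "s \<in> cst s" for s by (simp add: cst_def H_one)
  have cst_one: "cst \<one>\<^bsub>G\<^esub> = H" by (simp add: cst_def)
  have "measure \<mu> H = 0"
  proof (rule ccontr)
    assume "measure \<mu> H \<noteq> 0"
    then have pos: "measure \<mu> H > 0" by (simp add: zero_less_measure_iff)
    \<comment> \<open>disjoint cosets of equal positive measure in a space of measure one\<close>
    have card_le: "card F \<le> nat \<lfloor>1 / measure \<mu> H\<rfloor>" if F: "F \<subseteq> range cst" "finite F" for F
    proof -
      have "real (card F) * measure \<mu> H = (\<Sum>A\<in>F. measure \<mu> A)"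
      proof -
        have "measure \<mu> A = measure \<mu> H" if "A \<in> F" for A using F(1) that cst_meas by blast
        then show ?thesis by simp
      qed
      also have "\<dots> = measure \<mu> (\<Union>A\<in>F. A)"
      proof (rule P.finite_measure_finite_Union[symmetric])
        show "finite F" by fact
        show "(\<lambda>A. A) ` F \<subseteq> sets \<mu>" using F cst_closed by (auto simp: sets_haar)
        show "disjoint_family_on (\<lambda>A. A) F"
          unfolding disjoint_family_on_def
        proof (intro ballI impI)
          fix A B assume AB: "A \<in> F" "B \<in> F" "A \<noteq> B"
          obtain s t where "A = cst s" "B = cst t" using AB F(1) by blast
          then show "A \<inter> B = {}" using AB(3) cst_eq[of _ s t] by blast
        qed
      qed
      also have "\<dots> \<le> 1" by (rule P.prob_le_1)
      finally have "real (card F) \<le> 1 / measure \<mu> H" using pos by (simp add: pos_le_divide_eq)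
      then show ?thesis by (simp add: le_nat_floor)
    qed
    have "finite (range cst)"
    proof (rule ccontr)
      assume "infinite (range cst)"
      then obtain F where "F \<subseteq> range cst" "finite F" "card F = Suc (nat \<lfloor>1 / measure \<mu> H\<rfloor>)"
        using infinite_arbitrarily_large by blast
      with card_le[of F] show False by simp
    qed
    then have "closed (\<Union>(range cst - {H}))" using cst_closed by (intro closed_Union) auto
    moreover have "- H = \<Union>(range cst - {H})"
    proof (intro equalityI subsetI)
      fix x assume "x \<in> - H"
      then have "cst x \<noteq> H" using cst_self[of x] by auto
      then show "x \<in> \<Union>(range cst - {H})" using cst_self[of x] by blast
    next
      fix x assume "x \<in> \<Union>(range cst - {H})"
      then obtain s where "x \<in> cst s" "cst s \<noteq> H" by blast
      then show "x \<in> - H" using cst_eq[of x s "\<one>\<^bsub>G\<^esub>"] cst_one by auto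
    qed
    ultimately have "closed (- H)" by simp
    then have "open H" by (simp add: open_closed)
    then have "H = {} \<or> H = UNIV" using conn H_closed by (simp add: connected_clopen)
    then have "H = UNIV" using H_one by blast
    then have L: "L s g = g" for s using H_L by blast
    have "g x = g \<one>\<^bsub>G\<^esub>" for x
      using fun_cong[OF L[of x], of x] by (simp add: L_def)
    then show False using g[of "g \<one>\<^bsub>G\<^esub>"] by (simp add: fun_eq_iff)
  qed
  moreover have "H \<in> sets \<mu>" using H_closed by (simp add: sets_haar)
  ultimately have "H \<in> null_sets \<mu>" by (simp add: null_sets_def P.emeasure_eq_measure)
  from AE_not_in[OF this] show ?thesis by (simp add: H_def)
qed

end

section \<open>The ring of essentially bounded functions\<close>

context
  fixes \<mu> :: "'g measure"
  assumes prob: "prob_space \<mu>"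
begin

lemma ess_boundedI:
  "f \<in> borel_measurable \<mu> \<Longrightarrow> AE x in \<mu>. cmod (f x) \<le> c \<Longrightarrow> f \<in> ess_bounded \<mu>"
  by (auto simp: ess_bounded_def)

lemma ess_bounded_cring: "cring (fun_ring (ess_bounded \<mu>))"
proof (rule fun_ring_cring)
  show "(\<lambda>_. 0) \<in> ess_bounded \<mu>" by (rule ess_boundedI[of _ 0]) auto
  show "(\<lambda>_. 1) \<in> ess_bounded \<mu>" by (rule ess_boundedI[of _ 1]) auto
  fix f assume f: "f \<in> ess_bounded \<mu>"
  then obtain c where c: "f \<in> borel_measurable \<mu>" "AE x in \<mu>. cmod (f x) \<le> c" by (auto simp: ess_bounded_def)
  show "(\<lambda>x. - f x) \<in> ess_bounded \<mu>" by (rule ess_boundedI[of _ c]) (use c in auto)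
  fix g assume "g \<in> ess_bounded \<mu>"
  then obtain b where b: "g \<in> borel_measurable \<mu>" "AE x in \<mu>. cmod (g x) \<le> b" by (auto simp: ess_bounded_def)
  show "(\<lambda>x. f x + g x) \<in> ess_bounded \<mu>"
  proof (rule ess_boundedI[of _ "c + b"])
    show "AE x in \<mu>. cmod (f x + g x) \<le> c + b"
      using c(2) b(2) by eventually_elim (rule norm_triangle_le, simp)
  qed (use c b in auto)
  show "(\<lambda>x. f x * g x) \<in> ess_bounded \<mu>"
  proof (rule ess_boundedI[of _ "\<bar>c\<bar> * \<bar>b\<bar>"])
    show "AE x in \<mu>. cmod (f x * g x) \<le> \<bar>c\<bar> * \<bar>b\<bar>"
      using c(2) b(2) by eventually_elim (auto simp: norm_mult intro!: mult_mono)
  qed (use c b in auto)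
qed

lemma ae_zero_ideal: "ideal (ae_zero \<mu>) (fun_ring (ess_bounded \<mu>))"
proof -
  interpret B: cring "fun_ring (ess_bounded \<mu>)" by (rule ess_bounded_cring)
  have zero: "f \<in> ae_zero \<mu> \<longleftrightarrow> f \<in> carrier (fun_ring (ess_bounded \<mu>)) \<and> (AE x in \<mu>. f x = 0)" for f
    by (simp add: ae_zero_def fun_ring_def)
  have uminus: "\<ominus>\<^bsub>fun_ring (ess_bounded \<mu>)\<^esub> f = (\<lambda>x. - f x)" if "f \<in> carrier (fun_ring (ess_bounded \<mu>))" for f
  proof (rule B.minus_equality)
    have "f \<in> ess_bounded \<mu>" using that by (simp add: fun_ring_def)
    then show "(\<lambda>x. - f x) \<in> carrier (fun_ring (ess_bounded \<mu>))"
      by (auto simp: fun_ring_def ess_bounded_def)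
    show "(\<lambda>x. - f x) \<oplus>\<^bsub>fun_ring (ess_bounded \<mu>)\<^esub> f = \<zero>\<^bsub>fun_ring (ess_bounded \<mu>)\<^esub>" by (simp add: fun_ring_def)
  qed (rule that)
  show ?thesis
  proof (rule idealI[OF B.ring_axioms])
    show "subgroup (ae_zero \<mu>) (add_monoid (fun_ring (ess_bounded \<mu>)))"
    proof (rule B.add.subgroupI)
      show "ae_zero \<mu> \<subseteq> carrier (fun_ring (ess_bounded \<mu>))" using zero by blast
      have "\<zero>\<^bsub>fun_ring (ess_bounded \<mu>)\<^esub> \<in> ae_zero \<mu>" unfolding zero by (simp add: fun_ring_def B.zero_closed[unfolded fun_ring_def, simplified])
      then show "ae_zero \<mu> \<noteq> {}" by blast
      fix f assume f: "f \<in> ae_zero \<mu>"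
      then have "\<ominus>\<^bsub>fun_ring (ess_bounded \<mu>)\<^esub> f \<in> ae_zero \<mu>"
        using zero[of f] B.a_inv_closed[of f] unfolding zero[of "\<ominus>\<^bsub>fun_ring (ess_bounded \<mu>)\<^esub> f"]
        by (simp add: uminus)
      then show "\<ominus>\<^bsub>fun_ring (ess_bounded \<mu>)\<^esub> f \<in> ae_zero \<mu>" .
      fix g assume g: "g \<in> ae_zero \<mu>"
      have "AE x in \<mu>. f x = 0" "AE x in \<mu>. g x = 0" using f g zero by auto
      then have "AE x in \<mu>. f x + g x = 0" by eventually_elim simp
      then show "f \<oplus>\<^bsub>fun_ring (ess_bounded \<mu>)\<^esub> g \<in> ae_zero \<mu>"
        using f g B.a_closed[of f g] zero unfolding zero[of "f \<oplus>\<^bsub>fun_ring (ess_bounded \<mu>)\<^esub> g"]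
        by (simp add: fun_ring_def)
    qed
  next
    fix f g assume f: "f \<in> ae_zero \<mu>" and g: "g \<in> carrier (fun_ring (ess_bounded \<mu>))"
    have "AE x in \<mu>. f x = 0" using f zero by auto
    then have "AE x in \<mu>. g x * f x = 0" by eventually_elim simp
    then show "g \<otimes>\<^bsub>fun_ring (ess_bounded \<mu>)\<^esub> f \<in> ae_zero \<mu>"
      using f g B.m_closed[of g f] zero unfolding zero[of "g \<otimes>\<^bsub>fun_ring (ess_bounded \<mu>)\<^esub> f"]
      by (simp add: fun_ring_def)
    have "AE x in \<mu>. f x * g x = 0" using \<open>AE x in \<mu>. f x = 0\<close> by eventually_elim simp
    then show "f \<otimes>\<^bsub>fun_ring (ess_bounded \<mu>)\<^esub> g \<in> ae_zero \<mu>"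
      using f g B.m_closed[of f g] zero unfolding zero[of "f \<otimes>\<^bsub>fun_ring (ess_bounded \<mu>)\<^esub> g"]
      by (simp add: fun_ring_def)
  qed
qed

lemma Linf_cring: "cring (Linf \<mu>)"
  unfolding Linf_def by (rule ideal.quotient_is_cring[OF ae_zero_ideal ess_bounded_cring])

lemma Linf_class_hom: "Linf_class \<mu> \<in> ring_hom (fun_ring (ess_bounded \<mu>)) (Linf \<mu>)"
proof -
  have "Linf_class \<mu> = (+>\<^bsub>fun_ring (ess_bounded \<mu>)\<^esub>) (ae_zero \<mu>)" by (rule ext) (simp add: Linf_class_def)
  then show ?thesis unfolding Linf_def using ideal.rcos_ring_hom[OF ae_zero_ideal] by simp
qed

lemma Linf_carrierE:
  assumes "X \<in> carrier (Linf \<mu>)" obtains f where "f \<in> ess_bounded \<mu>" "X = Linf_class \<mu> f"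
  using assms by (auto simp: Linf_def FactRing_def A_RCOSETS_def' Linf_class_def fun_ring_def a_r_coset_def')

lemma Linf_zero: "\<zero>\<^bsub>Linf \<mu>\<^esub> = ae_zero \<mu>"
  by (simp add: Linf_def FactRing_def)

lemma Linf_class_zero_iff:
  assumes "f \<in> ess_bounded \<mu>" shows "Linf_class \<mu> f = \<zero>\<^bsub>Linf \<mu>\<^esub> \<longleftrightarrow> (AE x in \<mu>. f x = 0)"
proof -
  interpret I: ideal "ae_zero \<mu>" "fun_ring (ess_bounded \<mu>)" by (rule ae_zero_ideal)
  have f: "f \<in> carrier (fun_ring (ess_bounded \<mu>))" using assms by (simp add: fun_ring_def)
  have "Linf_class \<mu> f = ae_zero \<mu> \<longleftrightarrow> f \<in> ae_zero \<mu>"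
    unfolding Linf_class_def using I.a_rcos_self[OF f] I.a_rcos_const[of f] by metis
  then show ?thesis using assms by (simp add: Linf_zero ae_zero_def)
qed

text \<open>If a product \<open>a f\<close> vanishes almost everywhere, then so does \<open>f\<close>, because the zeros of \<open>a\<close> are null.\<close>

lemma Linf_regular:
  assumes a: "a \<in> ess_bounded \<mu>" and nz: "AE x in \<mu>. a x \<noteq> 0"
    and X: "X \<in> carrier (Linf \<mu>)" and eq: "Linf_class \<mu> a \<otimes>\<^bsub>Linf \<mu>\<^esub> X = \<zero>\<^bsub>Linf \<mu>\<^esub>"
  shows "X = \<zero>\<^bsub>Linf \<mu>\<^esub>"
proof -
  interpret B: cring "fun_ring (ess_bounded \<mu>)" by (rule ess_bounded_cring)
  obtain f where f: "f \<in> ess_bounded \<mu>" "X = Linf_class \<mu> f" using Linf_carrierE[OF X] by blast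
  have car: "carrier (fun_ring (ess_bounded \<mu>)) = ess_bounded \<mu>" by (simp add: fun_ring_def)
  have mult: "a \<otimes>\<^bsub>fun_ring (ess_bounded \<mu>)\<^esub> f = (\<lambda>x. a x * f x)" by (simp add: fun_ring_def)
  have "Linf_class \<mu> (\<lambda>x. a x * f x) = \<zero>\<^bsub>Linf \<mu>\<^esub>"
    using ring_hom_mult[OF Linf_class_hom, of a f] a f eq by (simp add: car mult)
  moreover have "(\<lambda>x. a x * f x) \<in> ess_bounded \<mu>" using B.m_closed[of a f] a f by (simp add: car mult)
  ultimately have "AE x in \<mu>. a x * f x = 0" using Linf_class_zero_iff by blast
  with nz have "AE x in \<mu>. f x = 0" by eventually_elim simp
  then show ?thesis using f Linf_class_zero_iff by simp
qed

lemma haar_trace_zero: "haar_trace \<mu> \<zero>\<^bsub>Linf \<mu>\<^esub> = 0"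
proof -
  have "(\<lambda>_. 0) \<in> ae_zero \<mu>" by (auto simp: ae_zero_def intro: ess_boundedI[of _ 0])
  then have "(SOME f. f \<in> ae_zero \<mu>) \<in> ae_zero \<mu>" by (rule someI[of "\<lambda>f. f \<in> ae_zero \<mu>"])
  then have "AE x in \<mu>. (SOME f. f \<in> ae_zero \<mu>) x = 0" by (simp add: ae_zero_def)
  then show ?thesis unfolding haar_trace_def Linf_zero by (rule integral_eq_zero_AE)
qed

end

lemma (in compact_group) coeffs_ess_bounded: "coeffs G \<subseteq> ess_bounded \<mu>"
proof
  fix f assume "f \<in> coeffs G"
  then have f: "continuous_on UNIV f" by (rule coeffs_continuous[OF carrier])
  obtain b where "\<And>x. norm (f x) \<le> b" using cont_bounded[OF f] by blast
  then show "f \<in> ess_bounded \<mu>"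
    using measurable_haar[OF f] by (intro ess_boundedI[OF P.prob_space_axioms, of f b]) auto
qed

lemma (in compact_group) base_change_Linf: "base_change (Linf \<mu>) (coeff_algebra G) (Linf_class \<mu>)"
proof (intro base_change.intro base_change_axioms.intro)
  show "cring (Linf \<mu>)" by (rule Linf_cring[OF P.prob_space_axioms])
  show "cring (coeff_algebra G)" by (rule coeff_algebra_cring[OF group carrier])
  note hom = Linf_class_hom[OF P.prob_space_axioms]
  have car: "carrier (fun_ring (ess_bounded \<mu>)) = ess_bounded \<mu>" by (simp add: fun_ring_def)
  have ops: "\<one>\<^bsub>coeff_algebra G\<^esub> = \<one>\<^bsub>fun_ring (ess_bounded \<mu>)\<^esub>"
    "f \<otimes>\<^bsub>coeff_algebra G\<^esub> g = f \<otimes>\<^bsub>fun_ring (ess_bounded \<mu>)\<^esub> g"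
    "f \<oplus>\<^bsub>coeff_algebra G\<^esub> g = f \<oplus>\<^bsub>fun_ring (ess_bounded \<mu>)\<^esub> g" for f g
    by (simp_all add: coeff_algebra_def fun_ring_def)
  show "Linf_class \<mu> \<in> ring_hom (coeff_algebra G) (Linf \<mu>)"
    using coeffs_ess_bounded hom
    by (intro ring_hom_memI) (auto simp: ops car subset_iff ring_hom_mult[OF hom] ring_hom_add[OF hom]
        ring_hom_one[OF hom] intro: ring_hom_closed[OF hom])
qed

section \<open>Vanishing of the Betti numbers\<close>

theorem corollary3p4:
  fixes G :: "'g::{t2_space, second_countable_topology} monoid"
    and \<A> :: "('g set \<times> ('g \<Rightarrow> 'e::euclidean_space)) set"
    and \<mu> :: "'g measure"
    and n :: nat
  assumes "lie_group G \<A>"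
    and "compact (UNIV :: 'g set)"
    and "connected (UNIV :: 'g set)"
    and "carrier G \<noteq> {\<one>\<^bsub>G\<^esub>}"
    and "haar_probability G \<mu>"
  shows "l2_betti G \<mu> n = 0"
proof -
  interpret compact_group G \<mu>
    using assms by (simp add: compact_group_def lie_group_def)
  have "UNIV \<noteq> {\<one>\<^bsub>G\<^esub>}" using assms(4) carrier by simp
  then obtain a g where a: "a \<in> coeffs G" and g: "g \<in> C" "\<And>c. g \<noteq> (\<lambda>_. c)"
    and ag: "\<And>s. a s = 0 \<longleftrightarrow> L s g = g"
    by (rule stabilizer_function) (rule that)
  have nz: "AE s in \<mu>. a s \<noteq> 0"
    by (rule stabilizer_null[OF assms(3) coeffs_continuous[OF carrier a] g(2) ag])
  have a_one: "a \<one>\<^bsub>G\<^esub> = 0" by (simp add: ag) (simp add: L_def)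
  have ab: "a \<in> ess_bounded \<mu>" using a coeffs_ess_bounded by blast
  note prob = P.prob_space_axioms
  show ?thesis unfolding l2_betti_def
  proof (rule lueck_dim_annihilated[where c = "Linf_class \<mu> a", OF Linf_cring[OF prob]])
    show "Linf_class \<mu> a \<in> carrier (Linf \<mu>)"
      by (rule base_change.i_closed[OF base_change_Linf a])
    show "s = \<zero>\<^bsub>Linf \<mu>\<^esub>" if "s \<in> carrier (Linf \<mu>)" "Linf_class \<mu> a \<otimes>\<^bsub>Linf \<mu>\<^esub> s = \<zero>\<^bsub>Linf \<mu>\<^esub>" for s
      by (rule Linf_regular[OF prob ab nz that])
    show "haar_trace \<mu> \<zero>\<^bsub>Linf \<mu>\<^esub> = 0" by (rule haar_trace_zero[OF prob])
    show "Linf_class \<mu> a \<odot>\<^bsub>Tor (Linf \<mu>) (coeff_algebra G) (Linf_class \<mu>) (counit_module G) n\<^esub> x =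
        \<zero>\<^bsub>Tor (Linf \<mu>) (coeff_algebra G) (Linf_class \<mu>) (counit_module G) n\<^esub>"
      if "x \<in> carrier (Tor (Linf \<mu>) (coeff_algebra G) (Linf_class \<mu>) (counit_module G) n)" for x
      by (rule Tor_annihilated[OF base_change_Linf counit_module[OF group carrier] a _ that])
         (simp add: counit_module_def a_one)
  qed
qed

end
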